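(* Let $G=\mathbb{C}^*$ and let $V$ be a $G$-module whose positive weights (listed with multiplicity) are $r_1\le\dots\le r_d$, $d\ge 1$, and whose negative weights (listed with multiplicity) are $-s_1\le\dots\le -s_e$, $e\ge 1$, where the greatest common divisor of the $r_i$ and $s_j$ is $1$. Let $Z=V/\!\!/G$. Then $p_\infty^*\colon\mathcal{O}(Z_\infty)\to\mathcal{O}(V_\infty)^{G_\infty}$ is surjective only in the following cases: (1) $d=1$ and $r_1=1$, or $e=1$ and $s_1=1$. In this case $Z'=Z$, so that $p_m^*\colon\mathcal{O}(Z_m)\to\mathcal{O}(V_m)^{G_m}$ is an isomorphism for all $m$. (2) All the $r_i$ and $s_j$ are $1$.
   Context: A $G$-module is a finite-dimensional rational representation; $V$ may also have zero weights. For a scheme $X$ of finite type over $\mathbb{C}$ and an integer $m\ge 0$, the jet scheme $X_m$ is characterized by functorial bijections $\mathrm{Hom}(\mathrm{Spec}\,A,X_m)\cong\mathrm{Hom}(\mathrm{Spec}\,A[t]/\langle t^{m+1}\rangle,X)$ for $\mathbb{C}$-algebras $A$; the arc space is $X_\infty=\varprojlim X_m$. $V/\!\!/G=\mathrm{Spec}(\mathcal{O}(V)^G)$ with canonical map $p\colon V\to V/\!\!/G$. By functoriality $G_m$ acts on $V_m$, and $p$ induces $p_m$ and $p_m^*\colon\mathcal{O}((V/\!\!/G)_m)\to\mathcal{O}(V_m)^{G_m}$ ($m$ finite or $\infty$). Let $V'$ be the set of points of $V$ where $dp$ has maximal rank (i.e. rank $\dim Z$, computed with $p=(p_1,\dots,p_k)$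 for generators $p_i$ of $\mathcal{O}(V)^G$); $Z'=p(V')\subset Z$. *)

theory Defs
  imports
    "HOL-Analysis.Derivative"
    "HOL-Library.Poly_Mapping"
    "HOL-Library.Extended_Nat"
    "HOL-Computational_Algebra.Formal_Power_Series"
    "HOL-Algebra.QuotRing"
    "Jordan_Normal_Form.DL_Rank"
begin

text \<open>Polynomials with complex coefficients in variables of type \<open>'v\<close>\<close>

type_synonym 'v cpoly = "('v \<Rightarrow>\<^sub>0 nat) \<Rightarrow>\<^sub>0 complex"

definition pconst :: "complex \<Rightarrow> 'v cpoly" where
  "pconst c = Poly_Mapping.single 0 c"

definition pvar :: "'v \<Rightarrow> 'v cpoly" where
  "pvar v = Poly_Mapping.single (Poly_Mapping.single v 1) 1"

definition poly_ring :: "'v set \<Rightarrow> 'v cpoly ring" where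
  "poly_ring W = class_ring\<lparr>carrier := {f. \<forall>\<mu>\<in>Poly_Mapping.keys f. Poly_Mapping.keys \<mu> \<subseteq> W}\<rparr>"

text \<open>\<open>psubst \<iota> g f\<close> substitutes \<open>g v\<close> for the variable \<open>v\<close> in \<open>f\<close>; the map \<open>\<iota>\<close> is the structure
  map of the \<open>\<complex>\<close>-algebra that contains the values.\<close>

definition psubst :: "(complex \<Rightarrow> 'a::comm_ring_1) \<Rightarrow> ('v \<Rightarrow> 'a) \<Rightarrow> 'v cpoly \<Rightarrow> 'a" where
  "psubst \<iota> g f = (\<Sum>\<mu>\<in>Poly_Mapping.keys f. \<iota> (Poly_Mapping.lookup f \<mu>) * (\<Prod>v\<in>Poly_Mapping.keys \<mu>. g v ^ Poly_Mapping.lookup \<mu> v))"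

abbreviation peval :: "('v \<Rightarrow> complex) \<Rightarrow> 'v cpoly \<Rightarrow> complex" where
  "peval \<equiv> psubst (\<lambda>c. c)"

lemma poly_mapping_sum_single: "f = (\<Sum>\<mu>\<in>Poly_Mapping.keys f. Poly_Mapping.single \<mu> (Poly_Mapping.lookup f \<mu>))"
proof (rule poly_mapping_eqI)
  fix \<nu>
  have "Poly_Mapping.lookup (\<Sum>\<mu>\<in>Poly_Mapping.keys f. Poly_Mapping.single \<mu> (Poly_Mapping.lookup f \<mu>)) \<nu>
      = (\<Sum>\<mu>\<in>Poly_Mapping.keys f. if \<mu> = \<nu> then Poly_Mapping.lookup f \<mu> else 0)"
    by (simp add: lookup_sum lookup_single when_def)
  also have "\<dots> = Poly_Mapping.lookup f \<nu>"
    by (simp add: in_keys_iff)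
  finally show "Poly_Mapping.lookup f \<nu> =
    Poly_Mapping.lookup (\<Sum>\<mu>\<in>Poly_Mapping.keys f. Poly_Mapping.single \<mu> (Poly_Mapping.lookup f \<mu>)) \<nu>" ..
qed

context
  fixes \<iota> :: "complex \<Rightarrow> 'a::comm_ring_1" and g :: "'v \<Rightarrow> 'a"
  assumes hom: "comm_ring_hom \<iota>"
begin

interpretation comm_ring_hom \<iota> by (rule hom)

lemma psubst_superset:
  assumes "finite A" "Poly_Mapping.keys f \<subseteq> A"
  shows "psubst \<iota> g f = (\<Sum>\<mu>\<in>A. \<iota> (Poly_Mapping.lookup f \<mu>) * (\<Prod>v\<in>Poly_Mapping.keys \<mu>. g v ^ Poly_Mapping.lookup \<mu> v))"
  unfolding psubst_def by (rule sum.mono_neutral_left) (use assms in \<open>auto simp: in_keys_iff\<close>)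

lemma psubst_add: "psubst \<iota> g (f + h) = psubst \<iota> g f + psubst \<iota> g h"
proof -
  let ?A = "Poly_Mapping.keys f \<union> Poly_Mapping.keys h"
  have "Poly_Mapping.keys (f + h) \<subseteq> ?A" by (rule keys_add)
  then show ?thesis
    by (simp add: psubst_superset[of ?A] lookup_add hom_add algebra_simps sum.distrib)
qed

lemma psubst_zero: "psubst \<iota> g 0 = 0"
  by (simp add: psubst_def)

lemma psubst_sum: "psubst \<iota> g (sum F A) = (\<Sum>x\<in>A. psubst \<iota> g (F x))"
  by (induction A rule: infinite_finite_induct) (simp_all add: psubst_zero psubst_add)

lemma psubst_uminus: "psubst \<iota> g (- f) = - psubst \<iota> g f"
  using psubst_add[of f "- f"] by (simp add: psubst_zero minus_unique)

lemma psubst_diff: "psubst \<iota> g (f - h) = psubst \<iota> g f - psubst \<iota> g h"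
  using psubst_add[of f "- h"] by (simp add: psubst_uminus)

lemma psubst_single:
  "psubst \<iota> g (Poly_Mapping.single \<mu> c) = \<iota> c * (\<Prod>v\<in>Poly_Mapping.keys \<mu>. g v ^ Poly_Mapping.lookup \<mu> v)"
  by (simp add: psubst_superset[of "{\<mu>}"])

lemma monom_value_add:
  "(\<Prod>v\<in>Poly_Mapping.keys (\<mu> + \<nu>). g v ^ Poly_Mapping.lookup (\<mu> + \<nu>) v) =
   (\<Prod>v\<in>Poly_Mapping.keys \<mu>. g v ^ Poly_Mapping.lookup \<mu> v) *
   (\<Prod>v\<in>Poly_Mapping.keys \<nu>. g v ^ Poly_Mapping.lookup \<nu> v)"
proof -
  let ?A = "Poly_Mapping.keys \<mu> \<union> Poly_Mapping.keys \<nu>"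
  have *: "(\<Prod>v\<in>Poly_Mapping.keys \<xi>. g v ^ Poly_Mapping.lookup \<xi> v) = (\<Prod>v\<in>?A. g v ^ Poly_Mapping.lookup \<xi> v)"
    if "Poly_Mapping.keys \<xi> \<subseteq> ?A" for \<xi>
    by (rule prod.mono_neutral_left) (use that in \<open>auto simp: in_keys_iff\<close>)
  show ?thesis
    unfolding *[OF keys_add] *[OF Un_upper1] *[OF Un_upper2]
    by (simp add: lookup_add power_add prod.distrib)
qed

lemma psubst_mult: "psubst \<iota> g (f * h) = psubst \<iota> g f * psubst \<iota> g h"
proof -
  let ?s = "\<lambda>f \<mu>. Poly_Mapping.single \<mu> (Poly_Mapping.lookup f \<mu>)"
  have "f * h = (\<Sum>\<mu>\<in>Poly_Mapping.keys f. ?s f \<mu>) * (\<Sum>\<nu>\<in>Poly_Mapping.keys h. ?s h \<nu>)"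
    using poly_mapping_sum_single by metis
  also have "\<dots> = (\<Sum>\<mu>\<in>Poly_Mapping.keys f. \<Sum>\<nu>\<in>Poly_Mapping.keys h.
      Poly_Mapping.single (\<mu> + \<nu>) (Poly_Mapping.lookup f \<mu> * Poly_Mapping.lookup h \<nu>))"
    by (simp add: sum_product mult_single)
  also have "psubst \<iota> g \<dots> = psubst \<iota> g f * psubst \<iota> g h"
    by (simp add: psubst_sum psubst_single monom_value_add hom_mult psubst_def[of _ _ f] psubst_def[of _ _ h]
        sum_product mult_ac)
  finally show ?thesis .
qed

lemma psubst_pconst: "psubst \<iota> g (pconst c) = \<iota> c"
  by (simp add: pconst_def psubst_single)

lemma psubst_pvar: "psubst \<iota> g (pvar v) = g v"
  by (simp add: pvar_def psubst_single)

lemma psubst_one: "psubst \<iota> g 1 = 1"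
  using psubst_pconst[of 1] by (simp add: pconst_def)

end

lemma pconst_hom: "comm_ring_hom pconst"
  by unfold_locales (simp_all add: pconst_def single_add mult_single)


lemma poly_ring_simps:
  "\<one>\<^bsub>poly_ring W\<^esub> = 1" "\<zero>\<^bsub>poly_ring W\<^esub> = 0" "f \<oplus>\<^bsub>poly_ring W\<^esub> g = f + g" "f \<otimes>\<^bsub>poly_ring W\<^esub> g = f * g"
  by (simp_all add: poly_ring_def)

lemma poly_ring_carrier: "f \<in> carrier (poly_ring W) \<longleftrightarrow> (\<forall>\<mu>\<in>Poly_Mapping.keys f. Poly_Mapping.keys \<mu> \<subseteq> W)"
  by (simp add: poly_ring_def)

lemma poly_ring_closed:
  "pconst c \<in> carrier (poly_ring W)"
  "v \<in> W \<Longrightarrow> pvar v \<in> carrier (poly_ring W)"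
  "f \<in> carrier (poly_ring W) \<Longrightarrow> g \<in> carrier (poly_ring W) \<Longrightarrow> f + g \<in> carrier (poly_ring W)"
  "f \<in> carrier (poly_ring W) \<Longrightarrow> - f \<in> carrier (poly_ring W)"
  "f \<in> carrier (poly_ring W) \<Longrightarrow> g \<in> carrier (poly_ring W) \<Longrightarrow> f * g \<in> carrier (poly_ring W)"
  "0 \<in> carrier (poly_ring W)" "1 \<in> carrier (poly_ring W)"
proof -
  show "f + g \<in> carrier (poly_ring W)" if "f \<in> carrier (poly_ring W)" "g \<in> carrier (poly_ring W)"
    using that keys_add[of f g] by (auto simp: poly_ring_carrier)
  show "f * g \<in> carrier (poly_ring W)" if fg: "f \<in> carrier (poly_ring W)" "g \<in> carrier (poly_ring W)"
    unfolding poly_ring_carrier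
  proof
    fix \<mu> assume "\<mu> \<in> Poly_Mapping.keys (f * g)"
    then obtain \<alpha> \<beta> where "\<mu> = \<alpha> + \<beta>" "\<alpha> \<in> Poly_Mapping.keys f" "\<beta> \<in> Poly_Mapping.keys g"
      using keys_mult[of f g] by blast
    then show "Poly_Mapping.keys \<mu> \<subseteq> W"
      using fg keys_add[of \<alpha> \<beta>] unfolding poly_ring_carrier by blast
  qed
qed (auto simp: poly_ring_carrier pconst_def pvar_def in_keys_iff)

lemma poly_ring_diff_closed:
  "f \<in> carrier (poly_ring W) \<Longrightarrow> g \<in> carrier (poly_ring W) \<Longrightarrow> f - g \<in> carrier (poly_ring W)"
  using poly_ring_closed(3)[of f W "- g"] poly_ring_closed(4)[of g W] by simp

lemma poly_ring_sum_closed: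
  "(\<And>x. x \<in> A \<Longrightarrow> F x \<in> carrier (poly_ring W)) \<Longrightarrow> sum F A \<in> carrier (poly_ring W)"
  by (induction A rule: infinite_finite_induct) (auto intro: poly_ring_closed)

lemma poly_ring_cring: "cring (poly_ring W)"
proof (rule cringI)
  show "abelian_group (poly_ring W)"
  proof (rule abelian_groupI)
    fix x assume "x \<in> carrier (poly_ring W)"
    then show "\<exists>y\<in>carrier (poly_ring W). y \<oplus>\<^bsub>poly_ring W\<^esub> x = \<zero>\<^bsub>poly_ring W\<^esub>"
      by (intro bexI[of _ "- x"]) (auto simp: poly_ring_simps poly_ring_closed)
  qed (auto simp: poly_ring_simps poly_ring_closed algebra_simps)
  show "Group.comm_monoid (poly_ring W)"
    by (rule comm_monoidI) (auto simp: poly_ring_simps poly_ring_closed algebra_simps)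
qed (auto simp: poly_ring_simps algebra_simps)

lemma poly_ring_induct [consumes 1, case_names const var add mult]:
  assumes f: "f \<in> carrier (poly_ring W)"
    and const: "\<And>c. P (pconst c)" and var: "\<And>v. v \<in> W \<Longrightarrow> P (pvar v)"
    and add: "\<And>f g. f \<in> carrier (poly_ring W) \<Longrightarrow> g \<in> carrier (poly_ring W) \<Longrightarrow> P f \<Longrightarrow> P g \<Longrightarrow> P (f + g)"
    and mult: "\<And>f g. f \<in> carrier (poly_ring W) \<Longrightarrow> g \<in> carrier (poly_ring W) \<Longrightarrow> P f \<Longrightarrow> P g \<Longrightarrow> P (f * g)"
  shows "P f"
proof -
  define Q where "Q f \<longleftrightarrow> f \<in> carrier (poly_ring W) \<and> P f" for f
  have Q: "Q (pconst c)" "v \<in> W \<Longrightarrow> Q (pvar v)" "Q f \<Longrightarrow> Q g \<Longrightarrow> Q (f + g)" "Q f \<Longrightarrow> Q g \<Longrightarrow> Q (f * g)"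
    for c v f g
    by (auto simp: Q_def const var add mult poly_ring_closed)
  have Q0: "Q 0" and Q1: "Q 1" using Q(1)[of 0] Q(1)[of 1] by (simp_all add: pconst_def)
  have pow: "Q (Poly_Mapping.single (Poly_Mapping.single v n) 1)" if "v \<in> W" for v n
  proof (induction n)
    case (Suc n)
    have "Poly_Mapping.single (Poly_Mapping.single v (Suc n)) 1 =
        pvar v * Poly_Mapping.single (Poly_Mapping.single v n) 1"
      by (simp add: pvar_def mult_single flip: single_add)
    then show ?case using Q(4)[OF Q(2)[OF that] Suc] by simp
  qed (use Q1 in simp)
  have mon: "Q (Poly_Mapping.single (\<Sum>v\<in>A. Poly_Mapping.single v (n v)) 1)" if "finite A" "A \<subseteq> W" for A n
    using that
  proof (induction A)
    case (insert v A)
    have "Poly_Mapping.single (\<Sum>v\<in>insert v A. Poly_Mapping.single v (n v)) (1::complex) =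
      Poly_Mapping.single (Poly_Mapping.single v (n v)) 1 *
      Poly_Mapping.single (\<Sum>v\<in>A. Poly_Mapping.single v (n v)) 1"
      using insert by (simp add: mult_single)
    then show ?case using insert Q(4)[OF pow[of v "n v"]] by simp
  qed (use Q1 in simp)
  have "Q (Poly_Mapping.single \<mu> c)" if "Poly_Mapping.keys \<mu> \<subseteq> W" for \<mu> c
  proof -
    have "Q (Poly_Mapping.single \<mu> 1)"
      using mon[OF finite_keys that, of "Poly_Mapping.lookup \<mu>"] poly_mapping_sum_single[of \<mu>] by simp
    from Q(4)[OF Q(1)[of c] this] show ?thesis by (simp add: pconst_def mult_single)
  qed
  then have "Q (\<Sum>\<mu>\<in>A. Poly_Mapping.single \<mu> (Poly_Mapping.lookup f \<mu>))"
    if "A \<subseteq> Poly_Mapping.keys f" for A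
    using infinite_super[OF that] that f
    by (induction A rule: infinite_finite_induct) (auto simp: Q0 Q(3) poly_ring_carrier)
  from this[OF subset_refl] show ?thesis
    using poly_mapping_sum_single[of f] by (simp add: Q_def)
qed

lemma psubst_ring_hom:
  "comm_ring_hom \<iota> \<Longrightarrow> psubst \<iota> g \<in> Ring.ring_hom (poly_ring W) class_ring"
  by (rule ring_hom_memI) (auto simp: poly_ring_simps psubst_add psubst_mult psubst_one)

text \<open>Krull dimension: the supremum of the lengths \<open>n\<close> of chains \<open>P\<^sub>0 \<subset> \<dots> \<subset> P\<^sub>n\<close> of prime ideals\<close>

definition krull_dim :: "('a, 'c) ring_scheme \<Rightarrow> enat" where
  "krull_dim R = Sup {enat n | n. \<exists>P. (\<forall>i\<le>n. primeideal (P i) R) \<and> (\<forall>i<n. P i \<subset> P (Suc i))}"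


section \<open>Jet schemes of affine schemes\<close>

text \<open>An affine scheme \<open>X\<close> is given by its coordinate ring \<open>R\<close> with structure map \<open>\<kappa>\<close>. A point of \<open>X\<close>
  with values in \<open>A[t]/(t\<^sup>m\<^sup>+\<^sup>1)\<close> (in \<open>A[[t]]\<close> for \<open>m = \<infinity>\<close>) is a \<open>\<complex>\<close>-algebra map
  \<open>a \<mapsto> \<Sum>k\<le>m. D a k t\<^sup>k\<close> on \<open>R\<close>; it is described by its coefficients \<open>D a k\<close>, where \<open>k \<le> m\<close>.\<close>

definition jet_point ::
    "enat \<Rightarrow> ('b, 'c) ring_scheme \<Rightarrow> (complex \<Rightarrow> 'b) \<Rightarrow> (complex \<Rightarrow> 'a::comm_ring_1) \<Rightarrow> ('b \<Rightarrow> nat \<Rightarrow> 'a) \<Rightarrow> bool" where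
  "jet_point m R \<kappa> \<iota> D \<longleftrightarrow>
     (\<forall>a\<in>carrier R. \<forall>b\<in>carrier R. \<forall>k. enat k \<le> m \<longrightarrow>
        D (a \<oplus>\<^bsub>R\<^esub> b) k = D a k + D b k \<and>
        D (a \<otimes>\<^bsub>R\<^esub> b) k = (\<Sum>i\<le>k. D a i * D b (k - i))) \<and>
     (\<forall>c k. enat k \<le> m \<longrightarrow> D (\<kappa> c) k = (if k = 0 then \<iota> c else 0))"

text \<open>The coordinate ring of \<open>X\<^sub>m\<close>: it is generated by symbols \<open>(a, k)\<close>, standing for the coefficient of
  \<open>t\<^sup>k\<close> of the universal jet at \<open>a\<close>, subject to the identities that define \<^const>\<open>jet_point\<close>.
  That it represents the jet functor is shown in \<open>jet_algebra_universal\<close> below.\<close>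

definition jet_symbols :: "enat \<Rightarrow> ('b, 'c) ring_scheme \<Rightarrow> ('b \<times> nat) set" where
  "jet_symbols m R = carrier R \<times> {k. enat k \<le> m}"

definition jet_relations ::
    "enat \<Rightarrow> ('b, 'c) ring_scheme \<Rightarrow> (complex \<Rightarrow> 'b) \<Rightarrow> ('b \<times> nat) cpoly set" where
  "jet_relations m R \<kappa> =
     {pvar (a \<oplus>\<^bsub>R\<^esub> b, k) - (pvar (a, k) + pvar (b, k)) | a b k.
        a \<in> carrier R \<and> b \<in> carrier R \<and> enat k \<le> m} \<union>
     {pvar (a \<otimes>\<^bsub>R\<^esub> b, k) - (\<Sum>i\<le>k. pvar (a, i) * pvar (b, k - i)) | a b k.
        a \<in> carrier R \<and> b \<in> carrier R \<and> enat k \<le> m} \<union>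
     {pvar (\<kappa> c, k) - (if k = 0 then pconst c else 0) | c k. enat k \<le> m}"

definition jet_ideal ::
    "enat \<Rightarrow> ('b, 'c) ring_scheme \<Rightarrow> (complex \<Rightarrow> 'b) \<Rightarrow> ('b \<times> nat) cpoly set" where
  "jet_ideal m R \<kappa> = genideal (poly_ring (jet_symbols m R)) (jet_relations m R \<kappa>)"

definition jet_algebra ::
    "enat \<Rightarrow> ('b, 'c) ring_scheme \<Rightarrow> (complex \<Rightarrow> 'b) \<Rightarrow> ('b \<times> nat) cpoly set ring" where
  "jet_algebra m R \<kappa> = poly_ring (jet_symbols m R) Quot jet_ideal m R \<kappa>"

definition jet_class ::
    "enat \<Rightarrow> ('b, 'c) ring_scheme \<Rightarrow> (complex \<Rightarrow> 'b) \<Rightarrow> ('b \<times> nat) cpoly \<Rightarrow> ('b \<times> nat) cpoly set" where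
  "jet_class m R \<kappa> f = jet_ideal m R \<kappa> +>\<^bsub>poly_ring (jet_symbols m R)\<^esub> f"

text \<open>The map out of the jet algebra that corresponds to the jet \<open>D\<close>\<close>

definition jet_lift ::
    "(complex \<Rightarrow> 'a::comm_ring_1) \<Rightarrow> ('b \<Rightarrow> nat \<Rightarrow> 'a) \<Rightarrow> ('b \<times> nat) cpoly set \<Rightarrow> 'a" where
  "jet_lift \<iota> D X = the_elem (psubst \<iota> (\<lambda>(a, k). D a k) ` X)"


lemma enat_le_trans: "enat k \<le> m \<Longrightarrow> i \<le> k \<Longrightarrow> enat i \<le> m"
  by (erule order_trans[rotated]) simp

lemma jet_symbols_le: "a \<in> carrier R \<Longrightarrow> enat k \<le> m \<Longrightarrow> i \<le> k \<Longrightarrow> (a, i) \<in> jet_symbols m R"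
  using order_trans[of "enat i" "enat k" m] by (auto simp: jet_symbols_def)

lemma jet_relations_subset:
  assumes "cring R" "\<And>c. \<kappa> c \<in> carrier R"
  shows "jet_relations m R \<kappa> \<subseteq> carrier (poly_ring (jet_symbols m R))"
proof -
  interpret cring R by fact
  show ?thesis
    unfolding jet_relations_def
    by (auto intro!: poly_ring_diff_closed poly_ring_closed poly_ring_sum_closed
        simp: jet_symbols_def assms(2) elim!: enat_le_trans)
qed

lemma jet_lift_class:
  fixes \<iota> :: "complex \<Rightarrow> 'a::comm_ring_1"
  assumes R: "cring R" "\<And>c. \<kappa> c \<in> carrier R" and \<iota>: "comm_ring_hom \<iota>" and D: "jet_point m R \<kappa> \<iota> D"
  shows "jet_lift \<iota> D \<in> Ring.ring_hom (jet_algebra m R \<kappa>) class_ring"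
    and "f \<in> carrier (poly_ring (jet_symbols m R)) \<Longrightarrow>
      jet_lift \<iota> D (jet_class m R \<kappa> f) = psubst \<iota> (\<lambda>(a, k). D a k) f"
proof -
  let ?P = "poly_ring (jet_symbols m R)" and ?h = "psubst \<iota> (\<lambda>(a, k). D a k)"
  let ?I = "jet_ideal m R \<kappa>"
  interpret P: cring ?P by (rule poly_ring_cring)
  have A: "cring (class_ring :: 'a ring)" by unfold_locales
  have h: "ring_hom_ring ?P class_ring ?h"
    by (intro ring_hom_ringI2 cring.axioms(1) poly_ring_cring psubst_ring_hom \<iota> A)
  have K: "a_kernel ?P class_ring ?h = {x \<in> carrier ?P. ?h x = 0}"
    unfolding a_kernel_def' by simp
  have sub: "jet_relations m R \<kappa> \<subseteq> carrier ?P" by (rule jet_relations_subset) (fact R)+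
  interpret I: ideal ?I ?P unfolding jet_ideal_def by (rule P.genideal_ideal[OF sub])
  have "jet_relations m R \<kappa> \<subseteq> a_kernel ?P class_ring ?h"
  proof
    fix x assume x: "x \<in> jet_relations m R \<kappa>"
    have "?h x = 0"
      using x D unfolding jet_relations_def jet_point_def
      by (auto simp: psubst_diff[OF \<iota>] psubst_add[OF \<iota>] psubst_sum[OF \<iota>] psubst_mult[OF \<iota>]
          psubst_pvar[OF \<iota>] psubst_pconst[OF \<iota>] psubst_zero[OF \<iota>])
    moreover have "x \<in> carrier ?P" using x sub by blast
    ultimately show "x \<in> a_kernel ?P class_ring ?h" by (simp add: K)
  qed
  then have "?I \<subseteq> a_kernel ?P class_ring ?h"
    unfolding jet_ideal_def by (rule P.genideal_minimal[OF ring_hom_ring.kernel_is_ideal[OF h]])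
  then have I0: "?h x = 0" if "x \<in> ?I" for x
    using that unfolding K by blast
  have cls: "jet_lift \<iota> D (?I +>\<^bsub>?P\<^esub> f) = ?h f" if "f \<in> carrier ?P" for f
  proof -
    have "?h ` (?I +>\<^bsub>?P\<^esub> f) = {?h f}"
      using I.zero_closed
      by (auto simp: a_r_coset_def' poly_ring_simps psubst_add[OF \<iota>] I0 image_iff intro!: bexI[of _ 0])
    then show ?thesis by (simp add: jet_lift_def)
  qed
  then show "f \<in> carrier ?P \<Longrightarrow> jet_lift \<iota> D (jet_class m R \<kappa> f) = ?h f"
    by (simp add: jet_class_def)
  show "jet_lift \<iota> D \<in> Ring.ring_hom (jet_algebra m R \<kappa>) class_ring"
  proof (rule ring_hom_memI)
    have c: "carrier (jet_algebra m R \<kappa>) = (\<lambda>f. ?I +>\<^bsub>?P\<^esub> f) ` carrier ?P"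
      by (auto simp: jet_algebra_def FactRing_def A_RCOSETS_def')
    fix X Y assume "X \<in> carrier (jet_algebra m R \<kappa>)" "Y \<in> carrier (jet_algebra m R \<kappa>)"
    then obtain x y where xy: "x \<in> carrier ?P" "X = ?I +>\<^bsub>?P\<^esub> x" "y \<in> carrier ?P" "Y = ?I +>\<^bsub>?P\<^esub> y"
      unfolding c by blast
    have "X \<otimes>\<^bsub>jet_algebra m R \<kappa>\<^esub> Y = ?I +>\<^bsub>?P\<^esub> (x * y)"
      using xy I.rcoset_mult_add[of x y] by (simp add: jet_algebra_def FactRing_def poly_ring_simps)
    then show "jet_lift \<iota> D (X \<otimes>\<^bsub>jet_algebra m R \<kappa>\<^esub> Y) = jet_lift \<iota> D X \<otimes>\<^bsub>class_ring\<^esub> jet_lift \<iota> D Y"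
      using xy by (simp add: cls poly_ring_closed psubst_mult[OF \<iota>])
    have "X \<oplus>\<^bsub>jet_algebra m R \<kappa>\<^esub> Y = ?I +>\<^bsub>?P\<^esub> (x + y)"
      using xy I.a_rcos_sum[of x y] by (simp add: jet_algebra_def FactRing_def poly_ring_simps)
    then show "jet_lift \<iota> D (X \<oplus>\<^bsub>jet_algebra m R \<kappa>\<^esub> Y) = jet_lift \<iota> D X \<oplus>\<^bsub>class_ring\<^esub> jet_lift \<iota> D Y"
      using xy by (simp add: cls poly_ring_closed psubst_add[OF \<iota>])
  next
    have "\<one>\<^bsub>jet_algebra m R \<kappa>\<^esub> = ?I +>\<^bsub>?P\<^esub> 1"
      by (simp add: jet_algebra_def FactRing_def poly_ring_simps)
    then show "jet_lift \<iota> D \<one>\<^bsub>jet_algebra m R \<kappa>\<^esub> = \<one>\<^bsub>class_ring\<^esub>"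
      by (simp add: cls poly_ring_closed psubst_one[OF \<iota>])
  qed simp
qed

lemma jet_class_hom:
  assumes R: "cring R" "\<And>c. \<kappa> c \<in> carrier R"
  shows "jet_class m R \<kappa> \<in> Ring.ring_hom (poly_ring (jet_symbols m R)) (jet_algebra m R \<kappa>)"
    and "carrier (jet_algebra m R \<kappa>) = jet_class m R \<kappa> ` carrier (poly_ring (jet_symbols m R))"
    and "x \<in> jet_relations m R \<kappa> \<Longrightarrow> jet_class m R \<kappa> x = jet_class m R \<kappa> 0"
proof -
  let ?P = "poly_ring (jet_symbols m R)"
  let ?I = "jet_ideal m R \<kappa>"
  interpret P: cring ?P by (rule poly_ring_cring)
  have sub: "jet_relations m R \<kappa> \<subseteq> carrier ?P" by (rule jet_relations_subset) (fact R)+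
  interpret I: ideal ?I ?P unfolding jet_ideal_def by (rule P.genideal_ideal[OF sub])
  show "jet_class m R \<kappa> \<in> Ring.ring_hom ?P (jet_algebra m R \<kappa>)"
    unfolding jet_class_def[abs_def] jet_algebra_def by (rule I.rcos_ring_hom)
  show "carrier (jet_algebra m R \<kappa>) = jet_class m R \<kappa> ` carrier ?P"
    by (auto simp: jet_algebra_def FactRing_def A_RCOSETS_def' jet_class_def)
  assume x: "x \<in> jet_relations m R \<kappa>"
  then have "x \<in> ?I" unfolding jet_ideal_def using P.genideal_self[OF sub] by blast
  then show "jet_class m R \<kappa> x = jet_class m R \<kappa> 0"
    unfolding jet_class_def using I.a_rcos_const[of x] I.a_rcos_const[of 0] I.zero_closed
    by (simp add: poly_ring_simps)
qed

text \<open>Maps of \<open>\<complex>\<close>-algebras from \<^const>\<open>jet_algebra\<close> to \<open>A\<close> correspond to \<open>A[t]/(t\<^sup>m\<^sup>+\<^sup>1)\<close>-valued points.\<close>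

theorem jet_algebra_universal:
  fixes \<iota> :: "complex \<Rightarrow> 'a::comm_ring_1"
  assumes R: "cring R" "\<And>c. \<kappa> c \<in> carrier R" and \<iota>: "comm_ring_hom \<iota>"
  shows "jet_point m R \<kappa> \<iota> D \<Longrightarrow>
      \<exists>!h. h \<in> extensional (carrier (jet_algebra m R \<kappa>)) \<and> h \<in> Ring.ring_hom (jet_algebra m R \<kappa>) class_ring \<and>
        (\<forall>c. h (jet_class m R \<kappa> (pconst c)) = \<iota> c) \<and>
        (\<forall>a\<in>carrier R. \<forall>k. enat k \<le> m \<longrightarrow> h (jet_class m R \<kappa> (pvar (a, k))) = D a k)"
    and "h \<in> Ring.ring_hom (jet_algebra m R \<kappa>) class_ring \<Longrightarrow>
      (\<forall>c. h (jet_class m R \<kappa> (pconst c)) = \<iota> c) \<Longrightarrow>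
      jet_point m R \<kappa> \<iota> (\<lambda>a k. h (jet_class m R \<kappa> (pvar (a, k))))"
proof -
  let ?P = "poly_ring (jet_symbols m R)" and ?J = "jet_algebra m R \<kappa>" and ?q = "jet_class m R \<kappa>"
  interpret R: cring R by fact
  have comp: "h \<circ> ?q \<in> Ring.ring_hom ?P class_ring" if "h \<in> Ring.ring_hom ?J class_ring"
    for h :: "_ \<Rightarrow> 'a"
    using ring_hom_trans[OF jet_class_hom(1) that] R by blast
  have cr: "h (?q (f + g)) = h (?q f) + h (?q g)" "h (?q (f * g)) = h (?q f) * h (?q g)"
    if "h \<in> Ring.ring_hom ?J class_ring" "f \<in> carrier ?P" "g \<in> carrier ?P" for h :: "_ \<Rightarrow> 'a" and f g
    using ring_hom_add[OF comp[OF that(1)] that(2,3)] ring_hom_mult[OF comp[OF that(1)] that(2,3)]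
    by (simp_all add: poly_ring_simps)
  {
    assume D: "jet_point m R \<kappa> \<iota> D"
    note L = jet_lift_class[where \<kappa> = \<kappa>, OF R \<iota> D]
    let ?h = "restrict (jet_lift \<iota> D) (carrier ?J)"
    have q: "?q f \<in> carrier ?J" if "f \<in> carrier ?P" for f
      using that unfolding jet_class_hom(2)[where \<kappa> = \<kappa>, OF R] by (rule imageI)
    show "\<exists>!h. h \<in> extensional (carrier ?J) \<and> h \<in> Ring.ring_hom ?J class_ring \<and>
        (\<forall>c. h (?q (pconst c)) = \<iota> c) \<and>
        (\<forall>a\<in>carrier R. \<forall>k. enat k \<le> m \<longrightarrow> h (?q (pvar (a, k))) = D a k)"
    proof (rule ex1I[of _ ?h], intro conjI allI ballI impI)
      interpret J: ring ?J
        unfolding jet_algebra_def jet_ideal_def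
        by (intro ideal.quotient_is_ring ring.genideal_ideal cring.axioms(1) poly_ring_cring
            jet_relations_subset R)
      show "?h \<in> Ring.ring_hom ?J class_ring"
        using L(1) by (auto simp: Ring.ring_hom_def)
      show "?h (?q (pconst c)) = \<iota> c" for c
        by (simp add: q poly_ring_closed L(2) psubst_pconst[OF \<iota>])
      show "?h (?q (pvar (a, k))) = D a k" if "a \<in> carrier R" "enat k \<le> m" for a k
        using that by (simp add: q poly_ring_closed jet_symbols_def L(2) psubst_pvar[OF \<iota>])
    next
      fix g assume g: "g \<in> extensional (carrier ?J) \<and> g \<in> Ring.ring_hom ?J class_ring \<and>
        (\<forall>c. g (?q (pconst c)) = \<iota> c) \<and>
        (\<forall>a\<in>carrier R. \<forall>k. enat k \<le> m \<longrightarrow> g (?q (pvar (a, k))) = D a k)"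
      have "g (?q f) = psubst \<iota> (\<lambda>(a, k). D a k) f" if "f \<in> carrier ?P" for f
        using that
      proof (induction rule: poly_ring_induct)
        case (var v)
        then show ?case using g by (cases v) (auto simp: jet_symbols_def psubst_pvar[OF \<iota>])
      qed (use g in \<open>simp_all add: psubst_pconst[OF \<iota>] psubst_add[OF \<iota>] psubst_mult[OF \<iota>] cr\<close>)
      then have "g X = ?h X" if X: "X \<in> carrier ?J" for X
      proof -
        obtain f where "f \<in> carrier ?P" "X = ?q f"
          using X unfolding jet_class_hom(2)[where \<kappa> = \<kappa>, OF R] by (rule imageE)
        then show ?thesis using \<open>\<And>f. f \<in> carrier ?P \<Longrightarrow> g (?q f) = _ f\<close> X L(2) by simp
      qed
      then show "g = ?h"
        using g by (intro extensionalityI[of _ "carrier ?J"]) auto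
    qed simp
  next
    assume h: "h \<in> Ring.ring_hom ?J class_ring" and c: "\<forall>c. h (?q (pconst c)) = \<iota> c"
    note cr = cr[OF h]
    have h0: "h (?q 0) = 0"
      using cr(1)[of 0 0] by (simp add: poly_ring_closed)
    have hs: "h (?q (sum F A)) = (\<Sum>x\<in>A. h (?q (F x)))" if "\<And>x. x \<in> A \<Longrightarrow> F x \<in> carrier ?P"
      for F and A :: "nat set"
      using that
      by (induction A rule: infinite_finite_induct) (auto simp: h0 cr poly_ring_sum_closed)
    have eq: "h (?q x) = h (?q y)" if "x - y \<in> jet_relations m R \<kappa>" "y \<in> carrier ?P" for x y
    proof -
      have "x - y \<in> carrier ?P" using that jet_relations_subset[where \<kappa> = \<kappa>, OF R] by blast
      from cr(1)[OF this that(2)] show ?thesis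
        using jet_class_hom(3)[where \<kappa> = \<kappa>, OF R that(1)] h0 by simp
    qed
    note cl = poly_ring_closed poly_ring_sum_closed
    show "jet_point m R \<kappa> \<iota> (\<lambda>a k. h (?q (pvar (a, k))))"
      unfolding jet_point_def
    proof (intro conjI ballI allI impI)
      fix a b k assume abk: "a \<in> carrier R" "b \<in> carrier R" "enat k \<le> m"
      then have v: "pvar (a, i) \<in> carrier ?P" "pvar (b, i) \<in> carrier ?P" if "i \<le> k" for i
        using that by (auto intro!: cl elim!: jet_symbols_le)
      have "h (?q (pvar (a \<oplus>\<^bsub>R\<^esub> b, k))) = h (?q (pvar (a, k) + pvar (b, k)))"
        by (rule eq; (unfold jet_relations_def)?)
          (use abk in blast, (intro poly_ring_closed poly_ring_sum_closed v; simp))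
      then show "h (?q (pvar (a \<oplus>\<^bsub>R\<^esub> b, k))) = h (?q (pvar (a, k))) + h (?q (pvar (b, k)))"
        using v by (simp add: cr)
      have "h (?q (pvar (a \<otimes>\<^bsub>R\<^esub> b, k))) = h (?q (\<Sum>i\<le>k. pvar (a, i) * pvar (b, k - i)))"
        by (rule eq; (unfold jet_relations_def)?)
          (use abk in blast, (intro poly_ring_closed poly_ring_sum_closed v; simp))
      also have "\<dots> = (\<Sum>i\<le>k. h (?q (pvar (a, i) * pvar (b, k - i))))"
        by (rule hs) (intro poly_ring_closed v; simp)
      also have "\<dots> = (\<Sum>i\<le>k. h (?q (pvar (a, i))) * h (?q (pvar (b, k - i))))"
        by (intro sum.cong refl cr(2) v) simp_all
      finally show "h (?q (pvar (a \<otimes>\<^bsub>R\<^esub> b, k))) = (\<Sum>i\<le>k. h (?q (pvar (a, i))) * h (?q (pvar (b, k - i))))" .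
    next
      fix x k assume k: "enat k \<le> m"
      have "h (?q (pvar (\<kappa> x, k))) = h (?q (if k = 0 then pconst x else 0))"
        by (rule eq; (unfold jet_relations_def)?) (use k in blast, simp add: poly_ring_closed)
      then show "h (?q (pvar (\<kappa> x, k))) = (if k = 0 then \<iota> x else 0)"
        using c h0 by simp
    qed
  }
qed


section \<open>The module \<open>V\<close>, its jets, and the quotient\<close>

text \<open>A \<open>\<complex>\<^sup>*\<close>-module is a direct sum of one-dimensional weight spaces. The list \<open>w\<close> contains all weights
  of \<open>V\<close> with multiplicity, and the variable \<open>i < length w\<close> is the coordinate of the \<open>i\<close>-th line.\<close>

definition coord_ring :: "int list \<Rightarrow> nat cpoly ring" where
  "coord_ring w = poly_ring {..<length w}"

definition act :: "int list \<Rightarrow> complex \<Rightarrow> (nat \<Rightarrow> complex) \<Rightarrow> nat \<Rightarrow> complex" where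
  "act w a v = (\<lambda>i. a powi (w ! i) * v i)"

definition inv_ring :: "int list \<Rightarrow> nat cpoly ring" where
  "inv_ring w = class_ring\<lparr>carrier :=
     {f \<in> carrier (coord_ring w). \<forall>a v. a \<noteq> 0 \<longrightarrow> peval (act w a v) f = peval v f}\<rparr>"

text \<open>\<open>V\<^sub>m\<close> is the affine space with coordinates \<open>(i, k)\<close>, the coefficient of \<open>t\<^sup>k\<close> in the \<open>i\<close>-th
  component of a jet; \<open>jet_coeff f k\<close> is the coefficient of \<open>t\<^sup>k\<close> in \<open>f(x(t))\<close> for the universal jet
  \<open>x(t)\<close>. If \<open>k \<le> m\<close>, it only involves the coordinates of \<open>V\<^sub>m\<close>.\<close>

definition coord_jet_ring :: "int list \<Rightarrow> enat \<Rightarrow> (nat \<times> nat) cpoly ring" where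
  "coord_jet_ring w m = poly_ring ({..<length w} \<times> {k. enat k \<le> m})"

definition jet_coeff :: "nat cpoly \<Rightarrow> nat \<Rightarrow> (nat \<times> nat) cpoly" where
  "jet_coeff f k = fps_nth (psubst (\<lambda>c. fps_const (pconst c)) (\<lambda>i. Abs_fps (\<lambda>j. pvar (i, j))) f) k"

lemma jet_coeff_simps:
  "jet_coeff (f + g) k = jet_coeff f k + jet_coeff g k"
  "jet_coeff (f * g) k = (\<Sum>i\<le>k. jet_coeff f i * jet_coeff g (k - i))"
  "jet_coeff (pconst c) k = (if k = 0 then pconst c else 0)"
  "jet_coeff (pvar i) k = pvar (i, k)"
proof -
  interpret comm_ring_hom pconst by (rule pconst_hom)
  have *: "comm_ring_hom (\<lambda>c. fps_const (pconst c :: (nat \<times> nat) cpoly))"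
    by unfold_locales (simp_all add: hom_add hom_mult)
  show "jet_coeff (f + g) k = jet_coeff f k + jet_coeff g k"
    "jet_coeff (f * g) k = (\<Sum>i\<le>k. jet_coeff f i * jet_coeff g (k - i))"
    "jet_coeff (pconst c) k = (if k = 0 then pconst c else 0)"
    "jet_coeff (pvar i) k = pvar (i, k)"
    by (simp_all add: jet_coeff_def psubst_add[OF *] psubst_mult[OF *] psubst_pconst[OF *]
        psubst_pvar[OF *] fps_mult_nth atLeast0AtMost)
qed

lemma jet_coeff_closed:
  assumes "f \<in> carrier (coord_ring w)" "enat k \<le> m"
  shows "jet_coeff f k \<in> carrier (coord_jet_ring w m)"
  using assms unfolding coord_ring_def
proof (induction arbitrary: k rule: poly_ring_induct)
  case (mult f g)
  have "enat i \<le> m" "enat (k - i) \<le> m" if "i \<le> k" for i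
    using that mult.prems order_trans[of _ "enat k" m] by auto
  then show ?case
    using mult.IH by (auto simp: coord_jet_ring_def jet_coeff_simps intro!: poly_ring_closed poly_ring_sum_closed)
qed (auto simp: coord_jet_ring_def jet_coeff_simps intro!: poly_ring_closed)

text \<open>Likewise \<^const>\<open>coord_jet_ring\<close> represents the jets of \<open>V\<close>, with universal jet \<^const>\<open>jet_coeff\<close>.\<close>

theorem coord_jet_ring_universal:
  fixes \<iota> :: "complex \<Rightarrow> 'a::comm_ring_1"
  assumes \<iota>: "comm_ring_hom \<iota>"
  shows "jet_point m (coord_ring w) pconst \<iota> D \<Longrightarrow>
      \<exists>!h. h \<in> extensional (carrier (coord_jet_ring w m)) \<and> h \<in> Ring.ring_hom (coord_jet_ring w m) class_ring \<and>
        (\<forall>c. h (pconst c) = \<iota> c) \<and>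
        (\<forall>f\<in>carrier (coord_ring w). \<forall>k. enat k \<le> m \<longrightarrow> h (jet_coeff f k) = D f k)"
    and "h \<in> Ring.ring_hom (coord_jet_ring w m) class_ring \<Longrightarrow> (\<forall>c. h (pconst c) = \<iota> c) \<Longrightarrow>
      jet_point m (coord_ring w) pconst \<iota> (\<lambda>f k. h (jet_coeff f k))"
proof -
  let ?J = "coord_jet_ring w m" and ?R = "coord_ring w"
  have cr: "h (f + g) = h f + h g" "h (f * g) = h f * h g"
    if "h \<in> Ring.ring_hom ?J class_ring" "f \<in> carrier ?J" "g \<in> carrier ?J" for h :: "_ \<Rightarrow> 'a" and f g
    using ring_hom_add[OF that] ring_hom_mult[OF that] by (simp_all add: coord_jet_ring_def poly_ring_simps)
  have hs: "h (sum F A) = (\<Sum>x\<in>A. h (F x))"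
    if h: "h \<in> Ring.ring_hom ?J class_ring" and "\<And>x. x \<in> A \<Longrightarrow> F x \<in> carrier ?J"
    for h :: "_ \<Rightarrow> 'a" and F and A :: "nat set"
  proof -
    have "h 0 = 0" using cr(1)[OF h, of 0 0] by (simp add: coord_jet_ring_def poly_ring_closed)
    then show ?thesis using that(2)
      by (induction A rule: infinite_finite_induct)
        (auto simp: cr[OF h] coord_jet_ring_def poly_ring_sum_closed)
  qed
  have le: "enat i \<le> m" "enat (k - i) \<le> m" if "i \<le> k" "enat k \<le> m" for i k
    using that order_trans[of _ "enat k" m] by auto
  have point: "jet_point m ?R pconst \<iota> (\<lambda>f k. h (jet_coeff f k))"
    if h: "h \<in> Ring.ring_hom ?J class_ring" and c: "\<forall>c. h (pconst c) = \<iota> c" for h :: "_ \<Rightarrow> 'a"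
  proof -
    have h0: "h 0 = 0" using cr(1)[OF h, of 0 0] by (simp add: coord_jet_ring_def poly_ring_closed)
    show ?thesis
      unfolding jet_point_def
    proof (intro conjI ballI allI impI)
      fix f g k assume fg: "f \<in> carrier ?R" "g \<in> carrier ?R" and k: "enat k \<le> m"
      note jc = jet_coeff_closed[OF fg(1)] jet_coeff_closed[OF fg(2)]
      show "h (jet_coeff (f \<oplus>\<^bsub>?R\<^esub> g) k) = h (jet_coeff f k) + h (jet_coeff g k)"
        using k jc by (simp add: coord_ring_def poly_ring_simps jet_coeff_simps cr[OF h])
      have "h (\<Sum>i\<le>k. jet_coeff f i * jet_coeff g (k - i)) = (\<Sum>i\<le>k. h (jet_coeff f i * jet_coeff g (k - i)))"
        by (rule hs[OF h]) (use jc le[OF _ k] in \<open>auto simp: coord_jet_ring_def intro!: poly_ring_closed\<close>)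
      also have "\<dots> = (\<Sum>i\<le>k. h (jet_coeff f i) * h (jet_coeff g (k - i)))"
        by (rule sum.cong) (use jc le[OF _ k] in \<open>auto intro!: cr(2)[OF h]\<close>)
      finally show "h (jet_coeff (f \<otimes>\<^bsub>?R\<^esub> g) k) = (\<Sum>i\<le>k. h (jet_coeff f i) * h (jet_coeff g (k - i)))"
        by (simp add: coord_ring_def poly_ring_simps jet_coeff_simps)
    qed (use c h0 in \<open>simp add: jet_coeff_simps\<close>)
  qed
  {
    assume "h \<in> Ring.ring_hom ?J class_ring" "\<forall>c. h (pconst c) = \<iota> c"
    then show "jet_point m ?R pconst \<iota> (\<lambda>f k. h (jet_coeff f k))" by (rule point)
  }
  assume D: "jet_point m ?R pconst \<iota> D"
  have uniq: "h (jet_coeff f k) = D f k"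
    if h: "h \<in> Ring.ring_hom ?J class_ring" and c: "\<forall>c. h (pconst c) = \<iota> c"
      and v: "\<And>i k. i < length w \<Longrightarrow> enat k \<le> m \<Longrightarrow> h (pvar (i, k)) = D (pvar i) k"
      and f: "f \<in> carrier ?R" and k: "enat k \<le> m" for h :: "_ \<Rightarrow> 'a" and f k
    using f k unfolding coord_ring_def
  proof (induction arbitrary: k rule: poly_ring_induct)
    case (const x)
    then show ?case
      using point[OF h c] D by (simp add: jet_point_def)
  next
    case (var i)
    then show ?case using v by (simp add: jet_coeff_simps)
  next
    case (add f g)
    then have "f \<in> carrier ?R" "g \<in> carrier ?R" by (simp_all add: coord_ring_def)
    then show ?case
      using point[OF h c] D add.IH[OF add.prems] add.prems
      unfolding jet_point_def by (simp add: coord_ring_def poly_ring_simps)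
  next
    case (mult f g)
    then have "f \<in> carrier ?R" "g \<in> carrier ?R" by (simp_all add: coord_ring_def)
    moreover have "(\<Sum>i\<le>k. h (jet_coeff f i) * h (jet_coeff g (k - i))) = (\<Sum>i\<le>k. D f i * D g (k - i))"
      by (rule sum.cong) (use mult.IH le[OF _ mult.prems] in auto)
    ultimately show ?case
      using point[OF h c] D mult.prems
      unfolding jet_point_def by (simp add: coord_ring_def poly_ring_simps)
  qed
  let ?g = "psubst \<iota> (\<lambda>(i, k). D (pvar i) k)"
  let ?h = "restrict ?g (carrier ?J)"
  have g: "?g \<in> Ring.ring_hom ?J class_ring"
    unfolding coord_jet_ring_def by (rule psubst_ring_hom[OF \<iota>])
  interpret J: cring ?J unfolding coord_jet_ring_def by (rule poly_ring_cring)
  have h: "?h \<in> Ring.ring_hom ?J class_ring"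
    using g by (auto simp: Ring.ring_hom_def)
  have hc: "\<forall>c. ?h (pconst c) = \<iota> c"
    by (simp add: coord_jet_ring_def poly_ring_closed psubst_pconst[OF \<iota>])
  have hv: "?h (pvar (i, k)) = D (pvar i) k" if "i < length w" "enat k \<le> m" for i k
    using that by (simp add: coord_jet_ring_def poly_ring_closed psubst_pvar[OF \<iota>])
  show "\<exists>!h. h \<in> extensional (carrier ?J) \<and> h \<in> Ring.ring_hom ?J class_ring \<and>
        (\<forall>c. h (pconst c) = \<iota> c) \<and>
        (\<forall>f\<in>carrier ?R. \<forall>k. enat k \<le> m \<longrightarrow> h (jet_coeff f k) = D f k)"
  proof (rule ex1I[of _ ?h], intro conjI)
    show "\<forall>f\<in>carrier ?R. \<forall>k. enat k \<le> m \<longrightarrow> ?h (jet_coeff f k) = D f k"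
      using uniq[OF h hc hv] by blast
  next
    fix u assume u: "u \<in> extensional (carrier ?J) \<and> u \<in> Ring.ring_hom ?J class_ring \<and>
      (\<forall>c. u (pconst c) = \<iota> c) \<and>
      (\<forall>f\<in>carrier ?R. \<forall>k. enat k \<le> m \<longrightarrow> u (jet_coeff f k) = D f k)"
    then have uv: "u (pvar (i, k)) = D (pvar i) k" if "i < length w" "enat k \<le> m" for i k
      using that jet_coeff_simps(4)[of i k] by (metis coord_ring_def lessThan_iff poly_ring_closed(2))
    have "u f = ?g f" if "f \<in> carrier ?J" for f
      using that unfolding coord_jet_ring_def
    proof (induction rule: poly_ring_induct)
      case (var v)
      then show ?case using uv by (cases v) (auto simp: psubst_pvar[OF \<iota>])
    qed (use u in \<open>simp_all add: psubst_pconst[OF \<iota>] psubst_add[OF \<iota>] psubst_mult[OF \<iota>] cr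
      flip: coord_jet_ring_def\<close>)
    then show "u = ?h"
      using u by (intro extensionalityI[of _ "carrier ?J"]) auto
  qed (use h hc in auto)
qed

text \<open>The complex points of \<open>G\<^sub>m\<close> are the units of \<open>\<complex>[t]/(t\<^sup>m\<^sup>+\<^sup>1)\<close>, represented by power series without
  terms of degree \<open>> m\<close>. A coefficient of degree \<open>\<le> m\<close> of a product (or inverse) of power series does
  not depend on the coefficients of degree \<open>> m\<close>, so the truncation need not be made explicit in the
  action on \<open>V\<^sub>m\<close>.\<close>

definition jet_group :: "enat \<Rightarrow> complex fps set" where
  "jet_group m = {\<gamma>. fps_nth \<gamma> 0 \<noteq> 0 \<and> (\<forall>k. m < enat k \<longrightarrow> fps_nth \<gamma> k = 0)}"

definition jet_act :: "int list \<Rightarrow> complex fps \<Rightarrow> (nat \<times> nat \<Rightarrow> complex) \<Rightarrow> nat \<times> nat \<Rightarrow> complex" where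
  "jet_act w \<gamma> v = (\<lambda>(i, k). fps_nth (\<gamma> powi (w ! i) * Abs_fps (\<lambda>j. v (i, j))) k)"

definition inv_jet_ring :: "int list \<Rightarrow> enat \<Rightarrow> (nat \<times> nat) cpoly ring" where
  "inv_jet_ring w m = class_ring\<lparr>carrier :=
     {f \<in> carrier (coord_jet_ring w m). \<forall>\<gamma>\<in>jet_group m. \<forall>v. peval (jet_act w \<gamma> v) f = peval v f}\<rparr>"

definition quot_jet_ring :: "int list \<Rightarrow> enat \<Rightarrow> (nat cpoly \<times> nat) cpoly set ring" where
  "quot_jet_ring w m = jet_algebra m (inv_ring w) pconst"

text \<open>On points \<open>p\<^sub>m\<close> composes a jet \<open>\<O>(V) \<rightarrow> A[t]/(t\<^sup>m\<^sup>+\<^sup>1)\<close> with the inclusion \<open>\<O>(V)\<^sup>G \<subseteq> \<O>(V)\<close>. So the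
  comorphism of \<open>p\<^sub>m\<close> corresponds to the restriction of the universal jet \<^const>\<open>jet_coeff\<close> to \<open>\<O>(V)\<^sup>G\<close>.\<close>

definition p_star :: "(nat cpoly \<times> nat) cpoly set \<Rightarrow> (nat \<times> nat) cpoly" where
  "p_star = jet_lift pconst jet_coeff"

lemma inv_ring_cring: "cring (inv_ring w)" "pconst c \<in> carrier (inv_ring w)"
proof -
  have id: "comm_ring_hom (\<lambda>c::complex. c)" by unfold_locales simp_all
  note ps = psubst_add[OF id] psubst_mult[OF id] psubst_pconst[OF id] psubst_zero[OF id]
    psubst_one[OF id] psubst_uminus[OF id]
  have cl: "f + g \<in> carrier (inv_ring w)" "f * g \<in> carrier (inv_ring w)"
    if "f \<in> carrier (inv_ring w)" "g \<in> carrier (inv_ring w)" for f g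
    using that by (simp_all add: inv_ring_def coord_ring_def ps poly_ring_closed)
  have clm: "- f \<in> carrier (inv_ring w)" if "f \<in> carrier (inv_ring w)" for f
    using that by (simp add: inv_ring_def coord_ring_def ps poly_ring_closed)
  have cl0: "0 \<in> carrier (inv_ring w)" "1 \<in> carrier (inv_ring w)"
    by (simp_all add: inv_ring_def coord_ring_def ps poly_ring_closed)
  have ops: "f \<oplus>\<^bsub>inv_ring w\<^esub> g = f + g" "f \<otimes>\<^bsub>inv_ring w\<^esub> g = f * g" "\<zero>\<^bsub>inv_ring w\<^esub> = 0" "\<one>\<^bsub>inv_ring w\<^esub> = 1"
    for f g by (simp_all add: inv_ring_def)
  show "pconst c \<in> carrier (inv_ring w)"
    by (simp_all add: inv_ring_def coord_ring_def ps poly_ring_closed)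
  show "cring (inv_ring w)"
  proof (rule cringI)
    show "abelian_group (inv_ring w)"
    proof (rule abelian_groupI)
      fix x assume "x \<in> carrier (inv_ring w)"
      then show "\<exists>y\<in>carrier (inv_ring w). y \<oplus>\<^bsub>inv_ring w\<^esub> x = \<zero>\<^bsub>inv_ring w\<^esub>"
        by (intro bexI[of _ "- x"]) (auto simp: ops clm)
    qed (auto simp: ops cl cl0 algebra_simps)
    show "Group.comm_monoid (inv_ring w)"
      by (rule comm_monoidI) (auto simp: ops cl cl0 algebra_simps)
  qed (auto simp: ops algebra_simps)
qed

lemma p_star_hom:
  "p_star \<in> Ring.ring_hom (quot_jet_ring w m) class_ring"
  "p_star (jet_class m (inv_ring w) pconst (pconst c)) = pconst c"
  "f \<in> carrier (inv_ring w) \<Longrightarrow> enat k \<le> m \<Longrightarrow>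
     p_star (jet_class m (inv_ring w) pconst (pvar (f, k))) = jet_coeff f k"
proof -
  have D: "jet_point m (inv_ring w) pconst pconst jet_coeff"
    by (simp add: jet_point_def inv_ring_def jet_coeff_simps)
  note L = jet_lift_class[where \<kappa> = pconst, OF inv_ring_cring pconst_hom D]
  show "p_star \<in> Ring.ring_hom (quot_jet_ring w m) class_ring"
    using L(1) by (simp add: p_star_def quot_jet_ring_def)
  show "p_star (jet_class m (inv_ring w) pconst (pconst c)) = pconst c"
    by (simp add: p_star_def L(2) poly_ring_closed psubst_pconst[OF pconst_hom])
  show "p_star (jet_class m (inv_ring w) pconst (pvar (f, k))) = jet_coeff f k"
    if "f \<in> carrier (inv_ring w)" "enat k \<le> m"
    using that by (simp add: p_star_def L(2) poly_ring_closed jet_symbols_def psubst_pvar[OF pconst_hom])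
qed

text \<open>Closed points. Generators \<open>ps\<close> of \<open>\<O>(V)\<^sup>G\<close> embed \<open>V//G\<close> into affine space as the zero set of the
  relations between them.\<close>

definition generators :: "int list \<Rightarrow> nat cpoly list \<Rightarrow> bool" where
  "generators w ps \<longleftrightarrow>
     psubst pconst (\<lambda>j. ps ! j) ` carrier (poly_ring {..<length ps}) = carrier (inv_ring w)"

definition quot_points :: "nat cpoly list \<Rightarrow> complex vec set" where
  "quot_points ps = {z \<in> carrier_vec (length ps). \<forall>F \<in> carrier (poly_ring {..<length ps}).
     psubst pconst (\<lambda>j. ps ! j) F = 0 \<longrightarrow> peval (\<lambda>j. z $ j) F = 0}"

definition quot_map :: "nat cpoly list \<Rightarrow> complex vec \<Rightarrow> complex vec" where
  "quot_map ps v = vec (length ps) (\<lambda>j. peval (\<lambda>i. v $ i) (ps ! j))"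

definition jacobian :: "int list \<Rightarrow> nat cpoly list \<Rightarrow> complex vec \<Rightarrow> complex mat" where
  "jacobian w ps v = mat (length ps) (length w)
     (\<lambda>(j, i). deriv (\<lambda>a. peval ((\<lambda>l. v $ l)(i := a)) (ps ! j)) (v $ i))"

definition max_rank_points :: "int list \<Rightarrow> nat cpoly list \<Rightarrow> complex vec set" where
  "max_rank_points w ps = {v \<in> carrier_vec (length w).
     enat (vec_space.rank (length ps) (jacobian w ps v)) = krull_dim (inv_ring w)}"

end

theory Submission
  imports Defs
begin

text \<open>
  Let \<open>A\<close> be the image of \<open>p\<^sub>\<infinity>\<^sup>*\<close>, the algebra generated by the jet coefficients of the invariants.

  If \<open>x\<close> is the only variable with a weight of its sign and this weight is \<open>\<plusminus>1\<close>, then restriction to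
  \<open>x = 1\<close> identifies both sides with a polynomial ring: an arc with \<open>x(0) \<noteq> 0\<close> can be moved to \<open>x(t) = 1\<close>
  by the unit \<open>x(t)\<^sup>\<mp>\<^sup>1\<close>, and the invariants \<open>x\<^sup>\<kappa> y\<close> restrict to the coordinates \<open>y\<close>.

  If all weights are in \<open>{-1, 0, 1}\<close>, polarization reduces an invariant to coefficients \<open>c(a, b)\<close> of
  multilinear monomials \<open>x\<^sub>1\<^sub>,\<^sub>a\<^sub>1 \<dots> x\<^sub>n\<^sub>,\<^sub>a\<^sub>n y\<^sub>1\<^sub>,\<^sub>b\<^sub>1 \<dots> y\<^sub>n\<^sub>,\<^sub>b\<^sub>n\<close>. Invariance under \<open>1 - \<epsilon> t\<close> says that \<open>c\<close>, as a
  linear map on \<open>\<complex>[S, T]\<close>, kills the ideal generated by the \<open>e\<^sub>k(S) - e\<^sub>k(T)\<close>. This ideal is radical, since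
  \<open>\<complex>[S, T]\<close> modulo it is free over \<open>\<complex>[S]\<close>, so \<open>c\<close> is a sum over permutations of maps that factor through
  \<open>T = S\<^sub>\<sigma>\<close>, and these yield products of coefficients of the series \<open>x\<^sub>i(t) y\<^sub>j(t)\<close>.

  In all other cases there are invariant monomials \<open>u\<close>, \<open>v\<close> such that \<open>v u'\<^sup>2 / u\<close> is a polynomial outside
  \<open>A\<close>: a linear functional on the arcs \<open>\<rho> (1 + \<xi> t)\<^sup>e\<close> separates it from \<open>A\<close>.
\<close>

section \<open>Polynomials and weights\<close>

text \<open>The group of arcs is not reductive, so an invariant cannot be averaged into
  \<open>A\<close>. For weights -1, 0, 1 the way around is to record jet orders as exponents: under
  1 - \<epsilon> t a derivative of order k acquires a term of order k + 1, which becomes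
  multiplication by a formal variable, one for each slot of the polarized invariant. Invariance is
  thereby a condition on a linear map between polynomial rings.

  In the obstruction, an element of \<open>A\<close> that is quadratic in \<xi> and has the monomial
  uv spends its two t-derivatives on one or two invariant divisors of uv, and its coefficient
  depends only on the exponents of these divisors on the arc. The functional is a difference of such
  coefficients for two arcs: on the first u has exponent 1, on the second u is constant and v,
  unless v = 1, has exponent 1. The divisors of uv do not distinguish the two arcs, while the
  witness is nonzero on the first and zero on the second.\<close>

abbreviation lookup where "lookup \<equiv> Poly_Mapping.lookup"
abbreviation keys where "keys \<equiv> Poly_Mapping.keys"
abbreviation single where "single \<equiv> Poly_Mapping.single"

lemma id_hom: "comm_ring_hom (\<lambda>c::complex. c)"
  by unfold_locales simp_all

lemma fps_const_hom: "comm_ring_hom (fps_const :: 'a::comm_ring_1 \<Rightarrow> 'a fps)"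
  by unfold_locales simp_all

lemma comm_ring_hom_comp:
  assumes "comm_ring_hom f" "comm_ring_hom g" shows "comm_ring_hom (\<lambda>x. f (g x))"
proof -
  interpret f: comm_ring_hom f by fact
  interpret g: comm_ring_hom g by fact
  show ?thesis by unfold_locales (simp_all add: f.hom_add g.hom_add f.hom_mult g.hom_mult)
qed

lemma fps_pconst_hom: "comm_ring_hom (\<lambda>c. fps_const (pconst c :: 'v cpoly))"
  by (rule comm_ring_hom_comp[OF fps_const_hom pconst_hom])

lemmas psubst_hom_simps = psubst_add psubst_mult psubst_pconst psubst_pvar psubst_zero psubst_one
  psubst_uminus psubst_diff psubst_sum

lemma psubst_comm_ring_hom:
  "comm_ring_hom \<iota> \<Longrightarrow> comm_ring_hom (psubst \<iota> g)"
  by unfold_locales (simp_all add: psubst_hom_simps)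

lemma psubst_power: "comm_ring_hom \<iota> \<Longrightarrow> psubst \<iota> g (f ^ n) = psubst \<iota> g f ^ n"
  by (induction n) (simp_all add: psubst_hom_simps)

lemma psubst_prod: "comm_ring_hom \<iota> \<Longrightarrow> psubst \<iota> g (prod F A) = (\<Prod>x\<in>A. psubst \<iota> g (F x))"
  by (induction A rule: infinite_finite_induct) (simp_all add: psubst_hom_simps)

lemma poly_ring_UNIV: "carrier (poly_ring UNIV) = UNIV"
  by (auto simp: poly_ring_carrier)

lemma cpoly_induct [case_names const var add mult]:
  assumes "\<And>c. P (pconst c)" "\<And>v. P (pvar v)"
    and "\<And>f g. P f \<Longrightarrow> P g \<Longrightarrow> P (f + g)" "\<And>f g. P f \<Longrightarrow> P g \<Longrightarrow> P (f * g)"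
  shows "P f"
proof -
  have "f \<in> carrier (poly_ring UNIV)" by (simp add: poly_ring_UNIV)
  then show ?thesis by (induction rule: poly_ring_induct) (auto intro: assms)
qed

lemma psubst_psubst:
  assumes "comm_ring_hom \<iota>"
  shows "psubst \<iota> g (psubst pconst h f) = psubst \<iota> (\<lambda>v. psubst \<iota> g (h v)) f"
  by (induction f rule: cpoly_induct)
    (simp_all add: psubst_hom_simps[OF pconst_hom] psubst_hom_simps[OF assms])

lemma psubst_cong:
  assumes "f \<in> carrier (poly_ring W)" "\<And>v. v \<in> W \<Longrightarrow> g v = h v"
  shows "psubst \<iota> g f = psubst \<iota> h f"
  unfolding psubst_def
  by (intro sum.cong arg_cong2[where f = times] prod.cong refl) (use assms in \<open>force simp: poly_ring_carrier\<close>)+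

lemma psubst_pvar_id: "psubst pconst pvar f = f"
  by (induction f rule: cpoly_induct) (simp_all add: psubst_hom_simps[OF pconst_hom])

lemma psubst_ident:
  assumes "f \<in> carrier (poly_ring W)" "\<And>v. v \<in> W \<Longrightarrow> g v = pvar v"
  shows "psubst pconst g f = f"
  using psubst_cong[of f W g pvar pconst, OF assms] psubst_pvar_id[of f] by simp

lemma poly_ring_prod_closed:
  "(\<And>x. x \<in> A \<Longrightarrow> F x \<in> carrier (poly_ring W)) \<Longrightarrow> prod F A \<in> carrier (poly_ring W)"
  by (induction A rule: infinite_finite_induct) (auto intro: poly_ring_closed)

lemma poly_ring_power_closed:
  "f \<in> carrier (poly_ring W) \<Longrightarrow> f ^ n \<in> carrier (poly_ring W)"
  by (induction n) (auto intro: poly_ring_closed)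

lemmas poly_ring_closed' = poly_ring_closed poly_ring_diff_closed poly_ring_sum_closed
  poly_ring_prod_closed poly_ring_power_closed

lemma poly_ring_mono: "W \<subseteq> W' \<Longrightarrow> f \<in> carrier (poly_ring W) \<Longrightarrow> f \<in> carrier (poly_ring W')"
  by (auto simp: poly_ring_carrier)

lemma psubst_closed:
  assumes "f \<in> carrier (poly_ring W)" "\<And>v. v \<in> W \<Longrightarrow> g v \<in> carrier (poly_ring W')"
  shows "psubst pconst g f \<in> carrier (poly_ring W')"
  using assms(1)
  by (induction rule: poly_ring_induct)
    (auto simp: psubst_hom_simps[OF pconst_hom] intro!: poly_ring_closed' assms(2))

lemma poly_ring_finite_vars: "\<exists>W. finite W \<and> f \<in> carrier (poly_ring W)"
  by (rule exI[of _ "\<Union>(keys ` keys f)"]) (auto simp: poly_ring_carrier)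

lemma pconst_simps: "pconst 0 = 0" "pconst 1 = 1" "pconst (a + b) = pconst a + pconst b"
  "pconst (a * b) = pconst a * pconst b" "pconst (- a) = - pconst a" "pconst (a - b) = pconst a - pconst b"
  "pconst (a ^ n) = pconst a ^ n"
proof -
  interpret comm_ring_hom pconst by (rule pconst_hom)
  show "pconst 0 = 0" "pconst 1 = 1" "pconst (a + b) = pconst a + pconst b"
  "pconst (a * b) = pconst a * pconst b" "pconst (- a) = - pconst a" "pconst (a - b) = pconst a - pconst b"
  "pconst (a ^ n) = pconst a ^ n" by (simp_all add: hom_distribs)
qed

lemma pconst_mult_lookup: "lookup (pconst c * f) \<mu> = c * lookup f \<mu>"
proof -
  have "pconst c * f = (\<Sum>\<nu>\<in>keys f. single \<nu> (c * lookup f \<nu>))"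
    by (subst poly_mapping_sum_single[of f]) (simp add: sum_distrib_left pconst_def mult_single)
  then show ?thesis by (simp add: lookup_sum lookup_single when_def in_keys_iff)
qed

text \<open>The monomials are distinct characters of a torus, so this is Dedekind's independence of characters:
  rescaling one variable by 2 separates two given monomials, and subtracting a multiple of the original
  relation shortens it.\<close>

lemma peval_nonzero_vanish:
  assumes "\<And>v. (\<And>i. v i \<noteq> 0) \<Longrightarrow> peval v f = 0"
  shows "f = 0"
  using assms
proof (induction "card (keys f)" arbitrary: f rule: less_induct)
  case less
  show ?case
  proof (rule ccontr)
    assume "f \<noteq> 0"
    then obtain \<mu> where \<mu>: "\<mu> \<in> keys f" by fastforce
    have "keys f \<noteq> {\<mu>}"
    proof
      assume "keys f = {\<mu>}"
      then have "peval (\<lambda>_. 1) f = lookup f \<mu>" by (simp add: psubst_def)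
      then show False using less.prems[of "\<lambda>_. 1"] \<mu> by (simp add: in_keys_iff)
    qed
    then obtain \<nu> where \<nu>: "\<nu> \<in> keys f" "\<nu> \<noteq> \<mu>" using \<mu> by blast
    then obtain k where k: "lookup \<nu> k \<noteq> lookup \<mu> k"
      by (meson poly_mapping_eqI)
    let ?c = "\<lambda>\<xi>. (2::complex) ^ lookup \<xi> k - 2 ^ lookup \<nu> k"
    define h where "h = (\<Sum>\<xi>\<in>keys f. single \<xi> (lookup f \<xi> * ?c \<xi>))"
    have lk: "lookup h \<xi> = lookup f \<xi> * ?c \<xi>" for \<xi>
      unfolding h_def by (simp add: lookup_sum lookup_single when_def in_keys_iff)
    have 2: "(2::complex) ^ a = 2 ^ b \<longleftrightarrow> a = b" for a b
    proof
      assume "(2::complex) ^ a = 2 ^ b"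
      then have "norm ((2::complex) ^ a) = norm ((2::complex) ^ b)" by simp
      then show "a = b" by (simp add: norm_power)
    qed simp
    have keys: "keys h \<subseteq> keys f - {\<nu>}"
      by (auto simp: in_keys_iff lk)
    have "card (keys h) < card (keys f)"
      using psubset_card_mono[of "keys f" "keys h"] keys \<nu>(1) by auto
    moreover have "peval v h = 0" if v: "\<And>i. v i \<noteq> 0" for v
    proof -
      have sc: "(\<Prod>i\<in>keys \<xi>. (v(k := 2 * v k)) i ^ lookup \<xi> i) =
          2 ^ lookup \<xi> k * (\<Prod>i\<in>keys \<xi>. v i ^ lookup \<xi> i)" for \<xi>
      proof -
        have "(\<Prod>i\<in>keys \<xi>. (v(k := 2 * v k)) i ^ lookup \<xi> i) =
          (\<Prod>i\<in>keys \<xi>. (if i = k then 2 ^ lookup \<xi> i else 1) * v i ^ lookup \<xi> i)"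
          by (rule prod.cong) (auto simp: power_mult_distrib)
        also have "\<dots> = (\<Prod>i\<in>keys \<xi>. if i = k then 2 ^ lookup \<xi> i else 1) *
          (\<Prod>i\<in>keys \<xi>. v i ^ lookup \<xi> i)" by (simp add: prod.distrib)
        also have "(\<Prod>i\<in>keys \<xi>. if i = k then 2 ^ lookup \<xi> i else 1) = (2::complex) ^ lookup \<xi> k"
          by (simp add: prod.delta in_keys_iff)
        finally show ?thesis .
      qed
      have "peval v h = peval (v(k := 2 * v k)) f - 2 ^ lookup \<nu> k * peval v f"
        unfolding h_def psubst_sum[OF id_hom] psubst_single[OF id_hom]
        unfolding psubst_def sc
        by (simp add: sum_distrib_left sum_subtractf algebra_simps)
      moreover have "peval (v(k := 2 * v k)) f = 0" using v by (intro less.prems) auto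
      ultimately show ?thesis using less.prems[of v] v by simp
    qed
    ultimately have "h = 0" using less.hyps by blast
    then have "lookup h \<mu> = 0" by simp
    then show False using lk[of \<mu>] \<mu> k 2 by (simp add: in_keys_iff)
  qed
qed

text \<open>Coordinates may be assumed nonzero when polynomials are compared. This is what allows a
  point or an arc to be moved by a power of one of its own coordinates.\<close>

lemma peval_nonzero_eqI:
  assumes "\<And>v. (\<And>i. v i \<noteq> 0) \<Longrightarrow> peval v f = peval v g"
  shows "f = g"
  using peval_nonzero_vanish[of "f - g"] assms by (simp add: psubst_diff[OF id_hom])

definition weight :: "int list \<Rightarrow> (nat \<Rightarrow>\<^sub>0 nat) \<Rightarrow> int" where
  "weight w \<mu> = (\<Sum>i\<in>keys \<mu>. int (lookup \<mu> i) * w ! i)"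

lemma weight_superset:
  "finite A \<Longrightarrow> keys \<mu> \<subseteq> A \<Longrightarrow> weight w \<mu> = (\<Sum>i\<in>A. int (lookup \<mu> i) * w ! i)"
  unfolding weight_def by (rule sum.mono_neutral_left) (auto simp: in_keys_iff)

lemma weight_add: "weight w (\<mu> + \<nu>) = weight w \<mu> + weight w \<nu>"
proof -
  let ?A = "keys \<mu> \<union> keys \<nu>"
  have "keys (\<mu> + \<nu>) \<subseteq> ?A" by (rule keys_add)
  then show ?thesis
    by (simp add: weight_superset[of ?A] lookup_add algebra_simps sum.distrib)
qed

lemma weight_single: "weight w (single i n) = int n * w ! i"
  by (simp add: weight_def)

text \<open>A monomial is multiplied by a to the power of its weight. The single value a = 2 already
  forces weight zero, since 2 is not a root of unity.\<close>

lemma inv_ring_iff: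
  "f \<in> carrier (inv_ring w) \<longleftrightarrow> f \<in> carrier (coord_ring w) \<and> (\<forall>\<mu>\<in>keys f. weight w \<mu> = 0)"
proof -
  have mon: "(\<Prod>i\<in>keys \<mu>. act w a v i ^ lookup \<mu> i) =
      a powi weight w \<mu> * (\<Prod>i\<in>keys \<mu>. v i ^ lookup \<mu> i)" if "a \<noteq> 0" for a v \<mu>
  proof -
    have pw: "a powi (\<Sum>i\<in>A. F i) = (\<Prod>i\<in>A. a powi F i)" for A and F :: "nat \<Rightarrow> int"
      using that by (induction A rule: infinite_finite_induct) (simp_all add: power_int_add)
    have "(a powi w ! i) ^ n = a powi (int n * w ! i)" for i n
      by (metis mult.commute power_int_mult power_int_of_nat)
    then show ?thesis
      unfolding act_def weight_def pw by (simp add: power_mult_distrib prod.distrib)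
  qed
  have *: "weight w \<mu> = 0" if f: "\<And>a v. a \<noteq> 0 \<Longrightarrow> peval (act w a v) f = peval v f" and \<mu>: "\<mu> \<in> keys f" for \<mu>
  proof -
    define h where "h = (\<Sum>\<xi>\<in>keys f. single \<xi> (lookup f \<xi> * 2 powi weight w \<xi>))"
    have "peval v h = peval (act w 2 v) f" for v
      unfolding h_def psubst_sum[OF id_hom] psubst_single[OF id_hom]
      by (simp add: psubst_def mon mult.assoc)
    then have "h = f" using f[of 2] by (intro peval_nonzero_eqI) simp
    moreover have "lookup h \<mu> = lookup f \<mu> * 2 powi weight w \<mu>"
      unfolding h_def using \<mu> by (simp add: lookup_sum lookup_single when_def)
    ultimately have "(2::complex) powi weight w \<mu> = 1" using \<mu> by (simp add: in_keys_iff)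
    then have "norm ((2::complex) powi weight w \<mu>) = 1" by simp
    then have "(2::real) powi weight w \<mu> = 1" by (simp add: norm_power_int)
    then have "(2::real) powr weight w \<mu> = 1" by (simp add: powr_real_of_int')
    then show "weight w \<mu> = 0" by simp
  qed
  have "peval (act w a v) f = peval v f" if "\<forall>\<mu>\<in>keys f. weight w \<mu> = 0" "a \<noteq> 0" for a v
    unfolding psubst_def using that by (intro sum.cong refl) (simp add: mon)
  then show ?thesis using * by (auto simp: inv_ring_def)
qed

section \<open>Invariants of the jet groups\<close>

lemma peval_jet_coeff:
  "peval v (jet_coeff f k) = fps_nth (psubst fps_const (\<lambda>i. Abs_fps (\<lambda>j. v (i, j))) f) k"
  by (induction f arbitrary: k rule: cpoly_induct)
    (simp_all add: jet_coeff_simps psubst_hom_simps[OF id_hom] psubst_hom_simps[OF fps_const_hom]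
      fps_mult_nth atLeast0AtMost)

text \<open>Power series do not form a field, so the exponents are separated into powers of \<gamma>
  and powers of \<open>inverse \<gamma>\<close>. Their totals agree because the weight is
  zero.\<close>

lemma fps_powi_weight_zero:
  fixes \<gamma> :: "complex fps"
  assumes \<gamma>: "fps_nth \<gamma> 0 \<noteq> 0" and w: "weight w \<mu> = 0"
  shows "(\<Prod>i\<in>keys \<mu>. (\<gamma> powi (w ! i)) ^ lookup \<mu> i) = 1"
proof -
  let ?K = "keys \<mu>"
  define a where "a i = lookup \<mu> i * nat (w ! i)" for i
  define b where "b i = lookup \<mu> i * nat (- (w ! i))" for i
  have "(\<gamma> powi (w ! i)) ^ lookup \<mu> i = \<gamma> ^ a i * inverse \<gamma> ^ b i" for i
    by (simp add: power_int_def a_def b_def power_mult[symmetric] mult.commute)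
  then have "(\<Prod>i\<in>?K. (\<gamma> powi (w ! i)) ^ lookup \<mu> i) = \<gamma> ^ sum a ?K * inverse \<gamma> ^ sum b ?K"
    by (simp add: prod.distrib power_sum)
  also have "sum a ?K = sum b ?K"
  proof -
    have "int (lookup \<mu> i) * w ! i = int (a i) - int (b i)" for i
      by (cases "w ! i \<ge> 0") (simp_all add: a_def b_def)
    then have "int (sum a ?K) - int (sum b ?K) = weight w \<mu>"
      by (simp add: weight_def sum_subtractf)
    then have "int (sum a ?K) = int (sum b ?K)" using w by linarith
    then show ?thesis by (simp only: of_nat_eq_iff)
  qed
  also have "\<gamma> ^ sum b ?K * inverse \<gamma> ^ sum b ?K = 1"
    using \<gamma> by (simp add: power_mult_distrib[symmetric] inverse_mult_eq_1')
  finally show ?thesis .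
qed

lemma psubst_unit_scale:
  fixes \<gamma> :: "complex fps"
  assumes \<gamma>: "fps_nth \<gamma> 0 \<noteq> 0" and f: "f \<in> carrier (inv_ring w)"
  shows "psubst fps_const (\<lambda>i. \<gamma> powi (w ! i) * X i) f = psubst fps_const X f"
  unfolding psubst_def
proof (intro sum.cong arg_cong2[where f = times] refl)
  fix \<mu> assume "\<mu> \<in> keys f"
  then have "weight w \<mu> = 0" using f by (simp add: inv_ring_iff)
  then show "(\<Prod>i\<in>keys \<mu>. (\<gamma> powi (w ! i) * X i) ^ lookup \<mu> i) =
      (\<Prod>i\<in>keys \<mu>. X i ^ lookup \<mu> i)"
    by (simp add: power_mult_distrib prod.distrib fps_powi_weight_zero[OF \<gamma>])
qed

lemma peval_jet_act:
  assumes "fps_nth \<gamma> 0 \<noteq> 0" "f \<in> carrier (inv_ring w)"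
  shows "peval (jet_act w \<gamma> v) (jet_coeff f k) = peval v (jet_coeff f k)"
proof -
  have "Abs_fps (\<lambda>j. jet_act w \<gamma> v (i, j)) = \<gamma> powi (w ! i) * Abs_fps (\<lambda>j. v (i, j))" for i
    by (rule fps_ext) (simp add: jet_act_def)
  then show ?thesis
    by (simp add: peval_jet_coeff psubst_unit_scale[OF assms])
qed

lemma inv_jet_ring_iff:
  "f \<in> carrier (inv_jet_ring w m) \<longleftrightarrow> f \<in> carrier (coord_jet_ring w m) \<and>
    (\<forall>\<gamma>\<in>jet_group m. \<forall>v. peval (jet_act w \<gamma> v) f = peval v f)"
  by (simp add: inv_jet_ring_def)

lemma inv_jet_ring_closed:
  "pconst c \<in> carrier (inv_jet_ring w m)"
  "f \<in> carrier (inv_jet_ring w m) \<Longrightarrow> g \<in> carrier (inv_jet_ring w m) \<Longrightarrow> f + g \<in> carrier (inv_jet_ring w m)"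
  "f \<in> carrier (inv_jet_ring w m) \<Longrightarrow> g \<in> carrier (inv_jet_ring w m) \<Longrightarrow> f * g \<in> carrier (inv_jet_ring w m)"
  by (auto simp: inv_jet_ring_iff coord_jet_ring_def psubst_hom_simps[OF id_hom] intro: poly_ring_closed)

lemma jet_coeff_invariant:
  assumes "f \<in> carrier (inv_ring w)" "enat k \<le> m"
  shows "jet_coeff f k \<in> carrier (inv_jet_ring w m)"
  using assms jet_coeff_closed[of f w k m] peval_jet_act[of _ f w]
  by (auto simp: inv_jet_ring_iff inv_ring_iff jet_group_def)

section \<open>The image of the comorphism, computed on representatives\<close>

definition jet_subst :: "(nat cpoly \<times> nat) cpoly \<Rightarrow> (nat \<times> nat) cpoly" where
  "jet_subst = psubst pconst (\<lambda>(a, k). jet_coeff a k)"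

text \<open>Polynomials in the symbols replace the classes of the jet algebra, so that elements of
  the image can be treated by \<open>poly_ring_induct\<close>.\<close>

definition jet_image :: "int list \<Rightarrow> enat \<Rightarrow> (nat \<times> nat) cpoly set" where
  "jet_image w m = jet_subst ` carrier (poly_ring (jet_symbols m (inv_ring w)))"

lemma p_star_class:
  assumes "F \<in> carrier (poly_ring (jet_symbols m (inv_ring w)))"
  shows "p_star (jet_class m (inv_ring w) pconst F) = jet_subst F"
proof -
  have D: "jet_point m (inv_ring w) pconst pconst jet_coeff"
    by (simp add: jet_point_def inv_ring_def jet_coeff_simps)
  show ?thesis
    using jet_lift_class(2)[where \<kappa> = pconst, OF inv_ring_cring pconst_hom D assms]
    by (simp add: p_star_def jet_subst_def)
qed

lemma carrier_quot_jet_ring: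
  "carrier (quot_jet_ring w m) =
    jet_class m (inv_ring w) pconst ` carrier (poly_ring (jet_symbols m (inv_ring w)))"
  unfolding quot_jet_ring_def by (rule jet_class_hom(2)) (rule inv_ring_cring)+

lemma p_star_image: "p_star ` carrier (quot_jet_ring w m) = jet_image w m"
  by (auto simp: carrier_quot_jet_ring jet_image_def image_image p_star_class intro!: image_cong)

lemma jet_image_closed:
  "pconst c \<in> jet_image w m"
  "a \<in> carrier (inv_ring w) \<Longrightarrow> enat k \<le> m \<Longrightarrow> jet_coeff a k \<in> jet_image w m"
  "f \<in> jet_image w m \<Longrightarrow> g \<in> jet_image w m \<Longrightarrow> f + g \<in> jet_image w m"
  "f \<in> jet_image w m \<Longrightarrow> g \<in> jet_image w m \<Longrightarrow> f * g \<in> jet_image w m"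
proof -
  let ?C = "carrier (poly_ring (jet_symbols m (inv_ring w)))"
  have I: "jet_subst F \<in> jet_image w m" if "F \<in> ?C" for F
    using that by (auto simp: jet_image_def)
  note s = jet_subst_def psubst_hom_simps[OF pconst_hom]
  show "pconst c \<in> jet_image w m"
    using I[of "pconst c"] by (simp add: s poly_ring_closed)
  show "jet_coeff a k \<in> jet_image w m" if "a \<in> carrier (inv_ring w)" "enat k \<le> m"
    using that I[of "pvar (a, k)"] by (simp add: s poly_ring_closed jet_symbols_def)
  assume "f \<in> jet_image w m" "g \<in> jet_image w m"
  then obtain F G where "F \<in> ?C" "f = jet_subst F" "G \<in> ?C" "g = jet_subst G"
    by (auto simp: jet_image_def)
  then show "f + g \<in> jet_image w m" "f * g \<in> jet_image w m"
    using I[of "F + G"] I[of "F * G"] by (simp_all add: s poly_ring_closed)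
qed

lemma jet_image_sum_closed:
  "(\<And>x. x \<in> A \<Longrightarrow> F x \<in> jet_image w m) \<Longrightarrow> sum F A \<in> jet_image w m"
  using jet_image_closed(1)[of 0] 
  by (induction A rule: infinite_finite_induct) (auto simp: pconst_simps intro: jet_image_closed)

lemma jet_image_prod_closed:
  "(\<And>x. x \<in> A \<Longrightarrow> F x \<in> jet_image w m) \<Longrightarrow> prod F A \<in> jet_image w m"
  using jet_image_closed(1)[of 1] 
  by (induction A rule: infinite_finite_induct) (auto simp: pconst_simps intro: jet_image_closed)

lemma jet_image_subset: "jet_image w m \<subseteq> carrier (inv_jet_ring w m)"
proof
  fix f assume "f \<in> jet_image w m"
  then obtain F where F: "F \<in> carrier (poly_ring (jet_symbols m (inv_ring w)))" "f = jet_subst F"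
    by (auto simp: jet_image_def)
  show "f \<in> carrier (inv_jet_ring w m)"
    unfolding F(2) using F(1)
    by (induction rule: poly_ring_induct)
      (auto simp: jet_subst_def psubst_hom_simps[OF pconst_hom] jet_symbols_def
        intro: inv_jet_ring_closed jet_coeff_invariant)
qed

section \<open>Congruence modulo t^(m+1) and the action of arbitrary unit series\<close>

definition fps_agree :: "enat \<Rightarrow> 'a fps \<Rightarrow> 'a fps \<Rightarrow> bool" where
  "fps_agree m A B \<longleftrightarrow> (\<forall>k. enat k \<le> m \<longrightarrow> fps_nth A k = fps_nth B k)"

lemma fps_agree_mult:
  fixes A :: "'a::comm_ring_1 fps"
  assumes "fps_agree m A B" "fps_agree m C D"
  shows "fps_agree m (A * C) (B * D)"
  unfolding fps_agree_def fps_mult_nth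
proof (intro allI impI sum.cong refl)
  fix k i assume "enat k \<le> m" "i \<in> {0..k}"
  then have "enat i \<le> m" "enat (k - i) \<le> m" using enat_le_trans[of k m] by auto
  then show "fps_nth A i * fps_nth C (k - i) = fps_nth B i * fps_nth D (k - i)"
    using assms by (simp add: fps_agree_def)
qed

lemma fps_agree_power:
  fixes A :: "'a::comm_ring_1 fps"
  shows "fps_agree m A B \<Longrightarrow> fps_agree m (A ^ n) (B ^ n)"
  by (induction n) (simp_all add: fps_agree_mult, simp add: fps_agree_def)

lemma fps_agree_inverse:
  fixes A :: "complex fps"
  assumes "fps_agree m A B" "fps_nth A 0 \<noteq> 0" "fps_nth B 0 \<noteq> 0"
  shows "fps_agree m (inverse A) (inverse B)"
proof -
  have "fps_agree m (inverse A * (B * inverse B)) (inverse A * (A * inverse B))"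
    using assms(1) by (intro fps_agree_mult) (auto simp: fps_agree_def)
  moreover have "inverse A * (A * inverse B) = inverse B" "inverse A * (B * inverse B) = inverse A"
    using assms by (simp_all add: inverse_mult_eq_1 inverse_mult_eq_1' mult.assoc[symmetric])
  ultimately show ?thesis by simp
qed

text \<open>A unit series acts on jets of order m through its truncation, which lies in
  \<open>jet_group m\<close>. The units applied later are built from coordinate series and are not
  truncated.\<close>

lemma inv_jet_ring_unit:
  assumes f: "f \<in> carrier (inv_jet_ring w m)" and \<gamma>: "fps_nth \<gamma> 0 \<noteq> 0"
  shows "peval (jet_act w \<gamma> v) f = peval v f"
proof -
  define \<delta> where "\<delta> = Abs_fps (\<lambda>k. if enat k \<le> m then fps_nth \<gamma> k else 0)"
  have \<delta>0: "fps_nth \<delta> 0 \<noteq> 0" using \<gamma> by (simp add: \<delta>_def flip: zero_enat_def)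
  have \<delta>: "\<delta> \<in> jet_group m" using \<delta>0 by (auto simp: jet_group_def \<delta>_def)
  have ag: "fps_agree m \<gamma> \<delta>" by (simp add: fps_agree_def \<delta>_def)
  have "fps_agree m (\<gamma> powi z) (\<delta> powi z)" for z
    using fps_agree_power[OF ag] fps_agree_power[OF fps_agree_inverse[OF ag \<gamma> \<delta>0]]
    by (simp add: power_int_def)
  then have "fps_agree m (\<gamma> powi (w ! i) * Abs_fps (\<lambda>j. v (i, j))) (\<delta> powi (w ! i) * Abs_fps (\<lambda>j. v (i, j)))" for i
    by (rule fps_agree_mult) (simp add: fps_agree_def)
  then have "jet_act w \<gamma> v (i, k) = jet_act w \<delta> v (i, k)" if "enat k \<le> m" for i k
    using that by (simp add: jet_act_def fps_agree_def)
  then have "peval (jet_act w \<gamma> v) f = peval (jet_act w \<delta> v) f"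
    using f by (intro psubst_cong[of f "{..<length w} \<times> {k. enat k \<le> m}"])
      (auto simp: inv_jet_ring_iff coord_jet_ring_def)
  then show ?thesis using f \<delta> by (simp add: inv_jet_ring_iff)
qed

section \<open>A weight of absolute value one that is alone of its sign\<close>

lemma pvar_power: "pvar i ^ n = single (single i n) 1"
  by (induction n) (simp_all add: pvar_def mult_single single_add[symmetric])

lemma single_in_inv_ring:
  assumes "keys \<mu> \<subseteq> {..<length w}" "weight w \<mu> = 0"
  shows "single \<mu> c \<in> carrier (inv_ring w)"
  using assms by (auto simp: inv_ring_iff coord_ring_def poly_ring_carrier split: if_splits)

text \<open>All weights other than the one at \<open>i0\<close> are zero or of the opposite sign,
  and \<kappa> i is the power of the variable \<open>i0\<close> that compensates the weight of the
  variable i.\<close>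

locale unit_weight =
  fixes w :: "int list" and i0 :: nat and \<kappa> :: "nat \<Rightarrow> nat"
  assumes i0: "i0 < length w" and w0: "\<bar>w ! i0\<bar> = 1"
    and wi: "\<And>i. i < length w \<Longrightarrow> i \<noteq> i0 \<Longrightarrow> w ! i = - int (\<kappa> i) * w ! i0"
begin

text \<open>Next to the generating invariants, the value 1 at \<open>i0\<close> is the coordinate of
  the slice x = 1. Substituting \<open>u\<close> thus restricts to the slice and inserts the
  invariants at once.\<close>

definition u :: "nat \<Rightarrow> nat cpoly" where
  "u i = (if i = i0 then 1 else pvar i0 ^ \<kappa> i * pvar i)"

lemma w0_cases: "w ! i0 = 1 \<or> w ! i0 = -1"
  using w0 by linarith

lemma u_single: "i \<noteq> i0 \<Longrightarrow> u i = single (single i0 (\<kappa> i) + single i 1) 1"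
  by (simp add: u_def pvar_power) (simp add: pvar_def mult_single)

lemma u_inv: "i < length w \<Longrightarrow> u i \<in> carrier (inv_ring w)"
proof (cases "i = i0")
  case True
  then show ?thesis using inv_ring_cring(2)[of 1 w] by (simp add: u_def pconst_simps)
next
  case False
  assume i: "i < length w"
  show ?thesis
    unfolding u_single[OF False]
  proof (rule single_in_inv_ring)
    show "keys (single i0 (\<kappa> i) + single i 1) \<subseteq> {..<length w}"
      using i i0 keys_add[of "single i0 (\<kappa> i)" "single i 1"] by (auto split: if_splits)
    show "weight w (single i0 (\<kappa> i) + single i 1) = 0"
      using wi[OF i False] by (simp add: weight_add weight_single)
  qed
qed

text \<open>At a point v with nonzero coordinates the values of \<open>u\<close> form the translate
  of v by \<open>a\<close>, whose coordinate \<open>i0\<close> is 1. An invariant takes the same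
  value at both.\<close>

lemma psubst_u:
  assumes f: "f \<in> carrier (inv_ring w)"
  shows "psubst pconst u f = f"
proof (rule peval_nonzero_eqI)
  fix v :: "nat \<Rightarrow> complex" assume v: "\<And>i. v i \<noteq> 0"
  define a where "a = v i0 powi (- (w ! i0))"
  have "peval v (u i) = act w a v i" if "i < length w" for i
  proof (cases "i = i0")
    case True
    then show ?thesis using w0_cases v[of i0]
      by (auto simp: u_def act_def a_def psubst_one[OF id_hom] power_int_minus)
  next
    case False
    have "a powi (w ! i) = v i0 ^ \<kappa> i"
      using w0_cases wi[OF that False] by (auto simp: a_def power_int_minus power_inverse)
    then show ?thesis
      using False by (simp add: u_def act_def psubst_mult[OF id_hom] psubst_power[OF id_hom] psubst_pvar[OF id_hom])
  qed
  then have "peval v (psubst pconst u f) = peval (act w a v) f"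
    unfolding psubst_psubst[OF id_hom] using f
    by (intro psubst_cong[of f "{..<length w}"]) (auto simp: inv_ring_iff coord_ring_def)
  also have "\<dots> = peval v f" using f v[of i0] by (simp add: inv_ring_def a_def)
  finally show "peval v (psubst pconst u f) = peval v f" .
qed

lemma psubst_jet_u:
  assumes f: "f \<in> carrier (inv_jet_ring w m)"
  shows "psubst pconst (\<lambda>(i, k). jet_coeff (u i) k) f = f"
proof (rule peval_nonzero_eqI)
  fix v :: "nat \<times> nat \<Rightarrow> complex" assume v: "\<And>i. v i \<noteq> 0"
  define X where "X i = Abs_fps (\<lambda>j. v (i, j))" for i
  define \<gamma> where "\<gamma> = (if w ! i0 = 1 then inverse (X i0) else X i0)"
  have X0: "fps_nth (X i0) 0 \<noteq> 0" using v by (simp add: X_def)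
  then have \<gamma>: "fps_nth \<gamma> 0 \<noteq> 0" by (simp add: \<gamma>_def)
  have "peval v (jet_coeff (u i) k) = jet_act w \<gamma> v (i, k)" if "i < length w" for i k
  proof -
    have "psubst fps_const X (u i) = \<gamma> powi (w ! i) * X i"
    proof (cases "i = i0")
      case True
      then show ?thesis using w0_cases X0
        by (auto simp: u_def \<gamma>_def psubst_one[OF fps_const_hom] inverse_mult_eq_1 power_int_minus power_int_def)
    next
      case False
      have "\<gamma> powi (w ! i) = X i0 ^ \<kappa> i"
        using w0_cases wi[OF that False] X0 by (auto simp: \<gamma>_def power_int_def fps_inverse_idempotent)
      then show ?thesis
        using False by (simp add: u_def psubst_mult[OF fps_const_hom] psubst_power[OF fps_const_hom] psubst_pvar[OF fps_const_hom])
    qed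
    then show ?thesis by (simp add: peval_jet_coeff jet_act_def flip: X_def)
  qed
  then have "peval v (psubst pconst (\<lambda>(i, k). jet_coeff (u i) k) f) = peval (jet_act w \<gamma> v) f"
    unfolding psubst_psubst[OF id_hom] using f
    by (intro psubst_cong[of f "{..<length w} \<times> {k. enat k \<le> m}"]) (auto simp: inv_jet_ring_iff coord_jet_ring_def)
  also have "\<dots> = peval v f" using inv_jet_ring_unit[OF f \<gamma>] by simp
  finally show "peval v (psubst pconst (\<lambda>(i, k). jet_coeff (u i) k) f) = peval v f" .
qed

text \<open>This will be the inverse of \<open>p_star\<close> on representatives: restrict to the
  slice x(t) = 1, then replace each remaining coordinate by the symbol of its invariant.\<close>

definition \<psi> :: "(nat \<times> nat) cpoly \<Rightarrow> (nat cpoly \<times> nat) cpoly" where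
  "\<psi> = psubst pconst (\<lambda>(i, k). if i = i0 then (if k = 0 then 1 else 0) else pvar (u i, k))"

lemma \<psi>_closed:
  "f \<in> carrier (coord_jet_ring w m) \<Longrightarrow> \<psi> f \<in> carrier (poly_ring (jet_symbols m (inv_ring w)))"
  unfolding \<psi>_def coord_jet_ring_def
  by (rule psubst_closed) (auto simp: jet_symbols_def u_inv intro!: poly_ring_closed)

lemma jet_subst_\<psi>: "jet_subst (\<psi> f) = psubst pconst (\<lambda>(i, k). jet_coeff (u i) k) f"
proof -
  have "psubst pconst (\<lambda>(a, k). jet_coeff a k) (if i = i0 then (if k = 0 then 1 else 0) else pvar (u i, k)) = jet_coeff (u i) k" for i k
    using jet_coeff_simps(3)[of 1 k] by (simp add: psubst_hom_simps[OF pconst_hom] u_def pconst_simps)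
  then show ?thesis
    unfolding jet_subst_def \<psi>_def psubst_psubst[OF pconst_hom] by (simp add: case_prod_unfold)
qed

lemma jet_image_eq: "jet_image w m = carrier (inv_jet_ring w m)"
proof
  show "carrier (inv_jet_ring w m) \<subseteq> jet_image w m"
  proof
    fix f assume f: "f \<in> carrier (inv_jet_ring w m)"
    then have "\<psi> f \<in> carrier (poly_ring (jet_symbols m (inv_ring w)))"
      by (intro \<psi>_closed) (simp add: inv_jet_ring_iff)
    then show "f \<in> jet_image w m"
      using psubst_jet_u[OF f] by (force simp: jet_image_def jet_subst_\<psi>)
  qed
qed (rule jet_image_subset)

text \<open>This gives the injectivity of \<open>p_star\<close>: modulo the jet relations a
  polynomial in the symbols can be recovered from its image.\<close>

lemma normal_form:
  assumes "F \<in> carrier (poly_ring (jet_symbols m (inv_ring w)))"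
  shows "F - \<psi> (jet_subst F) \<in> jet_ideal m (inv_ring w) pconst"
proof -
  let ?R = "inv_ring w" let ?P = "poly_ring (jet_symbols m ?R)"
  let ?I = "jet_ideal m ?R pconst"
  interpret P: cring ?P by (rule poly_ring_cring)
  interpret R: cring ?R by (rule inv_ring_cring)
  have sub: "jet_relations m ?R pconst \<subseteq> carrier ?P"
    by (rule jet_relations_subset) (rule inv_ring_cring)+
  interpret I: ideal ?I ?P unfolding jet_ideal_def by (rule P.genideal_ideal[OF sub])
  have ops: "a \<oplus>\<^bsub>?R\<^esub> b = a + b" "a \<otimes>\<^bsub>?R\<^esub> b = a * b" for a b by (simp_all add: inv_ring_def)
  have rel: "x \<in> ?I" if "x \<in> jet_relations m ?R pconst" for x
    using that P.genideal_self[OF sub] unfolding jet_ideal_def by blast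
  have I0: "0 \<in> ?I" using I.zero_closed by (simp add: poly_ring_simps)
  have Iadd: "x + y \<in> ?I" if "x \<in> ?I" "y \<in> ?I" for x y
    using I.a_closed[OF that] by (simp add: poly_ring_simps)
  have Isum: "sum X A \<in> ?I" if "\<And>x. x \<in> A \<Longrightarrow> X x \<in> ?I" for X and A :: "nat set"
    using that by (induction A rule: infinite_finite_induct) (auto simp: I0 Iadd)
  have Imul: "x * y \<in> ?I" if "x \<in> ?I" "y \<in> carrier ?P" for x y
    using I.I_r_closed[OF that] by (simp add: poly_ring_simps)
  have mul_cong: "x * y - x' * y' \<in> ?I"
    if "x - x' \<in> ?I" "y - y' \<in> ?I" "x' \<in> carrier ?P" "y \<in> carrier ?P" for x y x' y'
  proof -
    have "x * y - x' * y' = (x - x') * y + (y - y') * x'" by (simp add: algebra_simps)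
    then show ?thesis using Imul[OF that(1,4)] Imul[OF that(2,3)] Iadd by metis
  qed
  have trans: "x - z \<in> ?I" if "x - y \<in> ?I" "y - z \<in> ?I" for x y z
    using Iadd[OF that] by simp
  note hs = psubst_hom_simps[OF pconst_hom]
  have inv: "psubst pconst u a \<in> carrier ?R" if "a \<in> carrier (coord_ring w)" for a
    using that unfolding coord_ring_def
  proof (induction rule: poly_ring_induct)
    case (add f g) then show ?case using R.a_closed[of "psubst pconst u f" "psubst pconst u g"] by (simp add: hs ops)
  next
    case (mult f g) then show ?case using R.m_closed[of "psubst pconst u f" "psubst pconst u g"] by (simp add: hs ops)
  qed (auto simp: hs u_inv inv_ring_cring)
  have \<psi>c: "\<psi> (jet_coeff a k) \<in> carrier ?P" if "a \<in> carrier (coord_ring w)" "enat k \<le> m" for a k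
    using \<psi>_closed jet_coeff_closed that by blast
  have \<psi>s: "\<psi> (f + g) = \<psi> f + \<psi> g" "\<psi> (f * g) = \<psi> f * \<psi> g" "\<psi> (pconst c) = pconst c" "\<psi> 0 = 0"
    "\<psi> (sum X A) = (\<Sum>x\<in>A. \<psi> (X x))" for f g c X and A :: "nat set"
    by (simp_all add: \<psi>_def hs)
  \<comment> \<open>Modulo the ideal both terms are coefficients of a jet of the coordinate ring in
    the argument a, and the two jets agree on the variables. For invariant a,
    \<open>psubst_u\<close> turns the first term into the symbol of a itself.\<close>
  have key: "pvar (psubst pconst u a, k) - \<psi> (jet_coeff a k) \<in> ?I"
    if "a \<in> carrier (coord_ring w)" "enat k \<le> m" for a k
    using that unfolding coord_ring_def
  proof (induction arbitrary: k rule: poly_ring_induct)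
    case (const c)
    have "pvar (pconst c, k) - (if k = 0 then pconst c else 0) \<in> ?I"
      by (rule rel) (use const in \<open>unfold jet_relations_def, blast\<close>)
    then show ?case by (simp add: hs jet_coeff_simps \<psi>s split: if_splits)
  next
    case (var i)
    show ?case
    proof (cases "i = i0")
      case True
      have "pvar (pconst 1, k) - (if k = 0 then pconst 1 else 0) \<in> ?I"
        by (rule rel) (use var in \<open>unfold jet_relations_def, blast\<close>)
      then show ?thesis using True by (simp add: hs jet_coeff_simps \<psi>_def u_def pconst_simps split: if_splits)
    next
      case False
      then show ?thesis using I0 by (simp add: hs jet_coeff_simps \<psi>_def)
    qed
  next
    case (add f g)
    let ?f = "psubst pconst u f" and ?g = "psubst pconst u g"
    have fg: "?f \<in> carrier ?R" "?g \<in> carrier ?R" using inv add.hyps by (simp_all add: coord_ring_def)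
    have "pvar (?f \<oplus>\<^bsub>?R\<^esub> ?g, k) - (pvar (?f, k) + pvar (?g, k)) \<in> ?I"
      by (rule rel) (use add fg in \<open>unfold jet_relations_def, blast\<close>)
    moreover have "pvar (?f, k) + pvar (?g, k) - (\<psi> (jet_coeff f k) + \<psi> (jet_coeff g k)) \<in> ?I"
      using Iadd[OF add.IH(1)[OF add.prems] add.IH(2)[OF add.prems]] by (simp add: algebra_simps)
    ultimately show ?case unfolding hs jet_coeff_simps \<psi>s ops by (rule trans)
  next
    case (mult f g)
    let ?f = "psubst pconst u f" and ?g = "psubst pconst u g"
    have c: "f \<in> carrier (coord_ring w)" "g \<in> carrier (coord_ring w)" using mult.hyps by (simp_all add: coord_ring_def)
    have fg: "?f \<in> carrier ?R" "?g \<in> carrier ?R" using inv c by auto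
    have "pvar (?f \<otimes>\<^bsub>?R\<^esub> ?g, k) - (\<Sum>i\<le>k. pvar (?f, i) * pvar (?g, k - i)) \<in> ?I"
      by (rule rel) (use mult fg in \<open>unfold jet_relations_def, blast\<close>)
    moreover have "(\<Sum>i\<le>k. pvar (?f, i) * pvar (?g, k - i)) - (\<Sum>i\<le>k. \<psi> (jet_coeff f i) * \<psi> (jet_coeff g (k - i))) \<in> ?I"
      unfolding sum_subtractf[symmetric]
    proof (rule Isum)
      fix i assume "i \<in> {..k}"
      then have le: "enat i \<le> m" "enat (k - i) \<le> m" using mult.prems enat_le_trans[of k m] by auto
      show "pvar (?f, i) * pvar (?g, k - i) - \<psi> (jet_coeff f i) * \<psi> (jet_coeff g (k - i)) \<in> ?I"
        using mult.IH(1)[OF le(1)] mult.IH(2)[OF le(2)] \<psi>c[OF c(1) le(1)] fg le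
        by (intro mul_cong) (auto intro!: poly_ring_closed simp: jet_symbols_def)
    qed
    ultimately show ?case unfolding hs jet_coeff_simps \<psi>s ops by (rule trans)
  qed
  have jc: "\<psi> (jet_subst F) \<in> carrier ?P" if "F \<in> carrier ?P" for F
  proof -
    have "jet_subst F \<in> jet_image w m" using that by (simp add: jet_image_def)
    then show ?thesis using jet_image_subset[of w m] by (intro \<psi>_closed) (auto simp: inv_jet_ring_iff)
  qed
  show ?thesis using assms
  proof (induction rule: poly_ring_induct)
    case (const c)
    then show ?case using I0 by (simp add: jet_subst_def hs \<psi>s)
  next
    case (var v)
    obtain a k where v: "v = (a, k)" by (cases v)
    then have ak: "a \<in> carrier ?R" "enat k \<le> m" using var by (auto simp: jet_symbols_def)
    then show ?case using key[of a k] psubst_u[OF ak(1)]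
      by (simp add: v jet_subst_def hs inv_ring_iff)
  next
    case (add f g)
    then show ?case using Iadd[OF add.IH] by (simp add: jet_subst_def hs \<psi>s algebra_simps)
  next
    case (mult f g)
    then show ?case using mul_cong[OF mult.IH jc[OF mult.hyps(1)] mult.hyps(2)]
      by (simp add: jet_subst_def hs \<psi>s)
  qed
qed

lemma p_star_iso: "p_star \<in> ring_iso (quot_jet_ring w m) (inv_jet_ring w m)"
proof -
  let ?R = "inv_ring w" let ?P = "poly_ring (jet_symbols m ?R)"
  let ?I = "jet_ideal m ?R pconst" and ?q = "jet_class m ?R pconst"
  interpret P: cring ?P by (rule poly_ring_cring)
  have sub: "jet_relations m ?R pconst \<subseteq> carrier ?P"
    by (rule jet_relations_subset) (rule inv_ring_cring)+
  interpret I: ideal ?I ?P unfolding jet_ideal_def by (rule P.genideal_ideal[OF sub])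
  have qh: "?q \<in> Ring.ring_hom ?P (quot_jet_ring w m)"
    unfolding quot_jet_ring_def by (rule jet_class_hom(1)) (rule inv_ring_cring)+
  have img: "p_star ` carrier (quot_jet_ring w m) = carrier (inv_jet_ring w m)"
    by (simp add: p_star_image jet_image_eq)
  have "inj_on p_star (carrier (quot_jet_ring w m))"
  proof (rule inj_onI)
    fix X Y assume XY: "X \<in> carrier (quot_jet_ring w m)" "Y \<in> carrier (quot_jet_ring w m)" "p_star X = p_star Y"
    then obtain F G where F: "F \<in> carrier ?P" "X = ?q F" and G: "G \<in> carrier ?P" "Y = ?q G"
      by (auto simp: carrier_quot_jet_ring)
    have eq: "jet_subst F = jet_subst G" using XY(3) F G by (simp add: p_star_class)
    have q\<psi>: "?q H = ?q (\<psi> (jet_subst H))" if H: "H \<in> carrier ?P" for H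
    proof -
      have n: "H - \<psi> (jet_subst H) \<in> ?I" by (rule normal_form[OF H])
      have c: "\<psi> (jet_subst H) \<in> carrier ?P" 
        using poly_ring_diff_closed[OF H, of "H - \<psi> (jet_subst H)"] I.a_subset n by auto
      have "?q (H - \<psi> (jet_subst H)) = ?q 0"
        unfolding jet_class_def using I.a_rcos_const[OF n] I.a_rcos_const[OF I.zero_closed] by (simp add: poly_ring_simps)
      then have "?q (H - \<psi> (jet_subst H) + \<psi> (jet_subst H)) = ?q (0 + \<psi> (jet_subst H))"
        using ring_hom_add[OF qh, of "H - \<psi> (jet_subst H)" "\<psi> (jet_subst H)"] 
          ring_hom_add[OF qh, of 0 "\<psi> (jet_subst H)"] c H poly_ring_diff_closed[OF H c]
        by (simp add: poly_ring_simps poly_ring_closed)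
      then show ?thesis by simp
    qed
    show "X = Y" using q\<psi>[OF F(1)] q\<psi>[OF G(1)] eq F G by simp
  qed
  moreover have "p_star \<in> Ring.ring_hom (quot_jet_ring w m) (inv_jet_ring w m)"
  proof -
    have "p_star X \<in> carrier (inv_jet_ring w m)" if "X \<in> carrier (quot_jet_ring w m)" for X
      using that img by blast
    then show ?thesis using p_star_hom(1)[of w m] by (auto simp: Ring.ring_hom_def inv_jet_ring_def)
  qed
  ultimately show ?thesis using img by (simp add: ring_iso_def bij_betw_def)
qed

end

section \<open>An obstruction to surjectivity\<close>

lemma psubst_jet_coeff:
  "psubst pconst g (jet_coeff f k) =
    fps_nth (psubst (\<lambda>c. fps_const (pconst c)) (\<lambda>i. Abs_fps (\<lambda>k. g (i, k))) f) k"
  by (induction f arbitrary: k rule: cpoly_induct)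
    (simp_all add: jet_coeff_simps psubst_hom_simps[OF pconst_hom] psubst_hom_simps[OF fps_pconst_hom]
      fps_mult_nth atLeast0AtMost)

text \<open>The series \<rho>^a (1 + \<xi> t)^p, where \<xi> is the variable n. The exponent p is an
  arbitrary complex number, and Vandermonde's identity is the exponent law.\<close>

definition bseries :: "nat \<Rightarrow> (nat \<Rightarrow>\<^sub>0 nat) \<Rightarrow> complex \<Rightarrow> nat cpoly fps" where
  "bseries n a p = Abs_fps (\<lambda>k. single (a + single n k) (p gchoose k))"

lemma bseries_mult: "bseries n a p * bseries n b q = bseries n (a + b) (p + q)"
proof (rule fps_ext)
  fix k
  have "fps_nth (bseries n a p * bseries n b q) k =
      (\<Sum>i=0..k. single (a + b + single n k) ((p gchoose i) * (q gchoose (k - i))))"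
    unfolding fps_mult_nth
  proof (rule sum.cong)
    fix i assume "i \<in> {0..k}"
    then have "a + single n i + (b + single n (k - i)) = a + b + single n k"
      by (simp add: algebra_simps flip: single_add)
    then show "fps_nth (bseries n a p) i * fps_nth (bseries n b q) (k - i) =
        single (a + b + single n k) ((p gchoose i) * (q gchoose (k - i)))"
      by (simp add: bseries_def mult_single)
  qed simp
  also have "\<dots> = single (a + b + single n k) (\<Sum>i=0..k. (p gchoose i) * (q gchoose (k - i)))"
    by (rule poly_mapping_eqI) (simp add: lookup_sum lookup_single when_def)
  finally show "fps_nth (bseries n a p * bseries n b q) k = fps_nth (bseries n (a + b) (p + q)) k"
    by (simp add: bseries_def gbinomial_Vandermonde)
qed

lemma bseries_0: "bseries n 0 0 = 1"
  by (rule fps_ext) (auto simp: bseries_def gbinomial_0_left)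

lemma bseries_power: "bseries n (single i 1) p ^ m = bseries n (single i m) (of_nat m * p)"
  by (induction m) (simp_all add: bseries_0 bseries_mult algebra_simps flip: single_add)

lemma bseries_prod: "(\<Prod>i\<in>A. bseries n (a i) (p i)) = bseries n (sum a A) (sum p A)"
  by (induction A rule: infinite_finite_induct) (simp_all add: bseries_0 bseries_mult)

text \<open>On the arc with exponents e the monomial a takes the value \<rho>^a (1 + \<xi>
  t)^(\<open>expo e a\<close>).\<close>

definition expo :: "(nat \<Rightarrow> complex) \<Rightarrow> (nat \<Rightarrow>\<^sub>0 nat) \<Rightarrow> complex" where
  "expo e a = (\<Sum>i\<in>keys a. of_nat (lookup a i) * e i)"

text \<open>Evaluation on the arcs \<open>x\<^sub>i(t) = \<rho>\<^sub>i (1 + \<xi> t)\<^sup>e\<^sup>i\<close>; the variable \<open>n\<close> plays the role of \<open>\<xi>\<close>.\<close>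

definition arc_eval :: "nat \<Rightarrow> (nat \<Rightarrow> complex) \<Rightarrow> (nat \<times> nat) cpoly \<Rightarrow> nat cpoly" where
  "arc_eval n e = psubst pconst
     (\<lambda>(i, k). single (single i 1 + single n k) (e i gchoose k))"

lemma arc_eval_hom_simps:
  "arc_eval n e (f + g) = arc_eval n e f + arc_eval n e g"
  "arc_eval n e (f * g) = arc_eval n e f * arc_eval n e g"
  "arc_eval n e (pconst c) = pconst c" "arc_eval n e 0 = 0" "arc_eval n e 1 = 1"
  "arc_eval n e (f ^ d) = arc_eval n e f ^ d"
  "arc_eval n e (pvar (i, k)) = single (single i 1 + single n k) (e i gchoose k)"
  by (simp_all add: arc_eval_def psubst_hom_simps[OF pconst_hom] psubst_power[OF pconst_hom])

lemma arc_eval_monomial: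
  "arc_eval n e (jet_coeff (single a 1) k) =
    single (a + single n k) (expo e a gchoose k)"
proof -
  have "(\<Prod>i\<in>keys a. bseries n (single i 1) (e i) ^ lookup a i) =
      bseries n (\<Sum>i\<in>keys a. single i (lookup a i)) (expo e a)"
    by (simp add: bseries_power bseries_prod expo_def del: One_nat_def)
  also have "(\<Sum>i\<in>keys a. single i (lookup a i)) = a"
    by (rule poly_mapping_sum_single[symmetric])
  finally show ?thesis
    unfolding arc_eval_def psubst_jet_coeff psubst_single[OF fps_pconst_hom]
    by (simp add: pconst_simps bseries_def)
qed

definition jet_product :: "((nat \<Rightarrow>\<^sub>0 nat) \<times> nat) list \<Rightarrow> (nat \<times> nat) cpoly" where
  "jet_product l = prod_list (map (\<lambda>(a, k). jet_coeff (single a 1) k) l)"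

lemma arc_eval_product:
  "arc_eval n e (jet_product l) = single
    (sum_list (map fst l) + single n (sum_list (map snd l))) (\<Prod>(a, k)\<leftarrow>l. expo e a gchoose k)"
proof (induction l)
  case Nil
  then show ?case by (simp add: jet_product_def arc_eval_hom_simps)
next
  case (Cons x l)
  obtain a k where x: "x = (a, k)" by (cases x)
  have "arc_eval n e (jet_product (x # l)) =
      arc_eval n e (jet_coeff (single a 1) k) * arc_eval n e (jet_product l)"
    by (simp add: jet_product_def x arc_eval_hom_simps)
  then show ?case by (simp add: Cons arc_eval_monomial mult_single x algebra_simps single_add)
qed

text \<open>\<open>M\<close> is the monomial uv. A product of jet coefficients of total order 2 in t
  has one factor of order 2, with value \<open>expo e a gchoose 2\<close>, or two factors of order
  1, with value \<open>expo e a * expo e b\<close>. The conditions \<open>square\<close> and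
  \<open>cross\<close> make the arcs \<open>e1\<close> and \<open>e2\<close> agree in these two
  cases.\<close>

locale quadratic_obstruction =
  fixes w :: "int list" and M :: "nat \<Rightarrow>\<^sub>0 nat" and e1 e2 :: "nat \<Rightarrow> complex"
  assumes keys_M: "keys M \<subseteq> {..<length w}"
    and square: "\<And>a b. weight w a = 0 \<Longrightarrow> a + b = M \<Longrightarrow> (expo e1 a gchoose 2) = (expo e2 a gchoose 2)"
    and cross: "\<And>a b c. weight w a = 0 \<Longrightarrow> weight w b = 0 \<Longrightarrow> a + b + c = M \<Longrightarrow>
      expo e1 a * expo e1 b = expo e2 a * expo e2 b"
begin

definition invs :: "((nat \<Rightarrow>\<^sub>0 nat) \<times> nat) list set" where
  "invs = {l. \<forall>(a, k)\<in>set l. keys a \<subseteq> {..<length w} \<and> weight w a = 0}"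

text \<open>The coefficients of \<rho>^M \<xi>^2 on the two arcs are compared. The index
  \<open>length w\<close> belongs to no coordinate of V and serves as \<xi>.\<close>

definition \<theta> :: "(nat \<times> nat) cpoly \<Rightarrow> complex" where
  "\<theta> g = lookup (arc_eval (length w) e1 g) (M + single (length w) 2)
       - lookup (arc_eval (length w) e2 g) (M + single (length w) 2)"

lemma weight0_product:
  "sum_list (map snd l) = 0 \<Longrightarrow> (\<Prod>(a, k)\<leftarrow>l. expo e a gchoose k) = 1"
  by (induction l) auto

lemma weight1_product:
  assumes "l \<in> invs" "sum_list (map snd l) = 1"
  shows "\<exists>a c. weight w a = 0 \<and> sum_list (map fst l) = a + c \<and> (\<forall>e. (\<Prod>(a, k)\<leftarrow>l. expo e a gchoose k) = expo e a)"
  using assms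
proof (induction l)
  case (Cons x l)
  obtain a k where x: "x = (a, k)" by (cases x)
  have "k + sum_list (map snd l) = 1" using Cons.prems by (simp add: x)
  then have "(k = 0 \<and> sum_list (map snd l) = 1) \<or> (k = 1 \<and> sum_list (map snd l) = 0)"
    by linarith
  then consider "k = 0" "sum_list (map snd l) = 1" | "k = 1" "sum_list (map snd l) = 0"
    by metis
  then show ?case
  proof cases
    case 1
    then obtain a' c where "weight w a' = 0" "sum_list (map fst l) = a' + c" "\<forall>e. (\<Prod>(a, k)\<leftarrow>l. expo e a gchoose k) = expo e a'"
      using Cons by (auto simp: invs_def)
    then show ?thesis using 1 by (intro exI[of _ a'] exI[of _ "a + c"]) (simp add: x algebra_simps)
  next
    case 2
    then show ?thesis using Cons.prems by (intro exI[of _ a] exI[of _ "sum_list (map fst l)"]) (auto simp: x weight0_product invs_def)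
  qed
qed simp

text \<open>Factors of order 0 contribute 1 and are absorbed into c; what is left is one factor of
  order 2 or two factors of order 1.\<close>

lemma weight2_product:
  assumes "l \<in> invs" "sum_list (map snd l) = 2"
  shows "(\<exists>a c. weight w a = 0 \<and> sum_list (map fst l) = a + c \<and> (\<forall>e. (\<Prod>(a, k)\<leftarrow>l. expo e a gchoose k) = expo e a gchoose 2)) \<or>
    (\<exists>a b c. weight w a = 0 \<and> weight w b = 0 \<and> sum_list (map fst l) = a + b + c \<and>
      (\<forall>e. (\<Prod>(a, k)\<leftarrow>l. expo e a gchoose k) = expo e a * expo e b))"
  using assms
proof (induction l)
  case (Cons x l)
  obtain a k where x: "x = (a, k)" by (cases x)
  have a: "weight w a = 0" "l \<in> invs" using Cons.prems by (auto simp: invs_def x)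
  have "k + sum_list (map snd l) = 2" using Cons.prems by (simp add: x)
  then have "(k = 0 \<and> sum_list (map snd l) = 2) \<or> (k = 1 \<and> sum_list (map snd l) = 1) \<or> (k = 2 \<and> sum_list (map snd l) = 0)"
    by linarith
  then consider "k = 0" "sum_list (map snd l) = 2" | "k = 1" "sum_list (map snd l) = 1" | "k = 2" "sum_list (map snd l) = 0"
    by metis
  then show ?case
  proof cases
    case 1
    from Cons.IH[OF a(2) 1(2)] show ?thesis
    proof (elim disjE exE conjE)
      fix a' c assume "weight w a' = 0" "sum_list (map fst l) = a' + c" "\<forall>e. (\<Prod>(a, k)\<leftarrow>l. expo e a gchoose k) = expo e a' gchoose 2"
      then show ?thesis using 1 by (intro disjI1 exI[of _ a'] exI[of _ "a + c"]) (simp add: x algebra_simps)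
    next
      fix a' b c assume "weight w a' = 0" "weight w b = 0" "sum_list (map fst l) = a' + b + c"
        "\<forall>e. (\<Prod>(a, k)\<leftarrow>l. expo e a gchoose k) = expo e a' * expo e b"
      then show ?thesis using 1 by (intro disjI2 exI[of _ a'] exI[of _ b] exI[of _ "a + c"]) (simp add: x algebra_simps)
    qed
  next
    case 2
    obtain b c where "weight w b = 0" "sum_list (map fst l) = b + c" "\<forall>e. (\<Prod>(a, k)\<leftarrow>l. expo e a gchoose k) = expo e b"
      using weight1_product[OF a(2) 2(2)] by blast
    then show ?thesis using 2 a by (intro disjI2 exI[of _ a] exI[of _ b] exI[of _ c]) (simp add: x algebra_simps)
  next
    case 3
    then show ?thesis using a by (intro disjI1 exI[of _ a] exI[of _ "sum_list (map fst l)"]) (simp add: x weight0_product)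
  qed
qed simp

lemma \<theta>_product:
  assumes l: "l \<in> invs"
  shows "\<theta> (jet_product l) = 0"
proof (cases "sum_list (map fst l) + single (length w) (sum_list (map snd l)) = M + single (length w) 2")
  case True
  \<comment> \<open>The variable \<xi> occurs neither in the invariants nor in \<open>M\<close>, so
    its exponent reads off the total order in t.\<close>
  have keys: "lookup (sum_list (map fst l)) (length w) = 0"
    using l
  proof (induction l)
    case (Cons x l)
    have "lookup (fst x) (length w) = 0" 
      using Cons.prems by (cases x) (auto simp: invs_def subset_iff in_keys_iff)
    then show ?case using Cons by (auto simp: lookup_add invs_def)
  qed simp
  have "lookup M (length w) = 0" using keys_M by (auto simp: subset_iff in_keys_iff)
  then have k2: "sum_list (map snd l) = 2"
    using arg_cong[OF True, of "\<lambda>\<mu>. lookup \<mu> (length w)"] keys by (simp add: lookup_add)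
  then have M: "sum_list (map fst l) = M" using True by simp
  have "(\<Prod>(a, k)\<leftarrow>l. expo e1 a gchoose k) = (\<Prod>(a, k)\<leftarrow>l. expo e2 a gchoose k)"
    using weight2_product[OF l k2] unfolding M
  proof (elim disjE exE conjE)
    fix a c assume "weight w a = 0" "M = a + c" "\<forall>e. (\<Prod>(a, k)\<leftarrow>l. expo e a gchoose k) = expo e a gchoose 2"
    then show ?thesis using square[of a c] by simp
  next
    fix a b c assume "weight w a = 0" "weight w b = 0" "M = a + b + c"
      "\<forall>e. (\<Prod>(a, k)\<leftarrow>l. expo e a gchoose k) = expo e a * expo e b"
    then show ?thesis using cross[of a b c] by simp
  qed
  then show ?thesis by (simp add: \<theta>_def arc_eval_product True)
next
  case False
  then show ?thesis by (simp add: \<theta>_def arc_eval_product lookup_single)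
qed

lemma \<theta>_simps: "\<theta> (f + g) = \<theta> f + \<theta> g" "\<theta> (pconst c * f) = c * \<theta> f" "\<theta> 0 = 0"
  by (simp_all add: \<theta>_def arc_eval_hom_simps lookup_add pconst_mult_lookup algebra_simps)

text \<open>\<theta> is linear but not multiplicative, so the induction runs through
  \<open>Ann\<close>, the elements killed by \<theta> after multiplication by every product of jet
  coefficients of invariant monomials. \<open>Ann\<close> is stable under multiplication by the
  image and contains 1.\<close>

lemma \<theta>_jet_image:
  assumes "f \<in> jet_image w \<infinity>"
  shows "\<theta> f = 0"
proof -
  define Ann where "Ann = {g. \<forall>l\<in>invs. \<theta> (g * jet_product l) = 0}"
  have add: "f + g \<in> Ann" if "f \<in> Ann" "g \<in> Ann" for f g
    using that by (simp add: Ann_def distrib_right \<theta>_simps)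
  have const: "pconst c * f \<in> Ann" if "f \<in> Ann" for f c
    using that by (simp add: Ann_def mult.assoc \<theta>_simps)
  have zero: "0 \<in> Ann" by (simp add: Ann_def \<theta>_simps)
  have mono: "jet_coeff (single a 1) k * f \<in> Ann"
    if "f \<in> Ann" "keys a \<subseteq> {..<length w}" "weight w a = 0" for a k f
  proof -
    have "jet_coeff (single a 1) k * f * jet_product l = f * jet_product ((a, k) # l)" for l
      by (simp add: jet_product_def algebra_simps)
    moreover have "(a, k) # l \<in> invs" if "l \<in> invs" for l
      using that \<open>keys a \<subseteq> _\<close> \<open>weight w a = 0\<close> by (auto simp: invs_def)
    ultimately show ?thesis using that(1) by (simp add: Ann_def)
  qed
  have jet_sum: "jet_coeff (sum X A) k = (\<Sum>x\<in>A. jet_coeff (X x) k)" for X :: "(nat \<Rightarrow>\<^sub>0 nat) \<Rightarrow> nat cpoly" and A k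
    using jet_coeff_simps(3)[of 0 k]
    by (induction A rule: infinite_finite_induct) (auto simp: jet_coeff_simps pconst_simps split: if_splits)
  have var: "jet_coeff a k * f \<in> Ann" if "f \<in> Ann" "a \<in> carrier (inv_ring w)" for a k f
  proof -
    have "jet_coeff (single \<mu> c) k = pconst c * jet_coeff (single \<mu> 1) k" for \<mu> c
    proof -
      have "jet_coeff (pconst c * single \<mu> 1) k =
          (\<Sum>i\<le>k. if i = 0 then pconst c * jet_coeff (single \<mu> 1) (k - i) else 0)"
        unfolding jet_coeff_simps by (intro sum.cong) auto
      then show ?thesis by (simp add: pconst_def mult_single)
    qed
    note single = this
    have "jet_coeff a k = jet_coeff (\<Sum>\<mu>\<in>keys a. single \<mu> (lookup a \<mu>)) k"
      by (rule arg_cong[OF poly_mapping_sum_single])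
    also have "\<dots> = (\<Sum>\<mu>\<in>keys a. pconst (lookup a \<mu>) * jet_coeff (single \<mu> 1) k)"
      unfolding jet_sum by (intro sum.cong refl single)
    finally have "jet_coeff a k = (\<Sum>\<mu>\<in>keys a. pconst (lookup a \<mu>) * jet_coeff (single \<mu> 1) k)" .
    then have "jet_coeff a k * f = (\<Sum>\<mu>\<in>keys a. pconst (lookup a \<mu>) * (jet_coeff (single \<mu> 1) k * f))"
      by (simp add: sum_distrib_right mult.assoc)
    also have "\<dots> \<in> Ann"
    proof -
      have "(\<Sum>\<mu>\<in>B. pconst (lookup a \<mu>) * (jet_coeff (single \<mu> 1) k * f)) \<in> Ann"
        if "B \<subseteq> keys a" for B
        using finite_subset[OF that] that
      proof (induction B rule: infinite_finite_induct)
        case (insert \<mu> B)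
        have "pconst (lookup a \<mu>) * (jet_coeff (single \<mu> 1) k * f) \<in> Ann"
          using insert.prems that \<open>f \<in> Ann\<close> \<open>a \<in> carrier _\<close>
          by (intro const mono) (auto simp: inv_ring_iff coord_ring_def poly_ring_carrier)
        then show ?case using insert by (simp add: add)
      qed (auto simp: zero)
      then show ?thesis by simp
    qed
    finally show ?thesis .
  qed
  obtain F where F: "F \<in> carrier (poly_ring (jet_symbols \<infinity> (inv_ring w)))" "f = jet_subst F"
    using assms by (auto simp: jet_image_def)
  have "jet_subst F * g \<in> Ann" if "g \<in> Ann" for g
    using F(1) that
  proof (induction arbitrary: g rule: poly_ring_induct)
    case (const c)
    then show ?case by (simp add: jet_subst_def psubst_hom_simps[OF pconst_hom] \<open>\<And>f c. f \<in> Ann \<Longrightarrow> pconst c * f \<in> Ann\<close>)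
  next
    case (var v)
    then show ?case by (cases v) (simp add: jet_subst_def psubst_hom_simps[OF pconst_hom] jet_symbols_def \<open>\<And>a k f. f \<in> Ann \<Longrightarrow> a \<in> _ \<Longrightarrow> jet_coeff a k * f \<in> Ann\<close>)
  next
    case (add f h)
    then show ?case by (simp add: jet_subst_def psubst_hom_simps[OF pconst_hom] distrib_right \<open>\<And>f g. f \<in> Ann \<Longrightarrow> g \<in> Ann \<Longrightarrow> f + g \<in> Ann\<close>)
  next
    case (mult f h)
    then show ?case by (simp add: jet_subst_def psubst_hom_simps[OF pconst_hom] mult.assoc)
  qed
  moreover have "1 \<in> Ann" by (simp add: Ann_def \<theta>_product)
  ultimately have "f * 1 \<in> Ann" using F by blast
  moreover have "[] \<in> invs" by (simp add: invs_def)
  ultimately show ?thesis by (auto simp: Ann_def jet_product_def dest!: bspec[of invs _ "[]"])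
qed

end

section \<open>The witness and its values on the two arcs\<close>

lemma fps_power_nth_1:
  fixes A :: "complex fps"
  assumes "fps_nth A 0 \<noteq> 0"
  shows "fps_nth (A ^ k) 1 = of_nat k * fps_nth A 0 ^ k * (fps_nth A 1 / fps_nth A 0)"
proof (induction k)
  case (Suc k)
  have "fps_nth (A ^ Suc k) 1 = fps_nth A 0 * fps_nth (A ^ k) 1 + fps_nth A 1 * fps_nth A 0 ^ k"
    by (simp add: fps_mult_nth_1 fps_power_zeroth)
  then show ?case unfolding Suc using assms by (simp only: power_Suc of_nat_Suc) (simp add: field_simps)
qed simp

text \<open>The logarithmic derivative of a power is z times that of A. Orders 0 and 1 suffice,
  because the witness involves no higher ones.\<close>

lemma fps_powi_nth:
  fixes A :: "complex fps"
  assumes "fps_nth A 0 \<noteq> 0"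
  shows "fps_nth (A powi z) 0 = fps_nth A 0 powi z"
    and "fps_nth (A powi z) 1 = of_int z * fps_nth A 0 powi z * (fps_nth A 1 / fps_nth A 0)"
proof -
  have 0: "fps_nth (inverse A) 0 = inverse (fps_nth A 0)" by simp
  have "fps_nth (A * inverse A) 1 = 0" using assms by (simp add: inverse_mult_eq_1')
  then have "fps_nth A 0 * fps_nth (inverse A) 1 + fps_nth A 1 * inverse (fps_nth A 0) = 0"
    by (simp add: fps_mult_nth_1)
  then have 1: "fps_nth (inverse A) 1 / fps_nth (inverse A) 0 = - (fps_nth A 1 / fps_nth A 0)"
    using assms by (simp add: field_simps add_eq_0_iff)
  show "fps_nth (A powi z) 0 = fps_nth A 0 powi z"
    by (simp add: power_int_def fps_power_zeroth)
  show "fps_nth (A powi z) 1 = of_int z * fps_nth A 0 powi z * (fps_nth A 1 / fps_nth A 0)"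
  proof (cases "z \<ge> 0")
    case True
    then show ?thesis using fps_power_nth_1[OF assms, of "nat z"] by (simp add: power_int_def)
  next
    case False
    have "fps_nth (inverse A ^ nat (- z)) 1 = of_nat (nat (- z)) * fps_nth (inverse A) 0 ^ nat (- z) * (- (fps_nth A 1 / fps_nth A 0))"
      using fps_power_nth_1[of "inverse A" "nat (- z)"] assms unfolding 1 by simp
    then show ?thesis using False by (simp add: power_int_def)
  qed
qed

text \<open>With \<open>u = x\<^sub>1\<^sup>\<alpha> y\<^sup>\<beta>\<close> and an invariant monomial \<open>v\<close> this is \<open>v u'\<^sup>2 / u\<close>; the exponents
  \<open>\<alpha>\<close> and \<open>b\<close> of \<open>x\<^sub>1\<close> and \<open>y\<close> in \<open>u v\<close> are at least 2, so that it is a polynomial.\<close>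

definition witness :: "nat \<Rightarrow> nat \<Rightarrow> nat \<Rightarrow> nat \<Rightarrow> nat \<Rightarrow> nat \<Rightarrow> nat \<Rightarrow> (nat \<times> nat) cpoly" where
  "witness i1 i2 j \<alpha> \<beta> \<alpha>2 b = pvar (i1, 0) ^ (\<alpha> - 2) * pvar (i2, 0) ^ \<alpha>2 * pvar (j, 0) ^ (b - 2) *
    (pconst (of_nat \<alpha>) * pvar (i1, 1) * pvar (j, 0) + pconst (of_nat \<beta>) * pvar (i1, 0) * pvar (j, 1))\<^sup>2"

text \<open>A unit changes x' by its logarithmic derivative \<theta> times the weight times x. In
  \<alpha> x' y + \<beta> x y' these terms cancel since u has weight zero; the remaining power of
  the constant term of \<gamma> is trivial since uv has weight zero.\<close>

lemma witness_invariant: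
  assumes idx: "i1 < length w" "i2 < length w" "j < length w"
    and ge: "\<alpha> \<ge> 2" "b \<ge> 2"
    and u: "int \<alpha> * w ! i1 + int \<beta> * w ! j = 0"
    and uv: "int \<alpha> * w ! i1 + int \<alpha>2 * w ! i2 + int b * w ! j = 0"
  shows "witness i1 i2 j \<alpha> \<beta> \<alpha>2 b \<in> carrier (inv_jet_ring w \<infinity>)"
  unfolding inv_jet_ring_iff
proof (intro conjI ballI allI)
  show "witness i1 i2 j \<alpha> \<beta> \<alpha>2 b \<in> carrier (coord_jet_ring w \<infinity>)"
    unfolding witness_def coord_jet_ring_def using idx by (intro poly_ring_closed') auto
  fix \<gamma> v assume "\<gamma> \<in> jet_group \<infinity>"
  then have g0: "fps_nth \<gamma> 0 \<noteq> 0" by (simp add: jet_group_def)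
  define g where "g = fps_nth \<gamma> 0"
  define \<theta> where "\<theta> = fps_nth \<gamma> 1 / g"
  have g: "g \<noteq> 0" using g0 by (simp add: g_def)
  have a0: "jet_act w \<gamma> v (i, 0) = g powi (w ! i) * v (i, 0)" for i
    by (simp add: jet_act_def fps_powi_nth[OF g0] g_def)
  have a1: "jet_act w \<gamma> v (i, 1) = g powi (w ! i) * (v (i, 1) + of_int (w ! i) * \<theta> * v (i, 0))" for i
    by (simp add: jet_act_def fps_mult_nth_1 fps_powi_nth[OF g0] g_def \<theta>_def algebra_simps del: One_nat_def)
  define G where "G i = g powi (w ! i)" for i
  have "of_nat \<alpha> * of_int (w ! i1) + of_nat \<beta> * of_int (w ! j) = (0::complex)"
    using arg_cong[OF u, of "of_int :: int \<Rightarrow> complex"] by simp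
  then have "of_nat \<alpha> * of_int (w ! i1) = - (of_nat \<beta> * of_int (w ! j) :: complex)"
    by (simp add: add_eq_0_iff2)
  then have *: "of_nat \<alpha> * (of_int (w ! i1) * X) = - (of_nat \<beta> * (of_int (w ! j) * (X::complex)))" for X
    by (metis minus_mult_left mult.assoc)
  have L: "of_nat \<alpha> * (G i1 * (v (i1, 1) + of_int (w ! i1) * \<theta> * v (i1, 0))) * (G j * v (j, 0)) +
        of_nat \<beta> * (G i1 * v (i1, 0)) * (G j * (v (j, 1) + of_int (w ! j) * \<theta> * v (j, 0)))
      = G i1 * G j * (of_nat \<alpha> * v (i1, 1) * v (j, 0) + of_nat \<beta> * v (i1, 0) * v (j, 1))"
    by (simp add: algebra_simps *)
  have "G i1 ^ (\<alpha> - 2) * G i2 ^ \<alpha>2 * G j ^ (b - 2) * (G i1 * G j)\<^sup>2 = (G i1 ^ (\<alpha> - 2) * (G i1)\<^sup>2) * G i2 ^ \<alpha>2 * (G j ^ (b - 2) * (G j)\<^sup>2)"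
    by (simp add: power_mult_distrib)
  also have "\<dots> = G i1 ^ \<alpha> * G i2 ^ \<alpha>2 * G j ^ b"
    using ge by (metis le_add_diff_inverse2 power_add)
  also have "\<dots> = g powi (int \<alpha> * w ! i1 + int \<alpha>2 * w ! i2 + int b * w ! j)"
  proof -
    have "G i ^ n = g powi (int n * w ! i)" for i n
      unfolding G_def by (metis mult.commute power_int_mult power_int_of_nat)
    then show ?thesis using g by (simp add: power_int_add)
  qed
  finally have G: "G i1 ^ (\<alpha> - 2) * G i2 ^ \<alpha>2 * G j ^ (b - 2) * (G i1 * G j)\<^sup>2 = 1"
    unfolding uv by simp
  have "peval (jet_act w \<gamma> v) (witness i1 i2 j \<alpha> \<beta> \<alpha>2 b) =
      (G i1 ^ (\<alpha> - 2) * G i2 ^ \<alpha>2 * G j ^ (b - 2) * (G i1 * G j)\<^sup>2) * peval v (witness i1 i2 j \<alpha> \<beta> \<alpha>2 b)"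
    unfolding witness_def psubst_hom_simps[OF id_hom] psubst_power[OF id_hom] a0 a1 G_def[symmetric] L
    by (simp add: power_mult_distrib mult_ac)
  then show "peval (jet_act w \<gamma> v) (witness i1 i2 j \<alpha> \<beta> \<alpha>2 b) = peval v (witness i1 i2 j \<alpha> \<beta> \<alpha>2 b)"
    unfolding G by simp
qed

lemma single_one_power: "single (single (i::'v) 1) (1::complex) ^ n = single (single i n) 1"
  using pvar_power[of i n] by (simp add: pvar_def)

lemma pconst_mult_single: "pconst c * single \<mu> d = single \<mu> (c * d)"
  by (simp add: pconst_def mult_single)

text \<open>The exponent 1/\<alpha> normalizes the first arc: u gets exponent 1 and the witness
  becomes \<rho>^M \<xi>^2 with coefficient 1. On the second arc the coordinates \<open>i1\<close>
  and \<open>j\<close> are constant, so u' and with it the witness vanish.\<close>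

lemma not_surjective:
  assumes idx: "i1 < length w" "i2 < length w" "j < length w" "i1 \<noteq> j" "i1 \<noteq> i2" "i2 \<noteq> j \<or> \<alpha>2 = 0"
    and ge: "\<alpha> \<ge> 2" "b \<ge> 2"
    and u: "int \<alpha> * w ! i1 + int \<beta> * w ! j = 0"
    and uv: "int \<alpha> * w ! i1 + int \<alpha>2 * w ! i2 + int b * w ! j = 0"
    and obst: "quadratic_obstruction w
      (single i1 \<alpha> + single i2 \<alpha>2 + single j b)
      (\<lambda>i. if i = i1 then 1 / of_nat \<alpha> else 0) (\<lambda>i. if i = i2 then 1 / of_nat \<alpha>2 else 0)"
  shows "jet_image w \<infinity> \<noteq> carrier (inv_jet_ring w \<infinity>)"
proof
  define M where "M = single i1 \<alpha> + single i2 \<alpha>2 + single j b"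
  define e1 :: "nat \<Rightarrow> complex" where "e1 = (\<lambda>i. if i = i1 then 1 / of_nat \<alpha> else 0)"
  define e2 :: "nat \<Rightarrow> complex" where "e2 = (\<lambda>i. if i = i2 then 1 / of_nat \<alpha>2 else 0)"
  interpret quadratic_obstruction w M e1 e2 using obst by (simp add: M_def e1_def e2_def)
  let ?n = "length w" and ?f = "witness i1 i2 j \<alpha> \<beta> \<alpha>2 b"
  assume "jet_image w \<infinity> = carrier (inv_jet_ring w \<infinity>)"
  then have "?f \<in> jet_image w \<infinity>" using witness_invariant[OF idx(1-3) ge u uv] by simp
  then have "\<theta> ?f = 0" by (rule \<theta>_jet_image)
  have \<alpha>: "\<alpha> \<noteq> 0" using ge by simp
  let ?s = "\<lambda>\<mu>. single \<mu> (1::complex)"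
  let ?x = "\<lambda>i n. single (i::nat) (n::nat)"
  have v0: "arc_eval ?n e (pvar (i, 0)) = ?s (?x i 1)" for e i
    by (simp add: arc_eval_hom_simps)
  have "arc_eval ?n e1 (pconst (of_nat \<alpha>) * pvar (i1, 1) * pvar (j, 0) + pconst (of_nat \<beta>) * pvar (i1, 0) * pvar (j, 1))
      = ?s (?x i1 1 + ?x j 1 + ?x ?n 1)"
    using idx \<alpha> by (simp add: arc_eval_hom_simps e1_def pconst_mult_single mult_single add_ac del: One_nat_def)
  then have "arc_eval ?n e1 ?f = ?s (?x i1 (\<alpha> - 2)) * ?s (?x i2 \<alpha>2) * ?s (?x j (b - 2)) * (?s (?x i1 1 + ?x j 1 + ?x ?n 1))\<^sup>2"
    unfolding witness_def arc_eval_hom_simps(2)[of _ _ "_ * _"] arc_eval_hom_simps(2)[of _ _ "_ ^ _"] arc_eval_hom_simps(6) v0 single_one_power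
    by (simp only:)
  also have "\<dots> = ?s (?x i1 (\<alpha> - 2) + ?x i2 \<alpha>2 + ?x j (b - 2) + (?x i1 1 + ?x j 1 + ?x ?n 1) + (?x i1 1 + ?x j 1 + ?x ?n 1))"
    by (simp add: power2_eq_square mult_single add_ac del: One_nat_def)
  also have "\<dots> = ?s (M + ?x ?n 2)"
    by (rule arg_cong[of _ _ ?s], rule poly_mapping_eqI)
      (use ge in \<open>auto simp: M_def lookup_add lookup_single when_def\<close>)
  finally have 1: "arc_eval ?n e1 ?f = ?s (M + ?x ?n 2)" .
  have "arc_eval ?n e2 (pconst (of_nat \<alpha>) * pvar (i1, 1) * pvar (j, 0) + pconst (of_nat \<beta>) * pvar (i1, 0) * pvar (j, 1)) = 0"
    using idx by (auto simp: arc_eval_hom_simps e2_def simp del: One_nat_def)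
  then have "arc_eval ?n e2 ?f = 0"
    unfolding witness_def arc_eval_hom_simps(2)[of _ _ "_ * _"] arc_eval_hom_simps(6) by simp
  then have "\<theta> ?f = 1" by (simp add: \<theta>_def 1)
  then show False using \<open>\<theta> ?f = 0\<close> by simp
qed

section \<open>Two configurations of weights that admit the obstruction\<close>

lemma expo_delta: "expo (\<lambda>i. if i = k then c else 0) a = of_nat (lookup a k) * c"
proof -
  have "expo (\<lambda>i. if i = k then c else 0) a = (\<Sum>i\<in>keys a. if i = k then of_nat (lookup a i) * c else 0)"
    unfolding expo_def by (rule sum.cong) auto
  then show ?thesis by (simp add: in_keys_iff)
qed

lemma gchoose_2_eq: "(of_real p gchoose 2 :: complex) = of_real (p * (p - 1) / 2)"
  by (simp add: gbinomial_prod_rev numeral_2_eq_2 field_simps)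

text \<open>Here v = 1 and the second arc is constant. As \<alpha> and \<beta> are coprime, the
  invariant divisors of u are 1 and u, with exponents 0 and 1, where \<open>gchoose 2\<close>
  vanishes; and two factors of u cannot both be u.\<close>

lemma not_surjective_coprime:
  assumes idx: "i < length w" "j < length w" "i \<noteq> j"
    and ge: "\<alpha> \<ge> 2" "\<beta> \<ge> 2" and cop: "coprime \<alpha> \<beta>" and u: "int \<alpha> * w ! i + int \<beta> * w ! j = 0" and wj: "w ! j \<noteq> 0"
  shows "jet_image w \<infinity> \<noteq> carrier (inv_jet_ring w \<infinity>)"
proof (rule not_surjective[of i w j j 0 \<alpha> \<beta> \<beta>])
  let ?M = "single i \<alpha> + single j 0 + single j \<beta>"
  have a: "lookup a i = 0 \<or> lookup a i = \<alpha>"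
    if w: "weight w a = 0" and M: "a + b = ?M" for a b
  proof -
    have lk: "lookup a k + lookup b k = lookup ?M k" for k
      using arg_cong[OF M, of "\<lambda>\<mu>. lookup \<mu> k"] by (simp add: lookup_add)
    let ?a = "lookup a i" and ?c = "lookup a j"
    have "keys a \<subseteq> {i, j}"
    proof
      fix k assume "k \<in> keys a"
      then show "k \<in> {i, j}" using lk[of k] by (auto simp: in_keys_iff lookup_add lookup_single when_def split: if_splits)
    qed
    then have "int ?a * w ! i + int ?c * w ! j = 0"
      using w idx(3) by (simp add: weight_superset[of "{i, j}"])
    then have "int \<alpha> * (int ?a * w ! i) = - (int \<alpha> * int ?c * w ! j)" by (simp add: algebra_simps add_eq_0_iff)
    moreover have "int \<alpha> * w ! i = - (int \<beta> * w ! j)" using u by linarith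
    then have "int ?a * (int \<alpha> * w ! i) = - (int ?a * int \<beta> * w ! j)" by (simp only: mult_minus_right mult.assoc)
    ultimately have "- (int \<alpha> * int ?c * w ! j) = - (int ?a * int \<beta> * w ! j)" by (metis mult.left_commute)
    then have "int ?a * int \<beta> * w ! j = int \<alpha> * int ?c * w ! j" by linarith
    then have "int (?a * \<beta>) = int (\<alpha> * ?c)" using wj by simp
    then have "?a * \<beta> = \<alpha> * ?c" by (simp only: of_nat_eq_iff)
    then have "\<alpha> dvd ?a * \<beta>" by simp
    then have "\<alpha> dvd ?a" using cop by (simp add: coprime_dvd_mult_left_iff)
    moreover have "?a \<le> \<alpha>" using lk[of i] idx(3) by (simp add: lookup_add lookup_single)
    ultimately show ?thesis using dvd_imp_le[of \<alpha> ?a] by auto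
  qed
  \<comment> \<open>\<open>1 / of_nat 0\<close> is 0, so the second family of exponents is
    identically zero.\<close>
  show "quadratic_obstruction w ?M (\<lambda>k. if k = i then 1 / of_nat \<alpha> else 0) (\<lambda>k. if k = j then 1 / of_nat 0 else 0)"
  proof
    show "keys ?M \<subseteq> {..<length w}"
      using idx keys_add[of "single i \<alpha>" "single j \<beta>"] by (auto split: if_splits)
  next
    fix a b assume "weight w a = 0" "a + b = ?M"
    then show "(expo (\<lambda>k. if k = i then 1 / of_nat \<alpha> else 0) a gchoose 2) = (expo (\<lambda>k. if k = j then 1 / of_nat 0 else 0) a gchoose 2)"
      using a[of a b] ge by (auto simp: expo_delta gbinomial_prod_rev numeral_2_eq_2)
  next
    fix a b c assume ab: "weight w a = 0" "weight w b = 0" "a + b + c = ?M"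
    have "a + (b + c) = ?M" "b + (a + c) = ?M" using ab(3) by (simp_all add: algebra_simps)
    from a[OF ab(1) this(1)] a[OF ab(2) this(2)] have "lookup a i = 0 \<or> lookup b i = 0"
      using arg_cong[OF ab(3), of "\<lambda>\<mu>. lookup \<mu> i"] idx(3) ge by (auto simp: lookup_add lookup_single)
    then show "expo (\<lambda>k. if k = i then 1 / of_nat \<alpha> else 0) a * expo (\<lambda>k. if k = i then 1 / of_nat \<alpha> else 0) b =
       expo (\<lambda>k. if k = j then 1 / of_nat 0 else 0) a * expo (\<lambda>k. if k = j then 1 / of_nat 0 else 0) b"
      by (auto simp: expo_delta)
  qed
qed (use idx ge u in auto)

text \<open>Here u = x_1^\<alpha> y and v = x_2^\<alpha>2 y^\<beta>2. For an invariant divisor of uv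
  let p and q be its exponents on the two arcs; weight zero makes p + \<beta>2 q the exponent of y.
  If \<beta>2 = 1, this integer is 0, 1 or 2: in the extreme cases p = q is 0 or 1, in the middle
  one q = 1 - p, and always p (p - 1) = q (q - 1). If \<alpha>2 = 1, then q is an integer, hence so
  is p, and both are 0 or 1.\<close>

lemma not_surjective_three:
  assumes idx: "i1 < length w" "i2 < length w" "j < length w" "i1 \<noteq> j" "i1 \<noteq> i2" "i2 \<noteq> j"
    and ge: "\<alpha> \<ge> 2" "\<alpha>2 \<ge> 1" "\<beta>2 \<ge> 1" and one: "\<alpha>2 = 1 \<or> \<beta>2 = 1"
    and u: "int \<alpha> * w ! i1 + w ! j = 0" and v: "int \<alpha>2 * w ! i2 + int \<beta>2 * w ! j = 0" and wj: "w ! j \<noteq> 0"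
  shows "jet_image w \<infinity> \<noteq> carrier (inv_jet_ring w \<infinity>)"
proof (rule not_surjective[of i1 w i2 j \<alpha>2 \<alpha> "1 + \<beta>2" 1])
  let ?M = "single i1 \<alpha> + single i2 \<alpha>2 + single j (1 + \<beta>2)"
  let ?p = "\<lambda>a. real (lookup a i1) / real \<alpha>" and ?q = "\<lambda>a. real (lookup a i2) / real \<alpha>2"
  have M: "lookup ?M i1 = \<alpha>" "lookup ?M i2 = \<alpha>2" "lookup ?M j = 1 + \<beta>2"
    using idx by (auto simp: lookup_add lookup_single)
  have rel: "?p a + real \<beta>2 * ?q a = real (lookup a j)"
    if w: "weight w a = 0" and aM: "a + b = ?M" for a b
  proof -
    have lk: "lookup a k + lookup b k = lookup ?M k" for k
      using arg_cong[OF aM, of "\<lambda>\<mu>. lookup \<mu> k"] by (simp add: lookup_add)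
    let ?a = "real (lookup a i1)" and ?b = "real (lookup a i2)" and ?c = "real (lookup a j)"
    have "keys a \<subseteq> {i1, i2, j}"
    proof
      fix k assume "k \<in> keys a"
      then show "k \<in> {i1, i2, j}" using lk[of k] by (auto simp: in_keys_iff lookup_add lookup_single when_def split: if_splits)
    qed
    then have "of_int (int (lookup a i1) * w ! i1 + int (lookup a i2) * w ! i2 + int (lookup a j) * w ! j) = (0::real)"
      using w idx by (simp add: weight_superset[of "{i1, i2, j}"] add.assoc)
    then have 1: "?a * real_of_int (w ! i1) + ?b * real_of_int (w ! i2) + ?c * real_of_int (w ! j) = 0" by simp
    have "real \<alpha> * real_of_int (w ! i1) + real_of_int (w ! j) = 0"
      using arg_cong[OF u, of real_of_int] by simp
    then have w1: "real_of_int (w ! i1) = - real_of_int (w ! j) / real \<alpha>" using ge by (simp add: field_simps add_eq_0_iff)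
    have "real \<alpha>2 * real_of_int (w ! i2) + real \<beta>2 * real_of_int (w ! j) = 0"
      using arg_cong[OF v, of real_of_int] by simp
    then have w2: "real_of_int (w ! i2) = - real \<beta>2 * real_of_int (w ! j) / real \<alpha>2" using ge by (simp add: field_simps add_eq_0_iff)
    have "real_of_int (w ! j) * (?p a + real \<beta>2 * ?q a - ?c) = 0"
      using 1 unfolding w1 w2 by (simp add: algebra_simps)
    then show ?thesis using wj by simp
  qed
  have bounds: "0 \<le> ?p a" "0 \<le> ?q a" for a by simp_all
  have split: "?p a + ?p b + ?p c = 1" "?q a + ?q b + ?q c = 1"
      "lookup a j + lookup b j + lookup c j = 1 + \<beta>2"
    if "a + b + c = ?M" for a b c
  proof -
    have lk: "lookup a k + lookup b k + lookup c k = lookup ?M k" for k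
      using arg_cong[OF that, of "\<lambda>\<mu>. lookup \<mu> k"] by (simp add: lookup_add)
    have "real (lookup a i1) + real (lookup b i1) + real (lookup c i1) = real \<alpha>"
      "real (lookup a i2) + real (lookup b i2) + real (lookup c i2) = real \<alpha>2"
      using lk[of i1] lk[of i2] unfolding M by linarith+
    then show "?p a + ?p b + ?p c = 1" "?q a + ?q b + ?q c = 1" using ge
      by (simp_all flip: add_divide_distrib)
    show "lookup a j + lookup b j + lookup c j = 1 + \<beta>2"
      using lk[of j] unfolding M .
  qed
  have int01: "?p a = 0 \<or> ?p a = 1" "?q a = 0 \<or> ?q a = 1"
    if \<alpha>2: "\<alpha>2 = 1" and w: "weight w a = 0" and aM: "a + b = ?M" for a b
  proof -
    have s: "?p a + ?p b + ?p 0 = 1" "?q a + ?q b + ?q 0 = 1" using split[of a b 0] aM by simp_all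
    have q: "?q a = real (lookup a i2)" using \<alpha>2 by simp
    have "?q a \<le> 1" using s(2) bounds(2)[of b] bounds(2)[of 0] by linarith
    then have "real (lookup a i2) \<le> 1" unfolding q .
    then have "lookup a i2 = 0 \<or> lookup a i2 = 1" by linarith
    then show "?q a = 0 \<or> ?q a = 1" unfolding q by auto
    have "?p a = real_of_int (int (lookup a j) - int \<beta>2 * int (lookup a i2))"
      using rel[OF w aM] unfolding q by simp
    then obtain z :: int where z: "?p a = of_int z" by blast
    have "?p a \<le> 1" "0 \<le> ?p a" using s(1) bounds(1)[of a] bounds(1)[of b] bounds(1)[of 0] by linarith+
    then have "0 \<le> z" "z \<le> 1" unfolding z by simp_all
    then have "z = 0 \<or> z = 1" by linarith
    then show "?p a = 0 \<or> ?p a = 1" unfolding z by auto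
  qed
  have e: "expo (\<lambda>i. if i = i1 then 1 / of_nat \<alpha> else 0) a = of_real (?p a)"
    "expo (\<lambda>i. if i = i2 then 1 / of_nat \<alpha>2 else 0) a = of_real (?q a)" for a
    by (simp_all add: expo_delta)
  show "quadratic_obstruction w ?M (\<lambda>i. if i = i1 then 1 / of_nat \<alpha> else 0) (\<lambda>i. if i = i2 then 1 / of_nat \<alpha>2 else 0)"
  proof (unfold_locales, unfold e)
    show "keys ?M \<subseteq> {..<length w}"
    proof
      fix k assume "k \<in> keys ?M"
      then show "k \<in> {..<length w}" using idx by (auto simp: in_keys_iff lookup_add lookup_single when_def split: if_splits)
    qed
  next
    fix a b assume w: "weight w a = 0" and aM: "a + b = ?M"
    have s: "?p a + ?p b = 1" "?q a + ?q b = 1" "lookup a j + lookup b j = 1 + \<beta>2"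
      using split[of a b 0] aM by simp_all
    have "?p a * (?p a - 1) = ?q a * (?q a - 1)"
    proof (cases "\<beta>2 = 1")
      case True
      then have r: "?p a + ?q a = real (lookup a j)" using rel[OF w aM] by simp
      have "lookup a j \<le> 2" using s(3) True by simp
      then consider "lookup a j = 0" | "lookup a j = 1" | "lookup a j = 2" by linarith
      then show ?thesis
      proof cases
        case 1
        then have 0: "?p a = 0" "?q a = 0" using r bounds[of a] by linarith+
        show ?thesis unfolding 0 by simp
      next
        case 2
        then have 1: "?q a = 1 - ?p a" using r by simp
        show ?thesis unfolding 1 by (simp add: algebra_simps)
      next
        case 3
        then have 1: "?p a = 1" "?q a = 1" using r s bounds[of b] by linarith+
        show ?thesis unfolding 1 by simp
      qed
    next
      case False
      then show ?thesis using one int01[OF _ w aM] by auto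
    qed
    then show "(of_real (?p a) gchoose 2 :: complex) = (of_real (?q a) gchoose 2)"
      by (simp only: gchoose_2_eq)
  next
    fix a b c assume w: "weight w a = 0" "weight w b = 0" and abc: "a + b + c = ?M"
    note s = split[OF abc]
    have aM: "a + (b + c) = ?M" "b + (a + c) = ?M" using abc by (simp_all add: algebra_simps)
    have "?p a * ?p b = ?q a * ?q b"
    proof (cases "\<beta>2 = 1")
      case True
      have r: "?p a + ?q a = real (lookup a j)" "?p b + ?q b = real (lookup b j)"
        using rel[OF w(1) aM(1)] rel[OF w(2) aM(2)] True by simp_all
      have le: "lookup a j + lookup b j \<le> 2" using s(3) True by simp
      consider "lookup a j = 0" | "lookup b j = 0"
        | "lookup a j = 1" "lookup b j = 1" using le by linarith
      then show ?thesis
      proof cases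
        case 1
        then have 0: "?p a = 0" "?q a = 0" using r bounds[of a] by linarith+
        show ?thesis unfolding 0 by simp
      next
        case 2
        then have 0: "?p b = 0" "?q b = 0" using r bounds[of b] by linarith+
        show ?thesis unfolding 0 by simp
      next
        case 3
        then have 1: "?q a = 1 - ?p a" "?q b = 1 - ?p b" using r by simp_all
        \<comment> \<open>The sums \<open>?p a + ?p b\<close> and \<open>?q a + ?q b\<close> are at
          most 1 and add up to 2, so both equal 1.\<close>
        have 2: "?p b = 1 - ?p a" using s(1,2) bounds[of c] 1 by linarith
        show ?thesis unfolding 1 2 by (simp add: algebra_simps)
      qed
    next
      case False
      then have "\<alpha>2 = 1" using one by simp
      note i = int01[OF this w(1) aM(1)] int01[OF this w(2) aM(2)]
      have "?p a = 0 \<or> ?p b = 0" "?q a = 0 \<or> ?q b = 0"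
        using i s(1,2) bounds[of c] by linarith+
      then show ?thesis by auto
    qed
    then show "(of_real (?p a) :: complex) * of_real (?p b) = of_real (?q a) * of_real (?q b)"
      by (simp only: of_real_mult[symmetric])
  qed
  show "int \<alpha> * w ! i1 + int 1 * w ! j = 0" using u by simp
  show "int \<alpha> * w ! i1 + int \<alpha>2 * w ! i2 + int (1 + \<beta>2) * w ! j = 0" using u v by (simp add: algebra_simps)
qed (use idx ge in auto)

section \<open>Dimension and rank\<close>

text \<open>The coefficient of t after adding t to the variable v. The Leibniz rule then comes from
  the multiplicativity of \<open>psubst\<close>.\<close>

definition pd :: "'v \<Rightarrow> 'v cpoly \<Rightarrow> 'v cpoly" where
  "pd v f = fps_nth (psubst (\<lambda>c. fps_const (pconst c))
     (\<lambda>u. fps_const (pvar u) + (if u = v then fps_X else 0)) f) 1"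

lemma pd_simps:
  "pd v (f + g) = pd v f + pd v g" "pd v (f * g) = pd v f * g + f * pd v g"
  "pd v (pconst c) = 0" "pd v (pvar u) = (if u = v then 1 else 0)"
proof -
  have 0: "fps_nth (psubst (\<lambda>c. fps_const (pconst c)) (\<lambda>u. fps_const (pvar u) + (if u = v then fps_X else 0)) f) 0 = f" for f
    by (induction f rule: cpoly_induct) (simp_all add: psubst_hom_simps[OF fps_pconst_hom])
  show "pd v (f + g) = pd v f + pd v g" "pd v (f * g) = pd v f * g + f * pd v g"
    "pd v (pconst c) = 0" "pd v (pvar u) = (if u = v then 1 else 0)"
    unfolding pd_def by (simp_all add: psubst_hom_simps[OF fps_pconst_hom] fps_mult_nth_1 0 algebra_simps del: One_nat_def)
qed

lemma pd_zero [simp]: "pd v 0 = 0" and pd_one [simp]: "pd v 1 = 0"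
  using pd_simps(3)[of v 0] pd_simps(3)[of v 1] by (simp_all add: pconst_simps)

lemma pd_sum: "pd v (sum F A) = (\<Sum>x\<in>A. pd v (F x))"
  by (induction A rule: infinite_finite_induct) (simp_all add: pd_simps)

lemma pd_chain:
  assumes "f \<in> carrier (poly_ring W)" "finite W"
  shows "pd v (psubst pconst h f) = (\<Sum>l\<in>W. psubst pconst h (pd l f) * pd v (h l))"
  using assms(1)
proof (induction rule: poly_ring_induct)
  case (var i)
  then have "(\<Sum>l\<in>W. psubst pconst h (pd l (pvar i)) * pd v (h l)) = (\<Sum>l\<in>W. if l = i then pd v (h l) else 0)"
    by (intro sum.cong) (auto simp: pd_simps psubst_hom_simps[OF pconst_hom])
  then show ?case using var assms(2) by (simp add: psubst_hom_simps[OF pconst_hom])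
next
  case (mult f g)
  then show ?case
    by (simp add: psubst_hom_simps[OF pconst_hom] pd_simps algebra_simps sum.distrib sum_distrib_left)
qed (simp_all add: psubst_hom_simps[OF pconst_hom] pd_simps algebra_simps sum.distrib)

lemma has_field_derivative_peval:
  "((\<lambda>a. peval (v(i := a)) f) has_field_derivative peval (v(i := a)) (pd i f)) (at a)"
proof (induction f rule: cpoly_induct)
  case (var u)
  then show ?case by (cases "u = i") (simp_all add: psubst_hom_simps[OF id_hom] pd_simps)
next
  case (mult f g)
  then show ?case
    by (auto simp: psubst_hom_simps[OF id_hom] pd_simps mult.commute intro!: derivative_eq_intros)
qed (auto simp: psubst_hom_simps[OF id_hom] pd_simps intro!: derivative_eq_intros)

lemma jacobian_index:
  assumes "j < length ps" "i < length w"
  shows "jacobian w ps v $$ (j, i) = peval (\<lambda>l. v $ l) (pd i (ps ! j))"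
proof -
  have "(\<lambda>l. v $ l)(i := v $ i) = (\<lambda>l. v $ l)" by auto
  then show ?thesis
    using DERIV_imp_deriv[OF has_field_derivative_peval[of "\<lambda>l. v $ l" i "ps ! j" "v $ i"]] assms
    by (simp add: jacobian_def)
qed

text \<open>The vector y makes the columns dependent, while a relation between the columns other
  than \<open>i0\<close> is a kernel vector with coordinate \<open>i0\<close> zero.\<close>

lemma rank_one_dim_kernel:
  fixes A :: "complex mat"
  assumes A: "A \<in> carrier_mat N n" and i0: "i0 < n"
    and y: "y \<in> carrier_vec n" "y \<noteq> 0\<^sub>v n" "A *\<^sub>v y = 0\<^sub>v N"
    and ker: "\<And>x. x \<in> carrier_vec n \<Longrightarrow> x $ i0 = 0 \<Longrightarrow> A *\<^sub>v x = 0\<^sub>v N \<Longrightarrow> x = 0\<^sub>v n"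
  shows "vec_space.rank N A = n - 1"
proof -
  interpret vec_space "TYPE(complex)" N .
  have "rank A < n"
  proof (rule ccontr)
    assume "\<not> rank A < n"
    then have r: "rank A = n" using rank_le_nc[OF A] by simp
    \<comment> \<open>Independence refers to the set of columns. Full rank gives an independent set
      of n of them, so no column is repeated and y really yields a dependence.\<close>
    obtain S where S: "maximal S (\<lambda>T. T \<subseteq> set (cols A) \<and> lin_indpt T)"
      using maximal_exists_superset[of "set (cols A)" "\<lambda>T. T \<subseteq> set (cols A) \<and> lin_indpt T" "{}"]
      by (auto simp: lin_dep_def)
    have "card S \<le> card (set (cols A))" using S by (intro card_mono) (auto simp: maximal_def)
    then have "n \<le> card (set (cols A))" using rank_card_indpt[OF A S] r by simp
    then have "distinct (cols A)" using A card_length[of "cols A"] by (intro card_distinct) auto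
    then show False
      using full_rank_lin_indpt[OF A r] lin_depI[OF A y] by blast
  qed
  moreover have "n - 1 \<le> rank A"
  proof -
    define I where "I = {..<n} - {i0}"
    define S where "S = col A ` I"
    have mult: "(A *\<^sub>v x) $ k = (\<Sum>i<n. A $$ (k, i) * x $ i)" if "x \<in> carrier_vec n" "k < N" for x k
      using that A by (simp add: scalar_prod_def atLeast0LessThan)
    have ker': "\<forall>i\<in>I. f i = 0" if f: "\<And>k. k < N \<Longrightarrow> (\<Sum>i\<in>I. A $$ (k, i) * f i) = 0" for f
    proof -
      define x where "x = vec n (\<lambda>i. if i = i0 then 0 else f i)"
      have "A *\<^sub>v x = 0\<^sub>v N"
      proof (rule eq_vecI)
        fix k assume "k < dim_vec (0\<^sub>v N :: complex vec)"
        then have k: "k < N" by simp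
        have "(A *\<^sub>v x) $ k = (\<Sum>i<n. A $$ (k, i) * x $ i)" by (rule mult) (simp_all add: x_def k)
        also have "\<dots> = (\<Sum>i\<in>I. A $$ (k, i) * f i)"
          unfolding I_def by (rule sum.mono_neutral_cong_right) (auto simp: x_def)
        finally show "(A *\<^sub>v x) $ k = 0\<^sub>v N $ k" using f[OF k] k by simp
      qed (use A in auto)
      then have x0: "x = 0\<^sub>v n" using i0 by (intro ker) (simp_all add: x_def)
      show ?thesis
      proof
        fix i assume "i \<in> I"
        then show "f i = 0" using arg_cong[OF x0, of "\<lambda>x. x $ i"] by (simp add: x_def I_def)
      qed
    qed
    have cN: "col A i $ k = A $$ (k, i)" if "i \<in> I" "k < N" for i k
      using that A by (simp add: I_def)
    have inj: "inj_on (col A) I"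
    proof (rule inj_onI, rule ccontr)
      fix i i' assume ii: "i \<in> I" "i' \<in> I" "col A i = col A i'" "i \<noteq> i'"
      define f :: "nat \<Rightarrow> complex" where "f l = (if l = i then 1 else if l = i' then -1 else 0)" for l
      have "\<forall>l\<in>I. f l = 0"
      proof (rule ker')
        fix k assume k: "k < N"
        have "(\<Sum>l\<in>I. A $$ (k, l) * f l) = (\<Sum>l\<in>I. (if l = i then A $$ (k, l) else 0) - (if l = i' then A $$ (k, l) else 0))"
          using ii(4) by (intro sum.cong) (auto simp: f_def)
        also have "\<dots> = A $$ (k, i) - A $$ (k, i')" using ii(1,2) by (simp add: sum_subtractf I_def)
        also have "\<dots> = 0" using cN[OF ii(1) k] cN[OF ii(2) k] ii(3) by simp
        finally show "(\<Sum>l\<in>I. A $$ (k, l) * f l) = 0" .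
      qed
      then show False using ii(1) by (auto simp: f_def)
    qed
    have S: "finite S" "S \<subseteq> carrier_vec N" "S \<subseteq> set (cols A)"
      using A by (auto simp: S_def I_def cols_def)
    have "lin_indpt S"
    proof
      assume "lin_dep S"
      then obtain a c where a: "lincomb a S = 0\<^sub>v N" "c \<in> S" "a c \<noteq> 0"
        using finite_lin_dep[OF S(1)] S(2) by blast
      have "\<forall>i\<in>I. a (col A i) = 0"
      proof (rule ker')
        fix k assume k: "k < N"
        have "(\<Sum>i\<in>I. A $$ (k, i) * a (col A i)) = (\<Sum>x\<in>S. a x * x $ k)"
          unfolding S_def using inj by (simp add: sum.reindex cN k mult.commute)
        also have "\<dots> = lincomb a S $ k" using lincomb_index[OF k S(2)] by simp
        finally show "(\<Sum>i\<in>I. A $$ (k, i) * a (col A i)) = 0" using a(1) k by simp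
      qed
      then show False using a by (auto simp: S_def)
    qed
    moreover have "card S = n - 1" using i0 card_image[OF inj] by (simp add: S_def I_def)
    ultimately show ?thesis using rank_ge_card_indpt[OF A S(3)] by simp
  qed
  ultimately show ?thesis by simp
qed

section \<open>Prime ideals and algebraic independence of invariants\<close>

lemma kernel_primeideal:
  fixes h :: "nat cpoly \<Rightarrow> 'a::idom"
  assumes "comm_ring_hom h"
  shows "primeideal {f \<in> carrier (inv_ring w). h f = 0} (inv_ring w)"
proof -
  interpret h: comm_ring_hom h by fact
  interpret R: cring "inv_ring w" by (rule inv_ring_cring)
  let ?P = "{f \<in> carrier (inv_ring w). h f = 0}"
  have ops: "f \<oplus>\<^bsub>inv_ring w\<^esub> g = f + g" "f \<otimes>\<^bsub>inv_ring w\<^esub> g = f * g" "\<zero>\<^bsub>inv_ring w\<^esub> = 0" "\<one>\<^bsub>inv_ring w\<^esub> = 1" for f g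
    by (simp_all add: inv_ring_def)
  have "ideal ?P (inv_ring w)"
  proof (rule idealI)
    show "ring (inv_ring w)" by (rule R.ring_axioms)
    show "subgroup ?P (add_monoid (inv_ring w))"
    proof (rule R.add.subgroupI)
      show "?P \<noteq> {}" using R.zero_closed by (auto simp: ops h.hom_zero)
      fix a assume a: "a \<in> ?P"
      then have "\<ominus>\<^bsub>inv_ring w\<^esub> a \<in> carrier (inv_ring w)" by simp
      moreover have "a + \<ominus>\<^bsub>inv_ring w\<^esub> a = 0" using a R.r_neg[of a] by (simp add: ops)
      then have "h a + h (\<ominus>\<^bsub>inv_ring w\<^esub> a) = 0" by (metis h.hom_add h.hom_zero)
      ultimately show "\<ominus>\<^bsub>inv_ring w\<^esub> a \<in> ?P" using a by simp
    next
      fix a b assume "a \<in> ?P" "b \<in> ?P"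
      then show "a \<oplus>\<^bsub>inv_ring w\<^esub> b \<in> ?P" using R.a_closed[of a b] by (simp add: ops h.hom_add)
    qed auto
    fix a x assume "a \<in> ?P" "x \<in> carrier (inv_ring w)"
    then show "x \<otimes>\<^bsub>inv_ring w\<^esub> a \<in> ?P" "a \<otimes>\<^bsub>inv_ring w\<^esub> x \<in> ?P"
      using R.m_closed[of x a] R.m_closed[of a x] by (simp_all add: ops h.hom_mult)
  qed
  then show ?thesis
  proof (rule primeidealI[OF _ inv_ring_cring(1)])
    have "1 \<in> carrier (inv_ring w)" "1 \<notin> ?P" using R.one_closed by (simp_all add: ops h.hom_one)
    then show "carrier (inv_ring w) \<noteq> ?P" by blast
  qed (auto simp: ops h.hom_mult)
qed

fun pow_prod :: "nat cpoly list \<Rightarrow> nat list \<Rightarrow> nat cpoly" where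
  "pow_prod (f # fs) (k # as) = f ^ k * pow_prod fs as"
| "pow_prod _ _ = 1"

definition exp_box :: "nat \<Rightarrow> nat \<Rightarrow> nat list set" where
  "exp_box L N = {as. set as \<subseteq> {..N} \<and> length as = L}"

lemma exp_box_Suc_sum: "(\<Sum>as\<in>exp_box (Suc L) N. F as) = (\<Sum>k\<le>N. \<Sum>as\<in>exp_box L N. F (k # as))"
proof -
  have "exp_box (Suc L) N = (\<lambda>(k, as). k # as) ` ({..N} \<times> exp_box L N)"
    by (auto simp: exp_box_def length_Suc_conv)
  then have "(\<Sum>as\<in>exp_box (Suc L) N. F as) = (\<Sum>x\<in>{..N} \<times> exp_box L N. F (case x of (k, as) \<Rightarrow> k # as))"
    by (simp add: sum.reindex inj_on_def case_prod_unfold prod_eq_iff)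
  then show ?thesis by (simp add: sum.cartesian_product case_prod_unfold)
qed

text \<open>Elements \<open>f\<^sub>i \<in> P\<^sub>i\<^sub>+\<^sub>1 \ P\<^sub>i\<close> along a chain of primes are algebraically independent modulo \<open>P\<^sub>0\<close>:
  strip the largest power of \<open>f\<^sub>0\<close> off a relation, then reduce modulo \<open>P\<^sub>1\<close>.\<close>

lemma chain_independent:
  assumes "\<And>i. i \<le> length fs \<Longrightarrow> primeideal (P i) (inv_ring w)"
    and "\<And>i. i < length fs \<Longrightarrow> P i \<subseteq> P (Suc i)"
    and "\<And>i. i < length fs \<Longrightarrow> fs ! i \<in> P (Suc i) - P i"
    and "(\<Sum>as\<in>exp_box (length fs) N. pconst (c as) * pow_prod fs as) \<in> P 0"
    and "as \<in> exp_box (length fs) N"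
  shows "c as = 0"
  using assms
proof (induction fs arbitrary: P c as)
  case Nil
  interpret P: primeideal "P 0" "inv_ring w" using Nil by simp
  interpret R: cring "inv_ring w" by (rule inv_ring_cring)
  have box: "exp_box 0 N = {[]}" by (auto simp: exp_box_def)
  then have as: "as = []" and P: "pconst (c []) \<in> P 0" using Nil by simp_all
  show ?case
  proof (rule ccontr)
    assume "c as \<noteq> 0"
    then have "pconst (1 / c []) * pconst (c []) = (1 :: nat cpoly)"
      using as by (simp flip: pconst_simps)
    then have "\<one>\<^bsub>inv_ring w\<^esub> \<in> P 0"
      using P.I_l_closed[OF P inv_ring_cring(2)[of "1 / c []" w]] by (simp add: inv_ring_def)
    then show False using P.one_imp_carrier P.I_notcarr by simp
  qed
next
  case (Cons f fs)
  interpret R: cring "inv_ring w" by (rule inv_ring_cring)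
  interpret P: primeideal "P 0" "inv_ring w" using Cons.prems(1)[of 0] by simp
  interpret P1: primeideal "P 1" "inv_ring w" using Cons.prems(1)[of 1] by simp
  let ?C = "carrier (inv_ring w)"
  have ops: "f \<oplus>\<^bsub>inv_ring w\<^esub> g = f + g" "f \<otimes>\<^bsub>inv_ring w\<^esub> g = f * g" "\<zero>\<^bsub>inv_ring w\<^esub> = 0" "\<one>\<^bsub>inv_ring w\<^esub> = 1" for f g
    by (simp_all add: inv_ring_def)
  have cl: "f + g \<in> ?C" "f * g \<in> ?C" if "f \<in> ?C" "g \<in> ?C" for f g
    using R.a_closed[OF that] R.m_closed[OF that] by (simp_all add: ops)
  have cl0: "0 \<in> ?C" "1 \<in> ?C" using R.zero_closed R.one_closed by (simp_all add: ops)
  have clp: "f ^ k \<in> ?C" if "f \<in> ?C" for f k by (induction k) (auto simp: cl0 cl that)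
  have cls: "sum F A \<in> ?C" if "\<And>x. x \<in> A \<Longrightarrow> F x \<in> ?C" for F and A :: "'z set"
    using that by (induction A rule: infinite_finite_induct) (auto simp: cl0 cl)
  have f: "f \<in> P 1" "f \<notin> P 0" "f \<in> ?C" using Cons.prems(3)[of 0] P1.a_subset by auto
  have fs: "x \<in> ?C" if x: "x \<in> set fs" for x
  proof -
    obtain i where i: "i < length fs" "x = fs ! i" using x by (metis in_set_conv_nth)
    interpret Pi: primeideal "P (Suc (Suc i))" "inv_ring w" using Cons.prems(1)[of "Suc (Suc i)"] i by simp
    have "x \<in> P (Suc (Suc i))" using Cons.prems(3)[of "Suc i"] i by simp
    then show ?thesis using Pi.a_subset by blast
  qed
  have pp: "pow_prod gs as \<in> ?C" if "\<And>x. x \<in> set gs \<Longrightarrow> x \<in> ?C" for gs as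
    using that by (induction gs as rule: pow_prod.induct) (auto simp: cl0 cl clp)
  define g where "g k = (\<Sum>as\<in>exp_box (length fs) N. pconst (c (k # as)) * pow_prod fs as)" for k
  have gC: "g k \<in> ?C" for k unfolding g_def by (intro cls cl pp fs inv_ring_cring)
  show ?case
  proof (rule ccontr)
    assume "c as \<noteq> 0"
    define Q where "Q k \<longleftrightarrow> (\<exists>as\<in>exp_box (length fs) N. c (k # as) \<noteq> 0)" for k
    obtain k0 as0 where k0: "as = k0 # as0" "k0 \<le> N" "as0 \<in> exp_box (length fs) N"
      using Cons.prems(5) by (cases as) (auto simp: exp_box_def)
    then have "Q k0" using \<open>c as \<noteq> 0\<close> by (auto simp: Q_def)
    define k where "k = (LEAST k. Q k)"
    have k: "Q k" "k \<le> N" using LeastI[of Q, OF \<open>Q k0\<close>] Least_le[of Q, OF \<open>Q k0\<close>] k0(2) by (simp_all add: k_def)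
    have g0: "g i = 0" if "i < k" for i
      using not_less_Least[of i Q] that by (auto simp: g_def k_def Q_def pconst_simps)
    define h where "h = (\<Sum>i\<in>{k<..N}. f ^ (i - k - 1) * g i)"
    have hC: "h \<in> ?C" unfolding h_def by (intro cls cl clp gC f)
    have "(\<Sum>as\<in>exp_box (length (f # fs)) N. pconst (c as) * pow_prod (f # fs) as) = (\<Sum>i\<le>N. f ^ i * g i)"
      by (simp add: exp_box_Suc_sum g_def sum_distrib_left algebra_simps)
    also have "\<dots> = (\<Sum>i\<in>{k..N}. f ^ i * g i)"
      by (rule sum.mono_neutral_right) (auto simp: g0)
    also have "{k..N} = insert k {k<..N}" using k(2) by auto
    also have "(\<Sum>i\<in>insert k {k<..N}. f ^ i * g i) = f ^ k * g k + (\<Sum>i\<in>{k<..N}. f ^ i * g i)" by simp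
    also have "(\<Sum>i\<in>{k<..N}. f ^ i * g i) = (\<Sum>i\<in>{k<..N}. f ^ k * f * (f ^ (i - k - 1) * g i))"
    proof (rule sum.cong)
      fix i assume "i \<in> {k<..N}"
      then have "i = k + 1 + (i - k - 1)" by simp
      then have "f ^ i = f ^ k * f * f ^ (i - k - 1)" by (metis power_add power_one_right)
      then show "f ^ i * g i = f ^ k * f * (f ^ (i - k - 1) * g i)" by (simp add: mult.assoc)
    qed simp
    also have "f ^ k * g k + \<dots> = f ^ k * (g k + f * h)"
      by (simp add: h_def algebra_simps sum_distrib_left)
    finally have in0: "f ^ k * (g k + f * h) \<in> P 0" using Cons.prems(4) by simp
    have "f ^ i \<notin> P 0" for i
    proof (induction i)
      case 0
      then show ?case using P.one_imp_carrier P.I_notcarr by (auto simp: ops)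
    next
      case (Suc i)
      then show ?case using P.I_prime[of f "f ^ i"] f clp[OF f(3)] by (auto simp: ops)
    qed
    then have "g k + f * h \<in> P 0"
      using P.I_prime[of "f ^ k" "g k + f * h"] in0 f gC hC by (auto simp: ops cl clp)
    then have 1: "g k + f * h \<in> P 1" using Cons.prems(2)[of 0] by auto
    have "f * h \<in> P 1" using P1.I_r_closed[OF f(1) hC] by (simp add: ops)
    then have "pconst (-1) * (f * h) \<in> P 1" using P1.I_l_closed[of "f * h" "pconst (-1)"] inv_ring_cring(2) by (simp add: ops)
    from P1.a_closed[OF 1 this] have "g k \<in> P 1" by (simp add: ops pconst_simps)
    have "c (k # as) = 0" if "as \<in> exp_box (length fs) N" for as
    proof (rule Cons.IH[of "\<lambda>i. P (Suc i)" "\<lambda>as. c (k # as)"])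
      fix i assume i: "i < length fs"
      show "P (Suc i) \<subseteq> P (Suc (Suc i))" using Cons.prems(2)[of "Suc i"] i by simp
      show "fs ! i \<in> P (Suc (Suc i)) - P (Suc i)" using Cons.prems(3)[of "Suc i"] i by simp
    qed (use that Cons.prems(1) \<open>g k \<in> P 1\<close> in \<open>simp_all add: g_def\<close>)
    then show False using k(1) by (auto simp: Q_def)
  qed
qed

text \<open>The degree is bounded in each variable separately, which turns the count of monomials
  below into a count of points in a box.\<close>

definition deg_le :: "nat \<Rightarrow> 'v cpoly \<Rightarrow> bool" where
  "deg_le d f \<longleftrightarrow> (\<forall>\<mu>\<in>keys f. \<forall>i. lookup \<mu> i \<le> d)"

lemma deg_le_mult: "deg_le a f \<Longrightarrow> deg_le b g \<Longrightarrow> deg_le (a + b) (f * g)"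
  unfolding deg_le_def
proof
  fix \<mu> assume a: "\<forall>\<mu>\<in>keys f. \<forall>i. lookup \<mu> i \<le> a" "\<forall>\<mu>\<in>keys g. \<forall>i. lookup \<mu> i \<le> b"
    and "\<mu> \<in> keys (f * g)"
  then obtain \<alpha> \<beta> where "\<mu> = \<alpha> + \<beta>" "\<alpha> \<in> keys f" "\<beta> \<in> keys g"
    using keys_mult[of f g] by blast
  then show "\<forall>i. lookup \<mu> i \<le> a + b" using a by (auto simp: lookup_add intro: add_mono)
qed

lemma deg_le_1: "deg_le 0 1" by (simp add: deg_le_def)

lemma deg_le_power: "deg_le d f \<Longrightarrow> deg_le (k * d) (f ^ k)"
  by (induction k) (auto simp: deg_le_1 intro: deg_le_mult)

lemma deg_le_mono: "deg_le a f \<Longrightarrow> a \<le> b \<Longrightarrow> deg_le b f"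
  by (auto simp: deg_le_def intro: order_trans)

lemma deg_le_ex: "\<exists>d. deg_le d f"
proof -
  let ?S = "(\<Union>\<mu>\<in>keys f. lookup \<mu> ` keys \<mu>)"
  have "lookup \<mu> i \<le> Max (insert 0 ?S)" if "\<mu> \<in> keys f" for \<mu> i
  proof (cases "i \<in> keys \<mu>")
    case True
    then show ?thesis using that by (intro Max_ge) auto
  qed (simp add: in_keys_iff)
  then show ?thesis by (auto simp: deg_le_def)
qed

lemma deg_le_pow_prod:
  assumes "\<forall>f\<in>set fs. deg_le d f" "set as \<subseteq> {..N}"
  shows "deg_le (length fs * (N * d)) (pow_prod fs as)"
  using assms
proof (induction fs as rule: pow_prod.induct)
  case (1 f fs k as)
  then have "deg_le (N * d) (f ^ k)" by (auto intro: deg_le_mono[OF deg_le_power])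
  then show ?case using 1 deg_le_mult[of "N * d" "f ^ k" "length fs * (N * d)"] by auto
qed (auto intro: deg_le_mono[OF deg_le_1])

lemma pvar_neq_0: "pvar v \<noteq> 0"
proof
  assume "pvar v = 0"
  from arg_cong[OF this, of "peval (\<lambda>_. 1)"] show False
    by (simp add: psubst_pvar[OF id_hom] psubst_zero[OF id_hom])
qed

lemma cpoly_vector_space: "vector_space (\<lambda>c f. pconst c * f :: 'v cpoly)"
  by unfold_locales (simp_all add: pconst_simps algebra_simps)

lemma exp_box_card: "card (exp_box L N) = (N + 1) ^ L" "finite (exp_box L N)"
  unfolding exp_box_def using card_lists_length_eq[of "{..N}" L] finite_lists_length_eq[of "{..N}" L] by simp_all

section \<open>Krull dimension of the invariants and points of maximal rank\<close>

context unit_weight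
begin

definition inv_monomials :: "nat \<Rightarrow> (nat \<Rightarrow>\<^sub>0 nat) set" where
  "inv_monomials B = {\<mu>. keys \<mu> \<subseteq> {..<length w} \<and> weight w \<mu> = 0 \<and> (\<forall>i. lookup \<mu> i \<le> B)}"

text \<open>The exponent of the variable \<open>i0\<close> in an invariant monomial is determined by the other ones.\<close>

lemma card_inv_monomials: "finite (inv_monomials B) \<and> card (inv_monomials B) \<le> (B + 1) ^ (length w - 1)"
proof -
  let ?I = "{..<length w} - {i0}"
  let ?F = "\<lambda>\<mu>. restrict (lookup \<mu>) ?I"
  have inj: "inj_on ?F (inv_monomials B)"
  proof (rule inj_onI)
    fix \<mu> \<nu> assume \<mu>: "\<mu> \<in> inv_monomials B" and \<nu>: "\<nu> \<in> inv_monomials B" and eq: "?F \<mu> = ?F \<nu>"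
    have e: "lookup \<mu> i = lookup \<nu> i" if "i \<in> ?I" for i
      using fun_cong[OF eq, of i] that by (simp only: restrict_apply if_True)
    have s: "int (lookup \<xi> i0) * w ! i0 = - (\<Sum>i\<in>?I. int (lookup \<xi> i) * w ! i)"
      if "\<xi> \<in> inv_monomials B" for \<xi>
    proof -
      have "weight w \<xi> = (\<Sum>i<length w. int (lookup \<xi> i) * w ! i)"
        using that by (intro weight_superset) (auto simp: inv_monomials_def)
      also have "\<dots> = int (lookup \<xi> i0) * w ! i0 + (\<Sum>i\<in>?I. int (lookup \<xi> i) * w ! i)"
        using i0 by (intro sum.remove) auto
      finally show ?thesis using that by (simp add: inv_monomials_def)
    qed
    have "(\<Sum>i\<in>?I. int (lookup \<mu> i) * w ! i) = (\<Sum>i\<in>?I. int (lookup \<nu> i) * w ! i)"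
      using e by (intro sum.cong) auto
    then have "int (lookup \<mu> i0) * w ! i0 = int (lookup \<nu> i0) * w ! i0"
      using s[OF \<mu>] s[OF \<nu>] by simp
    then have "lookup \<mu> i0 = lookup \<nu> i0" using w0 by auto
    moreover have "lookup \<mu> i = lookup \<nu> i" if "i \<notin> {..<length w}" for i
    proof -
      have "i \<notin> keys \<mu>" "i \<notin> keys \<nu>" using \<mu> \<nu> that by (auto simp: inv_monomials_def)
      then show ?thesis by (simp add: in_keys_iff)
    qed
    ultimately have "lookup \<mu> i = lookup \<nu> i" for i using e[of i] by blast
    then show "\<mu> = \<nu>" by (rule poly_mapping_eqI)
  qed
  have sub: "?F ` inv_monomials B \<subseteq> ?I \<rightarrow>\<^sub>E {..B}"
    by (rule image_subsetI) (simp only: restrict_PiE_iff, simp add: inv_monomials_def)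
  have fin: "finite (?I \<rightarrow>\<^sub>E {..B})" by (intro finite_PiE) auto
  have "card (?I \<rightarrow>\<^sub>E {..B}) = (B + 1) ^ (length w - 1)"
    using i0 by (subst card_PiE) auto
  then show ?thesis
    using card_inj_on_le[OF inj sub fin] inj_on_finite[OF inj sub fin] by simp
qed

text \<open>A longer chain would yield n = \<open>length w\<close> algebraically independent
  invariants. Their (N + 1)^n monomials with exponents up to N are independent, but lie in a space
  spanned by at most (n N d + 1)^(n - 1) invariant monomials, which is impossible for large
  N.\<close>

lemma chain_length:
  assumes P: "\<And>i. i \<le> k \<Longrightarrow> primeideal (P i) (inv_ring w)" "\<And>i. i < k \<Longrightarrow> P i \<subset> P (Suc i)"
  shows "k \<le> length w - 1"
proof (rule ccontr)
  assume "\<not> k \<le> length w - 1"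
  define n where "n = length w"
  have n: "n \<ge> 1" "n \<le> k" using \<open>\<not> k \<le> length w - 1\<close> i0 by (simp_all add: n_def)
  interpret V: vector_space "\<lambda>c f. pconst c * f :: nat cpoly" by (rule cpoly_vector_space)
  have "\<exists>f. f \<in> P (Suc i) - P i" if "i < k" for i using P(2)[OF that] by blast
  then obtain F where F: "\<And>i. i < k \<Longrightarrow> F i \<in> P (Suc i) - P i" by metis
  define fs where "fs = map F [0..<n]"
  have len: "length fs = n" by (simp add: fs_def)
  have C: "x \<in> carrier (inv_ring w)" if "x \<in> set fs" for x
  proof -
    from that obtain i where i: "i < n" "x = F i" by (auto simp: fs_def)
    interpret Pi: primeideal "P (Suc i)" "inv_ring w" using P(1)[of "Suc i"] i n by simp
    show ?thesis using F[of i] i n Pi.a_subset by auto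
  qed
  have ind: "c as = 0" if "(\<Sum>as\<in>exp_box n N. pconst (c as) * pow_prod fs as) = 0" "as \<in> exp_box n N" for c as N
  proof (rule chain_independent[of fs P w c N as])
    show "primeideal (P i) (inv_ring w)" if "i \<le> length fs" for i using that n len P(1) by simp
    show "P i \<subseteq> P (Suc i)" if "i < length fs" for i using that n len P(2)[of i] by auto
    show "fs ! i \<in> P (Suc i) - P i" if "i < length fs" for i using that n F[of i] by (simp add: fs_def)
    interpret P0: primeideal "P 0" "inv_ring w" using P(1)[of 0] by simp
    show "(\<Sum>as\<in>exp_box (length fs) N. pconst (c as) * pow_prod fs as) \<in> P 0"
      using additive_subgroup.zero_closed[OF P0.is_additive_subgroup] that(1) len by (simp add: inv_ring_def)
  qed (use that len in simp)
  have "\<exists>d. \<forall>f\<in>set fs. deg_le d f"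
  proof -
    obtain D where D: "\<And>f. deg_le (D f) (f :: nat cpoly)" using deg_le_ex by metis
    have "deg_le (sum D (set fs)) f" if "f \<in> set fs" for f
      using D that by (intro deg_le_mono[OF D] member_le_sum) auto
    then show ?thesis by blast
  qed
  then obtain d where d: "\<forall>f\<in>set fs. deg_le d f" by blast
  have bound: "(N + 1) ^ n \<le> (n * (N * d) + 1) ^ (n - 1)" for N
  proof -
    let ?T = "(\<lambda>\<mu>. single \<mu> (1::complex)) ` inv_monomials (n * (N * d))"
    have inj: "inj_on (pow_prod fs) (exp_box n N)"
    proof (rule inj_onI, rule ccontr)
      fix as bs assume ab: "as \<in> exp_box n N" "bs \<in> exp_box n N" "pow_prod fs as = pow_prod fs bs" "as \<noteq> bs"
      define c :: "nat list \<Rightarrow> complex" where "c x = (if x = as then 1 else if x = bs then -1 else 0)" for x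
      have "(\<Sum>x\<in>exp_box n N. pconst (c x) * pow_prod fs x) =
          (\<Sum>x\<in>exp_box n N. (if x = as then pow_prod fs x else 0) - (if x = bs then pow_prod fs x else 0))"
        using ab(4) by (intro sum.cong) (auto simp: c_def pconst_simps)
      also have "\<dots> = 0" using ab exp_box_card(2) by (simp add: sum_subtractf)
      finally show False using ind[of c N as] ab(1) by (simp add: c_def)
    qed
    have "V.independent (pow_prod fs ` exp_box n N)"
    proof (rule V.independent_if_scalars_zero)
      fix c x assume s: "(\<Sum>x\<in>pow_prod fs ` exp_box n N. pconst (c x) * x) = 0" and "x \<in> pow_prod fs ` exp_box n N"
      then obtain as where as: "as \<in> exp_box n N" "x = pow_prod fs as" by blast
      have "(\<Sum>as\<in>exp_box n N. pconst (c (pow_prod fs as)) * pow_prod fs as) = 0"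
        using s by (simp add: sum.reindex[OF inj])
      from ind[OF this as(1)] show "c x = 0" using as by simp
    qed (simp add: exp_box_card)
    moreover have "pow_prod fs ` exp_box n N \<subseteq> V.span ?T"
    proof (rule image_subsetI)
      fix as assume as: "as \<in> exp_box n N"
      let ?p = "pow_prod fs as"
      have "?p \<in> carrier (inv_ring w)"
      proof -
        interpret R: cring "inv_ring w" by (rule inv_ring_cring)
        have "pow_prod gs bs \<in> carrier (inv_ring w)" if "set gs \<subseteq> carrier (inv_ring w)" for gs bs
          using that
        proof (induction gs bs rule: pow_prod.induct)
          case (1 f fs k as)
          have "f ^ j \<in> carrier (inv_ring w)" for j
            using 1(2) R.m_closed[of f] R.one_closed by (induction j) (auto simp: inv_ring_def)
          then show ?case using 1 R.m_closed[of "f ^ k" "pow_prod fs as"] by (simp add: inv_ring_def)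
        qed (use R.one_closed in \<open>simp_all add: inv_ring_def\<close>)
        then show ?thesis using C by blast
      qed
      moreover have "deg_le (n * (N * d)) ?p"
        using deg_le_pow_prod[OF d, of as N] as len by (simp add: exp_box_def)
      ultimately have keys: "keys ?p \<subseteq> inv_monomials (n * (N * d))"
        by (auto simp: inv_monomials_def inv_ring_iff coord_ring_def poly_ring_carrier deg_le_def)
      have "?p = (\<Sum>\<mu>\<in>keys ?p. single \<mu> (lookup ?p \<mu>))"
        by (rule poly_mapping_sum_single)
      also have "\<dots> = (\<Sum>\<mu>\<in>keys ?p. pconst (lookup ?p \<mu>) * single \<mu> 1)"
        by (simp add: pconst_mult_single)
      also have "\<dots> \<in> V.span ?T"
        using keys by (intro V.span_sum V.span_scale V.span_base) auto
      finally show "?p \<in> V.span ?T" .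
    qed
    ultimately have "card (pow_prod fs ` exp_box n N) \<le> card ?T"
      using card_inv_monomials by (intro conjunct2[OF V.independent_span_bound]) auto
    also have "\<dots> \<le> card (inv_monomials (n * (N * d)))" using card_inv_monomials by (intro card_image_le) auto
    also have "\<dots> \<le> (n * (N * d) + 1) ^ (n - 1)" using card_inv_monomials by (simp add: n_def)
    finally show ?thesis by (simp add: card_image[OF inj] exp_box_card)
  qed
  \<comment> \<open>With these values n N d + 1 is at most K (N + 1), so the bound becomes N (N +
    1)^(n - 1), less than (N + 1)^n.\<close>
  define K where "K = n * d + 1"
  define N where "N = K ^ (n - 1)"
  have "n * (N * d) + 1 \<le> K * (N + 1)" by (simp add: K_def algebra_simps)
  then have "(n * (N * d) + 1) ^ (n - 1) \<le> (K * (N + 1)) ^ (n - 1)" by (rule power_mono) simp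
  then have "(N + 1) ^ n \<le> (K * (N + 1)) ^ (n - 1)" by (rule order_trans[OF bound])
  also have "\<dots> = N * (N + 1) ^ (n - 1)" unfolding power_mult_distrib N_def[symmetric] ..
  finally have "(N + 1) ^ n \<le> N * (N + 1) ^ (n - 1)" .
  moreover have "(N + 1) ^ n = (N + 1) * (N + 1) ^ (n - 1)" using n(1) by (cases n) auto
  ultimately show False by simp
qed

text \<open>For the lower bound, restrict to x = 1 and set the remaining variables to zero one after
  the other. The kernels form the chain, and the invariant \<open>u (js ! k)\<close> shows that step
  k is strict.\<close>

lemma krull_dim_inv_ring: "krull_dim (inv_ring w) = enat (length w - 1)"
proof (rule antisym)
  show "krull_dim (inv_ring w) \<le> enat (length w - 1)"
    unfolding krull_dim_def
  proof (rule Sup_least)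
    fix x assume "x \<in> {enat n | n. \<exists>P. (\<forall>i\<le>n. primeideal (P i) (inv_ring w)) \<and> (\<forall>i<n. P i \<subset> P (Suc i))}"
    then obtain n P where n: "x = enat n" "\<forall>i\<le>n. primeideal (P i) (inv_ring w)" "\<forall>i<n. P i \<subset> P (Suc i)" by blast
    show "x \<le> enat (length w - 1)" using chain_length[of n P] n by simp
  qed
  define js where "js = filter (\<lambda>i. i \<noteq> i0) [0..<length w]"
  have js: "distinct js" "set js = {..<length w} - {i0}" by (auto simp: js_def)
  then have len: "length js = length w - 1" using i0 distinct_card[of js] by simp
  define \<rho> where "\<rho> k i = (if i = i0 then 1 else if i \<in> set (take k js) then 0 else pvar i :: nat cpoly)" for k i
  define P where "P k = {f \<in> carrier (inv_ring w). psubst pconst (\<rho> k) f = 0}" for k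
  have "primeideal (P k) (inv_ring w)" for k
    unfolding P_def by (rule kernel_primeideal[OF psubst_comm_ring_hom[OF pconst_hom]])
  moreover have "P k \<subset> P (Suc k)" if k: "k < length w - 1" for k
  proof
    have nth: "js ! k \<in> set js" "js ! k \<noteq> i0" "js ! k < length w" using k len js nth_mem[of k js] by auto
    have notin: "js ! k \<notin> set (take k js)"
      using js(1) k len by (auto simp: in_set_conv_nth nth_eq_iff_index_eq)
    have Suc: "set (take (Suc k) js) = insert (js ! k) (set (take k js))" using k len by (simp add: take_Suc_conv_app_nth)
    have "psubst pconst (\<rho> (Suc k)) f = psubst pconst (\<lambda>i. if i = js ! k then 0 else pvar i) (psubst pconst (\<rho> k) f)" for f
    proof -
      have "(\<lambda>i. psubst pconst (\<lambda>i. if i = js ! k then 0 else pvar i) (\<rho> k i)) = \<rho> (Suc k)"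
        using nth(2) by (auto simp: fun_eq_iff \<rho>_def Suc psubst_hom_simps[OF pconst_hom])
      then show ?thesis by (simp add: psubst_psubst[OF pconst_hom])
    qed
    then show "P k \<subseteq> P (Suc k)" by (auto simp: P_def psubst_zero[OF pconst_hom])
    have s: "psubst pconst (\<rho> l) (u (js ! k)) = \<rho> l (js ! k)" for l
      using nth(2) by (simp add: u_def psubst_hom_simps[OF pconst_hom] psubst_power[OF pconst_hom] \<rho>_def)
    have "pvar (js ! k) \<noteq> (0 :: nat cpoly)" by (rule pvar_neq_0)
    then have "u (js ! k) \<in> P (Suc k) - P k"
      using u_inv[OF nth(3)] notin nth(2) by (simp add: P_def s) (simp add: \<rho>_def Suc)
    then show "P k \<noteq> P (Suc k)" by blast
  qed
  ultimately show "enat (length w - 1) \<le> krull_dim (inv_ring w)"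
    unfolding krull_dim_def by (intro Sup_upper) blast
qed

text \<open>The vector field that generates the torus action. It kills the invariants, so its value
  at a point lies in the kernel of the Jacobian.\<close>

definition euler :: "nat cpoly \<Rightarrow> nat cpoly" where
  "euler f = (\<Sum>i<length w. pconst (of_int (w ! i)) * pvar i * pd i f)"

lemma euler_mult: "euler (f * g) = euler f * g + f * euler g"
  by (simp add: euler_def pd_simps algebra_simps sum.distrib sum_distrib_left)

lemma euler_pvar: "i < length w \<Longrightarrow> euler (pvar i) = pconst (of_int (w ! i)) * pvar i"
proof -
  assume i: "i < length w"
  have "euler (pvar i) = (\<Sum>l<length w. if l = i then pconst (of_int (w ! l)) * pvar l else 0)"
    unfolding euler_def by (intro sum.cong) (auto simp: pd_simps)
  then show ?thesis using i by simp
qed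

lemma euler_u: "l < length w \<Longrightarrow> euler (u l) = 0"
proof (cases "l = i0")
  case True
  then show ?thesis by (simp add: u_def euler_def)
next
  case False
  assume l: "l < length w"
  have pow: "euler (pvar i0 ^ k) = pconst (of_int (int k * w ! i0)) * pvar i0 ^ k" for k
    by (induction k) (simp_all add: euler_mult euler_pvar i0 pconst_simps algebra_simps, simp add: euler_def)
  have "euler (u l) = pconst (of_int (int (\<kappa> l) * w ! i0) + of_int (w ! l)) * u l"
    using False l by (simp add: u_def euler_mult pow euler_pvar pconst_simps algebra_simps)
  also have "of_int (int (\<kappa> l) * w ! i0) + of_int (w ! l) = (0::complex)"
    using wi[OF l False] by simp
  finally show ?thesis by (simp add: pconst_simps)
qed

text \<open>By \<open>psubst_u\<close> an invariant is a polynomial in the \<open>u l\<close>, and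
  the chain rule reduces the claim to these.\<close>

lemma euler_inv:
  assumes f: "f \<in> carrier (inv_ring w)"
  shows "euler f = 0"
proof -
  have c: "f \<in> carrier (poly_ring {..<length w})" using f by (simp add: inv_ring_iff coord_ring_def)
  have "euler f = euler (psubst pconst u f)" using psubst_u[OF f] by simp
  also have "\<dots> = (\<Sum>l<length w. psubst pconst u (pd l f) * euler (u l))"
    unfolding euler_def pd_chain[OF c finite_lessThan]
    by (simp add: sum_distrib_left algebra_simps) (rule sum.swap)
  finally show ?thesis by (simp add: euler_u)
qed

lemma generators_lift:
  assumes "generators w ps"
  shows "\<exists>U. \<forall>i<length w. U i \<in> carrier (poly_ring {..<length ps}) \<and> psubst pconst (\<lambda>j. ps ! j) (U i) = u i"
proof -
  have "\<exists>F. F \<in> carrier (poly_ring {..<length ps}) \<and> psubst pconst (\<lambda>j. ps ! j) F = u i" if "i < length w" for i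
    using u_inv[OF that] assms unfolding generators_def by (metis (no_types, lifting) imageE)
  then show ?thesis by metis
qed

lemma generators_inv:
  assumes "generators w ps" "j < length ps"
  shows "ps ! j \<in> carrier (inv_ring w)"
proof -
  have "psubst pconst (\<lambda>j. ps ! j) (pvar j) \<in> carrier (inv_ring w)"
    using assms unfolding generators_def by (auto intro: poly_ring_closed)
  then show ?thesis by (simp add: psubst_hom_simps[OF pconst_hom])
qed

text \<open>The tangent vector y of the orbit lies in the kernel and has a nonzero coordinate
  \<open>i0\<close>. A kernel vector x is also annihilated by the differentials of the
  \<open>u i\<close>, which are polynomials in the generators; if its coordinate \<open>i0\<close>
  is zero, this reads \<open>v $ i0 ^ \<kappa> i * x $ i = 0\<close>.\<close>

lemma max_rank_pointsI:
  assumes ps: "generators w ps" and v: "v \<in> carrier_vec (length w)" "v $ i0 \<noteq> 0"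
  shows "v \<in> max_rank_points w ps"
proof -
  let ?n = "length w" and ?N = "length ps" and ?J = "jacobian w ps v" and ?v = "\<lambda>i. v $ i"
  have J: "?J \<in> carrier_mat ?N ?n" by (simp add: jacobian_def)
  have mult: "(?J *\<^sub>v x) $ j = (\<Sum>i<?n. peval ?v (pd i (ps ! j)) * x $ i)" if "x \<in> carrier_vec ?n" "j < ?N" for x j
  proof -
    have "(?J *\<^sub>v x) $ j = (\<Sum>i<?n. ?J $$ (j, i) * x $ i)"
      using that J by (simp add: scalar_prod_def atLeast0LessThan)
    also have "\<dots> = (\<Sum>i<?n. peval ?v (pd i (ps ! j)) * x $ i)"
      using that by (intro sum.cong) (simp_all add: jacobian_index)
    finally show ?thesis .
  qed
  obtain U where U: "\<And>i. i < ?n \<Longrightarrow> U i \<in> carrier (poly_ring {..<?N})"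
      "\<And>i. i < ?n \<Longrightarrow> psubst pconst (\<lambda>j. ps ! j) (U i) = u i"
    using generators_lift[OF ps] by blast
  define y where "y = vec ?n (\<lambda>i. of_int (w ! i) * v $ i)"
  have "vec_space.rank ?N ?J = ?n - 1"
  proof (rule rank_one_dim_kernel[OF J i0])
    show "y \<in> carrier_vec ?n" by (simp add: y_def)
    have "y $ i0 \<noteq> 0" using v(2) w0 i0 by (auto simp: y_def)
    then show "y \<noteq> 0\<^sub>v ?n" using i0 by auto
    show "?J *\<^sub>v y = 0\<^sub>v ?N"
    proof (rule eq_vecI)
      fix j assume "j < dim_vec (0\<^sub>v ?N :: complex vec)"
      then have j: "j < ?N" by simp
      have "(?J *\<^sub>v y) $ j = (\<Sum>i<?n. peval ?v (pd i (ps ! j)) * (of_int (w ! i) * v $ i))"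
        using mult[of y j] j by (simp add: y_def)
      also have "\<dots> = peval ?v (euler (ps ! j))"
        by (simp add: euler_def psubst_hom_simps[OF id_hom] algebra_simps)
      finally show "(?J *\<^sub>v y) $ j = 0\<^sub>v ?N $ j"
        using euler_inv[OF generators_inv[OF ps j]] j by (simp add: psubst_zero[OF id_hom])
    qed (use J in simp)
    fix x assume x: "x \<in> carrier_vec ?n" "x $ i0 = 0" "?J *\<^sub>v x = 0\<^sub>v ?N"
    have "x $ i = 0" if i: "i < ?n" for i
    proof (cases "i = i0")
      case False
      have "(\<Sum>l<?n. peval ?v (pd l (u i)) * x $ l) =
          (\<Sum>l<?n. (\<Sum>j<?N. peval ?v (psubst pconst (\<lambda>j. ps ! j) (pd j (U i))) * peval ?v (pd l (ps ! j))) * x $ l)"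
        unfolding U(2)[OF i, symmetric] pd_chain[OF U(1)[OF i] finite_lessThan]
        by (simp add: psubst_hom_simps[OF id_hom])
      also have "\<dots> = (\<Sum>j<?N. peval ?v (psubst pconst (\<lambda>j. ps ! j) (pd j (U i))) * (\<Sum>l<?n. peval ?v (pd l (ps ! j)) * x $ l))"
        by (simp add: sum_distrib_left sum_distrib_right mult.assoc) (rule sum.swap)
      also have "\<dots> = 0"
        using mult[OF x(1)] x(3) by (simp flip: mult)
      finally have s: "(\<Sum>l<?n. peval ?v (pd l (u i)) * x $ l) = 0" .
      have pow: "pd l (pvar i0 ^ k) = 0" if "l \<noteq> i0" for l k
        using that by (induction k) (simp_all add: pd_simps)
      have "(\<Sum>l<?n. peval ?v (pd l (u i)) * x $ l) = (\<Sum>l<?n. if l = i then v $ i0 ^ \<kappa> i * x $ l else 0)"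
      proof (rule sum.cong)
        fix l assume "l \<in> {..<?n}"
        show "peval ?v (pd l (u i)) * x $ l = (if l = i then v $ i0 ^ \<kappa> i * x $ l else 0)"
        proof (cases "l = i0")
          case True
          then show ?thesis using x(2) False by simp
        next
          case l: False
          then show ?thesis using False
            by (simp add: u_def pd_simps pow psubst_hom_simps[OF id_hom] psubst_power[OF id_hom])
        qed
      qed simp
      also have "\<dots> = v $ i0 ^ \<kappa> i * x $ i" using i by simp
      finally show ?thesis using s v(2) by simp
    qed (use x in simp)
    then show "x = 0\<^sub>v ?n" using x(1) by (intro eq_vecI) auto
  qed
  then show ?thesis using v(1) by (simp add: max_rank_points_def krull_dim_inv_ring)
qed

lemma quot_map_max_rank_points:
  assumes ps: "generators w ps"
  shows "quot_map ps ` max_rank_points w ps = quot_points ps"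
proof
  let ?n = "length w" and ?N = "length ps"
  show "quot_map ps ` max_rank_points w ps \<subseteq> quot_points ps"
  proof (rule image_subsetI)
    fix v assume "v \<in> max_rank_points w ps"
    have "peval (\<lambda>j. quot_map ps v $ j) F = 0" if F: "F \<in> carrier (poly_ring {..<?N})" "psubst pconst (\<lambda>j. ps ! j) F = 0" for F
    proof -
      have "peval (\<lambda>j. quot_map ps v $ j) F = peval (\<lambda>j. peval (\<lambda>i. v $ i) (ps ! j)) F"
        using F(1) by (rule psubst_cong) (simp add: quot_map_def)
      also have "\<dots> = peval (\<lambda>i. v $ i) (psubst pconst (\<lambda>j. ps ! j) F)"
        by (simp add: psubst_psubst[OF id_hom])
      finally show ?thesis using F(2) by (simp add: psubst_zero[OF id_hom])
    qed
    then show "quot_map ps v \<in> quot_points ps" by (simp add: quot_points_def) (simp add: quot_map_def)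
  qed
  show "quot_points ps \<subseteq> quot_map ps ` max_rank_points w ps"
  proof
    fix z assume z: "z \<in> quot_points ps"
    have dim: "dim_vec z = ?N" using z unfolding quot_points_def by (intro carrier_vecD) blast
    obtain U where U: "\<And>i. i < ?n \<Longrightarrow> U i \<in> carrier (poly_ring {..<?N})"
        "\<And>i. i < ?n \<Longrightarrow> psubst pconst (\<lambda>j. ps ! j) (U i) = u i"
      using generators_lift[OF ps] by blast
    \<comment> \<open>The preimage of z on the slice x = 1: its other coordinates are the values at
      z of the \<open>u i\<close>, written in the generators. The coordinate 1 at \<open>i0\<close>
      ensures maximal rank.\<close>
    define v where "v = vec ?n (\<lambda>i. peval (\<lambda>j. z $ j) (if i = i0 then 1 else U i))"
    have "v \<in> max_rank_points w ps"
      using i0 by (intro max_rank_pointsI[OF ps]) (simp_all add: v_def psubst_one[OF id_hom])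
    moreover have "quot_map ps v = z"
    proof (rule eq_vecI)
      show "dim_vec (quot_map ps v) = dim_vec z" by (simp add: dim quot_map_def)
      fix j assume "j < dim_vec z"
      then have j: "j < ?N" by (simp add: dim)
      note inv = generators_inv[OF ps j]
      then have c: "ps ! j \<in> carrier (poly_ring {..<?n})" by (simp add: inv_ring_iff coord_ring_def)
      \<comment> \<open>G is the generator \<open>ps ! j\<close> restricted to the slice and
        rewritten in the generators. So \<open>G - pvar j\<close> is a relation between them and
        vanishes at z.\<close>
      define G where "G = psubst pconst (\<lambda>i. if i = i0 then 1 else U i) (ps ! j)"
      have GC: "G \<in> carrier (poly_ring {..<?N})"
        unfolding G_def using c by (rule psubst_closed) (use U in \<open>auto intro: poly_ring_closed\<close>)
      have "psubst pconst (\<lambda>j. ps ! j) G = psubst pconst u (ps ! j)"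
        unfolding G_def psubst_psubst[OF pconst_hom] using c
        by (rule psubst_cong) (use U in \<open>auto simp: psubst_one[OF pconst_hom] u_def\<close>)
      also have "\<dots> = ps ! j" by (rule psubst_u[OF inv])
      finally have "psubst pconst (\<lambda>j. ps ! j) (G - pvar j) = 0"
        by (simp add: psubst_hom_simps[OF pconst_hom])
      moreover have "G - pvar j \<in> carrier (poly_ring {..<?N})"
        using GC j by (intro poly_ring_diff_closed) (auto intro: poly_ring_closed)
      ultimately have "peval (\<lambda>j. z $ j) (G - pvar j) = 0" using z by (auto simp: quot_points_def)
      then have "peval (\<lambda>j. z $ j) G = z $ j" by (simp add: psubst_hom_simps[OF id_hom])
      moreover have "peval (\<lambda>j. z $ j) G = peval (\<lambda>i. v $ i) (ps ! j)"
        unfolding G_def psubst_psubst[OF id_hom] using c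
        by (rule psubst_cong) (simp add: v_def)
      ultimately show "quot_map ps v $ j = z $ j" using j by (simp add: quot_map_def)
    qed
    ultimately show "z \<in> quot_map ps ` max_rank_points w ps" by blast
  qed
qed

end

section \<open>The ideal of equal elementary symmetric polynomials\<close>

text \<open>A Vandermonde argument by induction on N: replacing \<epsilon> by 2 \<epsilon> and
  subtracting the right multiple of the original sum removes the top coefficient and multiplies each
  lower one by a nonzero constant.\<close>

lemma subspace_coeffs:
  fixes a :: "nat \<Rightarrow> 'v cpoly"
  assumes add: "\<And>f g. f \<in> J \<Longrightarrow> g \<in> J \<Longrightarrow> f + g \<in> J" and scale: "\<And>c f. f \<in> J \<Longrightarrow> pconst c * f \<in> J"
    and J: "\<And>\<epsilon>. (\<Sum>k\<le>N. pconst (\<epsilon> ^ k) * a k) \<in> J" and k: "k \<le> N"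
  shows "a k \<in> J"
  using J k
proof (induction N arbitrary: a k)
  case 0
  from 0(1)[of 0] 0(2) show ?case by (simp add: pconst_simps)
next
  case (Suc N)
  have 2: "(2::complex) ^ i - 2 ^ Suc N \<noteq> 0" if "i \<le> N" for i
  proof
    assume "(2::complex) ^ i - 2 ^ Suc N = 0"
    then have "norm ((2::complex) ^ i) = norm ((2::complex) ^ Suc N)" by simp
    then have "(2::real) ^ i = 2 ^ Suc N" by (simp only: norm_power norm_numeral)
    moreover have "(2::real) ^ i < 2 ^ Suc N" using that by (intro power_strict_increasing) auto
    ultimately show False by simp
  qed
  have "(\<Sum>k\<le>N. pconst (\<epsilon> ^ k) * (pconst (2 ^ k - 2 ^ Suc N) * a k)) \<in> J" for \<epsilon>
  proof -
    have "(\<Sum>k\<le>Suc N. pconst ((2 * \<epsilon>) ^ k) * a k) + pconst (- (2 ^ Suc N)) * (\<Sum>k\<le>Suc N. pconst (\<epsilon> ^ k) * a k)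
        = (\<Sum>k\<le>Suc N. pconst (\<epsilon> ^ k) * (pconst (2 ^ k - 2 ^ Suc N) * a k))"
      unfolding sum_distrib_left sum.distrib[symmetric]
      by (intro sum.cong refl) (simp add: pconst_simps power_mult_distrib algebra_simps)
    also have "\<dots> = (\<Sum>k\<le>N. pconst (\<epsilon> ^ k) * (pconst (2 ^ k - 2 ^ Suc N) * a k))"
      by (simp add: pconst_simps)
    finally have eq: "(\<Sum>k\<le>Suc N. pconst ((2 * \<epsilon>) ^ k) * a k) + pconst (- (2 ^ Suc N)) * (\<Sum>k\<le>Suc N. pconst (\<epsilon> ^ k) * a k)
        = (\<Sum>k\<le>N. pconst (\<epsilon> ^ k) * (pconst (2 ^ k - 2 ^ Suc N) * a k))" .
    show ?thesis unfolding eq[symmetric] by (intro add scale Suc.prems(1))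
  qed
  then have "pconst (2 ^ i - 2 ^ Suc N) * a i \<in> J" if "i \<le> N" for i
    using that by (rule Suc.IH)
  then have low: "a i \<in> J" if "i \<le> N" for i
  proof -
    have "pconst (1 / (2 ^ i - 2 ^ Suc N)) * (pconst (2 ^ i - 2 ^ Suc N) * a i) \<in> J"
      using scale \<open>\<And>i. i \<le> N \<Longrightarrow> pconst (2 ^ i - 2 ^ Suc N) * a i \<in> J\<close>[OF that] by blast
    also have "pconst (1 / (2 ^ i - 2 ^ Suc N)) * (pconst (2 ^ i - 2 ^ Suc N) * a i) = pconst (1 / (2 ^ i - 2 ^ Suc N) * (2 ^ i - 2 ^ Suc N)) * a i"
      by (simp only: pconst_simps(4) mult.assoc)
    also have "\<dots> = a i" using 2[OF that] by (simp add: pconst_simps)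
    finally show ?thesis .
  qed
  show ?case
  proof (cases "k = Suc N")
    case True
    have zero: "0 \<in> J" using scale[OF Suc.prems(1)[of 0], of 0] by (simp add: pconst_simps)
    have neg: "(\<Sum>k\<le>N. pconst (-1) * a k) \<in> J"
    proof -
      have "(\<Sum>k\<in>A. pconst (-1) * a k) \<in> J" if "A \<subseteq> {..N}" for A
        using finite_subset[OF that] that
        by (induction A rule: infinite_finite_induct) (auto intro!: add scale zero low)
      then show ?thesis by blast
    qed
    have "(\<Sum>k\<le>N. a k) + a (Suc N) \<in> J" using Suc.prems(1)[of 1] by (simp add: pconst_simps)
    from add[OF this neg] show ?thesis using True by (simp add: pconst_simps sum_negf)
  qed (use Suc.prems low in auto)
qed

lemma fps_linear_nth:
  "fps_nth ((1 - fps_const c * fps_X) * B) k = fps_nth B k - (if k = 0 then 0 else c * fps_nth B (k - 1))"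
  for c :: "'a::comm_ring_1"
proof -
  have "(1 - fps_const c * fps_X) * B = B - fps_const c * (fps_X * B)"
    by (simp add: left_diff_distrib mult.assoc)
  then show ?thesis by simp
qed

lemma fps_linear_prod_degree:
  fixes a :: "'i \<Rightarrow> 'a::comm_ring_1"
  assumes "finite A" "card A < k"
  shows "fps_nth (\<Prod>i\<in>A. 1 - fps_const (a i) * fps_X) k = 0"
  using assms
proof (induction A arbitrary: k)
  case (insert x A)
  then show ?case by (auto simp: fps_linear_nth)
qed auto

text \<open>Evaluation at X = \<epsilon> of a polynomial whose coefficients are, up to sign, the
  elementary symmetric polynomials of the a i.\<close>

lemma prod_linear_expand:
  fixes a :: "'i \<Rightarrow> 'v cpoly"
  assumes "finite A" "card A \<le> N"
  shows "(\<Prod>i\<in>A. 1 - pconst \<epsilon> * a i) = (\<Sum>k\<le>N. pconst (\<epsilon> ^ k) * fps_nth (\<Prod>i\<in>A. 1 - fps_const (a i) * fps_X) k)"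
  using assms
proof (induction A arbitrary: N)
  case empty
  have "(\<Sum>k\<le>N. pconst (\<epsilon> ^ k) * fps_nth (1 :: 'v cpoly fps) k) = (\<Sum>k\<le>N. if k = 0 then 1 else 0)"
    by (intro sum.cong) (auto simp: pconst_simps)
  then show ?case by simp
next
  case (insert x A)
  then obtain M where M: "N = Suc M" "card A \<le> M" by (cases N) auto
  let ?B = "\<lambda>k. fps_nth (\<Prod>i\<in>A. 1 - fps_const (a i) * fps_X) k"
  have "(\<Sum>k\<le>N. pconst (\<epsilon> ^ k) * fps_nth (\<Prod>i\<in>insert x A. 1 - fps_const (a i) * fps_X) k)
      = (\<Sum>k\<le>N. pconst (\<epsilon> ^ k) * ?B k) - (\<Sum>k\<le>N. pconst (\<epsilon> ^ k) * (if k = 0 then 0 else a x * ?B (k - 1)))"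
    using insert.hyps by (simp add: fps_linear_nth right_diff_distrib sum_subtractf)
  also have "(\<Sum>k\<le>N. pconst (\<epsilon> ^ k) * (if k = 0 then 0 else a x * ?B (k - 1))) = pconst \<epsilon> * a x * (\<Sum>k\<le>M. pconst (\<epsilon> ^ k) * ?B k)"
    unfolding M(1) by (subst sum.atMost_Suc_shift) (simp add: pconst_simps sum_distrib_left algebra_simps)
  also have "(\<Sum>k\<le>M. pconst (\<epsilon> ^ k) * ?B k) = (\<Sum>k\<le>N. pconst (\<epsilon> ^ k) * ?B k)"
    using insert.hyps M by (simp add: fps_linear_prod_degree)
  also have "(\<Sum>k\<le>N. pconst (\<epsilon> ^ k) * ?B k) = (\<Prod>i\<in>A. 1 - pconst \<epsilon> * a i)"
    using insert.IH[of N] M by simp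
  finally show ?case using insert.hyps by (simp add: algebra_simps)
qed

section \<open>Normal forms for polynomials in S and T\<close>

abbreviation SS :: "nat \<Rightarrow> (nat + nat) cpoly" where "SS i \<equiv> pvar (Inl i)"
abbreviation TT :: "nat \<Rightarrow> (nat + nat) cpoly" where "TT j \<equiv> pvar (Inr j)"

text \<open>The tower along which the variables T are adjoined one at a time to the polynomials in
  S.\<close>

definition sub_ring :: "nat \<Rightarrow> (nat + nat) cpoly set" where
  "sub_ring k = carrier (poly_ring (range Inl \<union> Inr ` {..<k}))"

text \<open>Restriction to the linear subspace on which each T_j equals S_(\<sigma> j).\<close>

definition spec :: "(nat \<Rightarrow> nat) \<Rightarrow> (nat + nat) cpoly \<Rightarrow> nat cpoly" where
  "spec \<sigma> = psubst pconst (case_sum pvar (\<lambda>j. pvar (\<sigma> j)))"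

text \<open>Extensional functions make the set finite and leave exactly one element for k = 0, where
  the induction starts.\<close>

definition injections :: "nat \<Rightarrow> nat \<Rightarrow> (nat \<Rightarrow> nat) set" where
  "injections n k = {\<sigma> \<in> {..<k} \<rightarrow>\<^sub>E {..<n}. inj_on \<sigma> {..<k}}"

text \<open>Artin's normal forms: the degree in T_j is less than n - j, and the coefficients are
  polynomials in S.\<close>

primrec staircase :: "nat \<Rightarrow> nat \<Rightarrow> (nat + nat) cpoly set" where
  "staircase n 0 = sub_ring 0"
| "staircase n (Suc k) = {(\<Sum>m<n - k. \<rho> m * TT k ^ m) | \<rho>. \<forall>m. \<rho> m \<in> staircase n k}"

lemma sub_ring_closed:
  "pconst c \<in> sub_ring k" "SS i \<in> sub_ring k" "j < k \<Longrightarrow> TT j \<in> sub_ring k"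
  "f \<in> sub_ring k \<Longrightarrow> g \<in> sub_ring k \<Longrightarrow> f + g \<in> sub_ring k"
  "f \<in> sub_ring k \<Longrightarrow> g \<in> sub_ring k \<Longrightarrow> f - g \<in> sub_ring k"
  "f \<in> sub_ring k \<Longrightarrow> g \<in> sub_ring k \<Longrightarrow> f * g \<in> sub_ring k"
  "f \<in> sub_ring k \<Longrightarrow> - f \<in> sub_ring k" "f \<in> sub_ring k \<Longrightarrow> f ^ m \<in> sub_ring k" "0 \<in> sub_ring k" "1 \<in> sub_ring k"
  "(\<And>x. x \<in> A \<Longrightarrow> F x \<in> sub_ring k) \<Longrightarrow> sum F A \<in> sub_ring k"
  unfolding sub_ring_def by (auto intro: poly_ring_closed')

lemma sub_ring_mono: "k \<le> l \<Longrightarrow> f \<in> sub_ring k \<Longrightarrow> f \<in> sub_ring l"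
  unfolding sub_ring_def by (rule poly_ring_mono[of "range Inl \<union> Inr ` {..<k}"]) auto

lemma staircase_sub_ring: "f \<in> staircase n k \<Longrightarrow> f \<in> sub_ring k"
proof (induction k arbitrary: f)
  case (Suc k)
  then obtain \<rho> where "f = (\<Sum>m<n - k. \<rho> m * TT k ^ m)" "\<forall>m. \<rho> m \<in> sub_ring k" by auto
  then show ?case by (auto intro!: sub_ring_closed intro: sub_ring_mono[of k "Suc k"])
qed simp

text \<open>Viewed as a polynomial in the last variable \<open>T\<^sub>k\<close> of degree less than \<open>n - k\<close>, a staircase polynomial
  has the \<open>n - k\<close> roots \<open>S\<^sub>s\<close>, where \<open>s\<close> is not a value of the injection \<open>\<sigma>\<close> on \<open>{..<k}\<close>.\<close>

lemma staircase_vanish: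
  assumes "k \<le> n" "f \<in> staircase n k" "\<And>\<sigma>. \<sigma> \<in> injections n k \<Longrightarrow> spec \<sigma> f = 0"
  shows "f = 0"
  using assms
proof (induction k arbitrary: f)
  case 0
  have "(\<lambda>x. undefined) \<in> injections n 0" by (auto simp: injections_def)
  then have "spec (\<lambda>x. undefined) f = 0" using 0 by blast
  then have "psubst pconst SS (spec (\<lambda>x. undefined) f) = 0" by (simp add: psubst_zero[OF pconst_hom])
  moreover have "psubst pconst SS (spec (\<lambda>x. undefined) f) = f"
    unfolding spec_def psubst_psubst[OF pconst_hom]
    by (rule psubst_ident[of f "range Inl"]) (use 0 in \<open>auto simp: sub_ring_def psubst_pvar[OF pconst_hom]\<close>)
  ultimately show ?case by simp
next
  case (Suc k)
  then obtain \<rho> where \<rho>: "f = (\<Sum>m<n - k. \<rho> m * TT k ^ m)" "\<And>m. \<rho> m \<in> staircase n k" by auto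
  have "\<rho> m = 0" if m: "m < n - k" for m
  proof (rule Suc.IH)
    fix \<sigma> assume \<sigma>: "\<sigma> \<in> injections n k"
    define p where "p = (\<Sum>m<n - k. Polynomial.monom (spec \<sigma> (\<rho> m)) m)"
    have coeff: "coeff p i = (if i < n - k then spec \<sigma> (\<rho> i) else 0)" for i
      by (auto simp: p_def coeff_sum)
    have root: "poly p (pvar s) = 0" if s: "s \<in> {..<n} - \<sigma> ` {..<k}" for s
    proof -
      have "\<sigma>(k := s) \<in> injections n (Suc k)"
        using \<sigma> s by (auto simp: injections_def PiE_def Pi_def extensional_def inj_on_def less_Suc_eq image_iff)
      then have "spec (\<sigma>(k := s)) f = 0" using Suc.prems by blast
      moreover have "spec (\<sigma>(k := s)) (\<rho> m) = spec \<sigma> (\<rho> m)" for m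
        unfolding spec_def using staircase_sub_ring[OF \<rho>(2)[of m]] unfolding sub_ring_def
        by (rule psubst_cong) auto
      moreover have "spec (\<sigma>(k := s)) (TT k) = pvar s" by (simp add: spec_def psubst_pvar[OF pconst_hom])
      ultimately show ?thesis
        by (simp add: p_def poly_sum poly_monom \<rho>(1)) (simp add: spec_def psubst_hom_simps[OF pconst_hom] psubst_power[OF pconst_hom])
    qed
    have "p = 0"
    proof (rule ccontr)
      assume p: "p \<noteq> 0"
      have inj: "inj_on pvar B" for B :: "nat set"
      proof (rule inj_onI)
        fix a b :: nat assume "pvar a = pvar b"
        from arg_cong[OF this, of "peval (\<lambda>i. if i = a then 1 else 0)"] show "a = b"
          by (simp add: psubst_pvar[OF id_hom] split: if_splits)
      qed
      have "n - k = card ({..<n} - \<sigma> ` {..<k})"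
        using \<sigma> by (subst card_Diff_subset) (auto simp: injections_def card_image)
      also have "\<dots> = card (pvar ` ({..<n} - \<sigma> ` {..<k}) :: nat cpoly set)" by (simp add: card_image inj)
      also have "\<dots> \<le> card {x. poly p x = 0}" using root poly_roots_finite[OF p] by (intro card_mono) auto
      also have "\<dots> \<le> degree p" by (rule card_poly_roots_bound[OF p])
      also have "\<dots> < n - k" using p m coeff by (metis leading_coeff_0_iff)
      finally show False by simp
    qed
    then show "spec \<sigma> (\<rho> m) = 0" using coeff[of m] m by simp
  qed (use Suc.prems \<rho> in auto)
  then show ?case by (simp add: \<rho>(1))
qed

text \<open>The ideal J contains the relations e_k(S) = e_k(T) but may be larger, so that it can
  later be defined by the vanishing of a linear map.\<close>

locale root_ideal =
  fixes n :: nat and J :: "(nat + nat) cpoly set"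
  assumes zero: "0 \<in> J" and add: "f \<in> J \<Longrightarrow> g \<in> J \<Longrightarrow> f + g \<in> J" and mult: "f \<in> J \<Longrightarrow> h * f \<in> J"
    and gen: "fps_nth ((\<Prod>i<n. 1 - fps_const (SS i) * fps_X) - (\<Prod>j<n. 1 - fps_const (TT j) * fps_X)) k \<in> J"
begin

lemma sum_mem: "(\<And>x. x \<in> A \<Longrightarrow> F x \<in> J) \<Longrightarrow> sum F A \<in> J"
  by (induction A rule: infinite_finite_induct) (auto simp: zero add)

definition geom :: "nat \<Rightarrow> (nat + nat) cpoly fps" where
  "geom j = Abs_fps (\<lambda>m. TT j ^ m)"

lemma geom_inverse: "(1 - fps_const (TT j) * fps_X) * geom j = 1"
  by (rule fps_ext) (auto simp: fps_linear_nth geom_def power_eq_if)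

definition lin :: "(nat \<Rightarrow> (nat + nat) cpoly) \<Rightarrow> nat set \<Rightarrow> (nat + nat) cpoly fps" where
  "lin a A = (\<Prod>i\<in>A. 1 - fps_const (a i) * fps_X)"

text \<open>Coefficients of the product of the 1 - S_i X divided by the 1 - T_j X with j < k. The
  constant coefficient 1 makes the equation for T_k monic.\<close>

definition cf :: "nat \<Rightarrow> nat \<Rightarrow> (nat + nat) cpoly" where
  "cf k l = fps_nth (lin SS {..<n} * (\<Prod>j<k. geom j)) l"

lemma cf_sub_ring: "cf k l \<in> sub_ring k"
proof -
  define FC where "FC = {A. \<forall>l. fps_nth A l \<in> sub_ring k}"
  have mult: "A * B \<in> FC" if "A \<in> FC" "B \<in> FC" for A B
    using that by (auto simp: FC_def fps_mult_nth intro!: sub_ring_closed)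
  have one: "1 \<in> FC" by (auto simp: FC_def intro: sub_ring_closed)
  have prod: "prod F A \<in> FC" if "\<And>x. x \<in> A \<Longrightarrow> F x \<in> FC" for F and A :: "nat set"
    using that by (induction A rule: infinite_finite_induct) (auto simp: one mult)
  have "1 - fps_const (SS i) * fps_X \<in> FC" for i
    using fps_linear_nth[of "SS i" 1] by (auto simp: FC_def simp del: fps_mult_left_const_nth intro!: sub_ring_closed)
  moreover have "geom j \<in> FC" if "j < k" for j
    using that by (auto simp: FC_def geom_def intro!: sub_ring_closed)
  ultimately have "lin SS {..<n} * (\<Prod>j<k. geom j) \<in> FC"
    unfolding lin_def by (intro mult prod) auto
  then show ?thesis by (simp add: FC_def cf_def)
qed

lemma cf_0: "cf k 0 = 1"
proof -
  have "fps_nth (prod F A) 0 = 1" if "\<And>x. x \<in> A \<Longrightarrow> fps_nth (F x) 0 = 1" for F :: "nat \<Rightarrow> (nat + nat) cpoly fps" and A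
    using that by (induction A rule: infinite_finite_induct) auto
  then show ?thesis by (simp add: cf_def lin_def geom_def)
qed

text \<open>Modulo \<open>J\<close> the product of all \<open>1 - S\<^sub>i X\<close> divided by \<open>1 - T\<^sub>j X\<close> for \<open>j \<le> k\<close> is a polynomial of degree
  \<open>n - k - 1\<close> in \<open>X\<close>. Its coefficient of \<open>X\<^sup>n\<^sup>-\<^sup>k\<close> is a monic equation for \<open>T\<^sub>k\<close>.\<close>

lemma monic_relation:
  assumes k: "k < n"
  shows "(\<Sum>l\<le>n - k. cf k l * TT k ^ (n - k - l)) \<in> J"
proof -
  let ?G = "\<Prod>j<Suc k. geom j"
  have "lin TT {..<n} * ?G = lin TT {Suc k..<n} * (lin TT {..<Suc k} * ?G)"
  proof -
    have "{..<n} = {Suc k..<n} \<union> {..<Suc k}" using k by auto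
    then have "lin TT {..<n} = lin TT {Suc k..<n} * lin TT {..<Suc k}"
      unfolding lin_def by (metis (no_types, lifting) finite_atLeastLessThan finite_lessThan
        ivl_disj_int_one(2) lessThan_atLeast0 prod.union_disjoint inf_commute ivl_disj_int_two(3))
    then show ?thesis by (simp add: mult.assoc)
  qed
  also have "lin TT {..<Suc k} * ?G = (\<Prod>j<Suc k. (1 - fps_const (TT j) * fps_X) * geom j)"
    unfolding lin_def prod.distrib ..
  also have "\<dots> = 1" by (simp only: geom_inverse prod.neutral_const)
  finally have T: "lin TT {..<n} * ?G = lin TT {Suc k..<n}" by simp
  have S: "lin SS {..<n} * ?G = (lin SS {..<n} * (\<Prod>j<k. geom j)) * geom k" by (simp add: mult.assoc)
  have "fps_nth ((lin SS {..<n} - lin TT {..<n}) * ?G) (n - k) \<in> J"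
    unfolding fps_mult_nth
  proof (rule sum_mem)
    fix i assume "i \<in> {0..n - k}"
    show "fps_nth (lin SS {..<n} - lin TT {..<n}) i * fps_nth ?G (n - k - i) \<in> J"
      using mult[OF gen[of i], of "fps_nth ?G (n - k - i)"] by (simp only: lin_def mult.commute)
  qed
  also have "(lin SS {..<n} - lin TT {..<n}) * ?G = (lin SS {..<n} * (\<Prod>j<k. geom j)) * geom k - lin TT {Suc k..<n}"
    by (simp only: left_diff_distrib T S)
  also have "fps_nth \<dots> (n - k) = (\<Sum>l\<le>n - k. cf k l * TT k ^ (n - k - l))"
  proof -
    have "fps_nth (lin TT {Suc k..<n}) (n - k) = 0"
      unfolding lin_def using k by (intro fps_linear_prod_degree) auto
    then show ?thesis by (simp add: fps_mult_nth cf_def geom_def atLeast0AtMost)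
  qed
  finally show ?thesis .
qed

text \<open>Division with remainder by the monic equation for T_k. The set \<open>Q\<close> of
  polynomials that have a remainder contains 1 and is stable under multiplication by T_k and by the
  smaller ring.\<close>

lemma reduce_one:
  assumes k: "k < n" and f: "f \<in> sub_ring (Suc k)"
  shows "\<exists>a. (\<forall>m. a m \<in> sub_ring k) \<and> f - (\<Sum>m<n - k. a m * TT k ^ m) \<in> J"
proof -
  define N where "N = n - k"
  define Q where "Q = {f. \<exists>a. (\<forall>m. a m \<in> sub_ring k) \<and> f - (\<Sum>m<N. a m * TT k ^ m) \<in> J}"
  obtain N' where N: "N = Suc N'" using k by (cases N) (auto simp: N_def)
  have Qadd: "f + g \<in> Q" if fQ: "f \<in> Q" and gQ: "g \<in> Q" for f g
  proof -
    obtain a where a: "\<forall>m. a m \<in> sub_ring k" "f - (\<Sum>m<N. a m * TT k ^ m) \<in> J" using fQ by (auto simp: Q_def)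
    obtain b where b: "\<forall>m. b m \<in> sub_ring k" "g - (\<Sum>m<N. b m * TT k ^ m) \<in> J" using gQ by (auto simp: Q_def)
    have "f + g - (\<Sum>m<N. (a m + b m) * TT k ^ m) = (f - (\<Sum>m<N. a m * TT k ^ m)) + (g - (\<Sum>m<N. b m * TT k ^ m))"
      by (simp add: algebra_simps sum.distrib)
    then have "f + g - (\<Sum>m<N. (a m + b m) * TT k ^ m) \<in> J" using add[OF a(2) b(2)] by (simp only:)
    then show ?thesis unfolding Q_def using a b by (intro CollectI exI[of _ "\<lambda>m. a m + b m"]) (auto intro: sub_ring_closed)
  qed
  have Qmul: "c * f \<in> Q" if c: "c \<in> sub_ring k" and fQ: "f \<in> Q" for c f
  proof -
    obtain a where a: "\<forall>m. a m \<in> sub_ring k" "f - (\<Sum>m<N. a m * TT k ^ m) \<in> J" using fQ by (auto simp: Q_def)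
    have "c * f - (\<Sum>m<N. (c * a m) * TT k ^ m) = c * (f - (\<Sum>m<N. a m * TT k ^ m))"
      by (simp add: algebra_simps sum_distrib_left)
    then have "c * f - (\<Sum>m<N. (c * a m) * TT k ^ m) \<in> J" using mult[OF a(2), of c] by (simp only:)
    then show ?thesis unfolding Q_def using a c by (intro CollectI exI[of _ "\<lambda>m. c * a m"]) (auto intro: sub_ring_closed)
  qed
  have QT: "TT k * f \<in> Q" if fQ: "f \<in> Q" for f
  proof -
    obtain a where a: "\<forall>m. a m \<in> sub_ring k" "f - (\<Sum>m<N. a m * TT k ^ m) \<in> J" using fQ by (auto simp: Q_def)
    \<comment> \<open>Multiplication by T_k shifts the coefficients; the top one,
      \<open>a N'\<close>, overflows to degree N and is brought back by the monic equation.\<close>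
    define b where "b m = (if m = 0 then 0 else a (m - 1)) - a N' * cf k (N - m)" for m
    have rel: "TT k ^ N + (\<Sum>m<N. cf k (N - m) * TT k ^ m) \<in> J"
    proof -
      have "(\<Sum>l\<le>N. cf k l * TT k ^ (N - l)) = (\<Sum>m\<le>N. cf k (N - m) * TT k ^ m)"
        by (rule sum.reindex_bij_witness[of _ "\<lambda>m. N - m" "\<lambda>m. N - m"]) auto
      also have "\<dots> = TT k ^ N + (\<Sum>m<N. cf k (N - m) * TT k ^ m)"
        by (simp add: lessThan_Suc_atMost[symmetric] cf_0)
      finally show ?thesis using monic_relation[OF k] by (simp add: N_def)
    qed
    have "(\<Sum>m<N. a m * TT k ^ Suc m) = (\<Sum>m<N. (if m = 0 then 0 else a (m - 1)) * TT k ^ m) + a N' * TT k ^ N"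
    proof -
      have "(\<Sum>m<N. (if m = 0 then 0 else a (m - 1)) * TT k ^ m) = (\<Sum>m<N'. a m * TT k ^ Suc m)"
        unfolding N by (subst sum.lessThan_Suc_shift) simp
      then show ?thesis by (simp add: N)
    qed
    then have "TT k * f - (\<Sum>m<N. b m * TT k ^ m)
        = TT k * (f - (\<Sum>m<N. a m * TT k ^ m)) + a N' * (TT k ^ N + (\<Sum>m<N. cf k (N - m) * TT k ^ m))"
      by (simp add: b_def algebra_simps sum_distrib_left sum_subtractf sum.distrib)
    also have "\<dots> \<in> J" by (intro add mult a rel)
    finally have "TT k * f - (\<Sum>m<N. b m * TT k ^ m) \<in> J" .
    moreover have "b m \<in> sub_ring k" for m
      using a(1) cf_sub_ring by (auto simp: b_def intro!: sub_ring_closed)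
    ultimately show ?thesis unfolding Q_def by blast
  qed
  have Q1: "1 \<in> Q"
  proof -
    have "(\<Sum>m<N. (if m = 0 then 1 else 0) * TT k ^ m) = 1"
      unfolding N by (subst sum.lessThan_Suc_shift) simp
    then show ?thesis unfolding Q_def
      by (intro CollectI exI[of _ "\<lambda>m. if m = 0 then 1 else 0"]) (auto simp: zero intro: sub_ring_closed)
  qed
  have "f * g \<in> Q" if "g \<in> Q" for g
    using f that unfolding sub_ring_def
  proof (induction arbitrary: g rule: poly_ring_induct)
    case (const c)
    then show ?case by (intro Qmul sub_ring_closed)
  next
    case (var v)
    then consider i where "v = Inl i" | j where "v = Inr j" "j < k" | "v = Inr k" by (auto simp: less_Suc_eq)
    then show ?case using var by cases (auto intro!: Qmul QT sub_ring_closed)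
  next
    case (add f h)
    then show ?case by (simp add: distrib_right Qadd)
  next
    case (mult f h)
    then show ?case by (simp add: mult.assoc)
  qed
  from this[OF Q1] show ?thesis by (simp add: Q_def N_def)
qed

lemma reduce:
  assumes "k \<le> n" "f \<in> sub_ring k"
  shows "\<exists>\<rho>\<in>staircase n k. f - \<rho> \<in> J"
  using assms
proof (induction k arbitrary: f)
  case 0
  then show ?case by (intro bexI[of _ f]) (auto simp: zero)
next
  case (Suc k)
  then obtain a where a: "\<forall>m. a m \<in> sub_ring k" "f - (\<Sum>m<n - k. a m * TT k ^ m) \<in> J"
    using reduce_one[of k f] by auto
  have "\<forall>m. \<exists>\<rho>. \<rho> \<in> staircase n k \<and> a m - \<rho> \<in> J" using Suc a(1) by fastforce
  then obtain \<rho> where \<rho>: "\<And>m. \<rho> m \<in> staircase n k" "\<And>m. a m - \<rho> m \<in> J" by metis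
  have "(\<Sum>m<n - k. TT k ^ m * (a m - \<rho> m)) \<in> J" by (intro sum_mem mult \<rho>)
  from add[OF a(2) this] have "f - (\<Sum>m<n - k. \<rho> m * TT k ^ m) \<in> J"
    by (simp add: algebra_simps sum_subtractf)
  then show ?case using \<rho>(1) by auto
qed

text \<open>This is the radicality. The normal form of f vanishes on all components together with f,
  hence is zero by \<open>staircase_vanish\<close>.\<close>

theorem vanishing_imp_mem:
  assumes "\<And>f \<sigma>. f \<in> J \<Longrightarrow> \<sigma> \<in> injections n n \<Longrightarrow> spec \<sigma> f = 0"
    and "f \<in> sub_ring n" "\<And>\<sigma>. \<sigma> \<in> injections n n \<Longrightarrow> spec \<sigma> f = 0"
  shows "f \<in> J"
proof -
  obtain \<rho> where \<rho>: "\<rho> \<in> staircase n n" "f - \<rho> \<in> J" using reduce[OF order_refl assms(2)] by blast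
  have "\<rho> = 0"
  proof (rule staircase_vanish[OF order_refl \<rho>(1)])
    fix \<sigma> assume \<sigma>: "\<sigma> \<in> injections n n"
    have "spec \<sigma> (f - \<rho>) = 0" using assms(1)[OF \<rho>(2) \<sigma>] .
    then show "spec \<sigma> \<rho> = 0" using assms(3)[OF \<sigma>] by (simp add: spec_def psubst_hom_simps[OF pconst_hom])
  qed
  then show ?thesis using \<rho>(2) by simp
qed

end

section \<open>Factorization of linear maps and Taylor expansion\<close>

definition lin_ext :: "(('u \<Rightarrow>\<^sub>0 nat) \<Rightarrow> 'v cpoly) \<Rightarrow> 'u cpoly \<Rightarrow> 'v cpoly" where
  "lin_ext \<Lambda> f = (\<Sum>\<mu>\<in>keys f. pconst (lookup f \<mu>) * \<Lambda> \<mu>)"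

lemma lin_ext_superset:
  "finite A \<Longrightarrow> keys f \<subseteq> A \<Longrightarrow> lin_ext \<Lambda> f = (\<Sum>\<mu>\<in>A. pconst (lookup f \<mu>) * \<Lambda> \<mu>)"
  unfolding lin_ext_def by (rule sum.mono_neutral_left) (auto simp: in_keys_iff pconst_simps)

lemma lin_ext_simps:
  "lin_ext \<Lambda> (f + g) = lin_ext \<Lambda> f + lin_ext \<Lambda> g"
  "lin_ext \<Lambda> (pconst c * f) = pconst c * lin_ext \<Lambda> f"
  "lin_ext \<Lambda> (single \<mu> 1) = \<Lambda> \<mu>"
  "lin_ext \<Lambda> 0 = 0"
proof -
  let ?A = "keys f \<union> keys g"
  have "keys (f + g) \<subseteq> ?A" by (rule keys_add)
  then show "lin_ext \<Lambda> (f + g) = lin_ext \<Lambda> f + lin_ext \<Lambda> g"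
    by (simp add: lin_ext_superset[of ?A] lookup_add pconst_simps algebra_simps sum.distrib)
  have "keys (pconst c * f) \<subseteq> keys f" by (auto simp: in_keys_iff pconst_mult_lookup)
  then show "lin_ext \<Lambda> (pconst c * f) = pconst c * lin_ext \<Lambda> f"
    by (simp add: lin_ext_superset[of "keys f"] pconst_mult_lookup pconst_simps sum_distrib_left mult.assoc)
qed (simp_all add: lin_ext_def pconst_simps)

lemma lin_ext_diff: "lin_ext \<Lambda> (f - pconst c * g) = lin_ext \<Lambda> f - pconst c * lin_ext \<Lambda> g"
  using lin_ext_simps(1)[of \<Lambda> "f - pconst c * g" "pconst c * g"] by (simp add: lin_ext_simps)

lemma cpoly_expand: "f = (\<Sum>\<mu>\<in>keys f. pconst (lookup f \<mu>) * single \<mu> 1)"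
  by (subst poly_mapping_sum_single) (simp add: pconst_mult_single)

text \<open>A linear map that respects the relations \<open>e\<^sub>k(S) = e\<^sub>k(T)\<close> factors through the restrictions to the
  components \<open>T = (S\<^sub>\<sigma>\<^sub>(\<^sub>0\<^sub>), \<dots>)\<close> of their zero set, because these relations generate a radical ideal.\<close>

lemma linear_factor:
  fixes L :: "(nat + nat) cpoly \<Rightarrow> 'v cpoly"
  assumes Ladd: "\<And>f g. L (f + g) = L f + L g" and Lscale: "\<And>c f. L (pconst c * f) = pconst c * L f"
    and gen: "\<And>h \<epsilon>. L (h * (\<Prod>i<n. 1 - pconst \<epsilon> * SS i)) = L (h * (\<Prod>j<n. 1 - pconst \<epsilon> * TT j))"
  shows "\<exists>c. (\<forall>\<sigma> p. c \<sigma> p \<in> range L) \<and> (\<forall>f\<in>sub_ring n. L f = (\<Sum>\<sigma>\<in>injections n n. c \<sigma> (spec \<sigma> f)))"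
proof -
  have L0: "L 0 = 0" using Lscale[of 0 0] by (simp add: pconst_simps)
  have Lsum: "L (sum F A) = (\<Sum>x\<in>A. L (F x))" for F and A :: "'x set"
    by (induction A rule: infinite_finite_induct) (simp_all add: L0 Ladd)
  have Ldiff: "L (f - g) = L f - L g" for f g
    using Ladd[of "f - g" g] by simp
  have ss: "spec \<sigma> (f + g) = spec \<sigma> f + spec \<sigma> g" "spec \<sigma> (f * g) = spec \<sigma> f * spec \<sigma> g"
    "spec \<sigma> (f - g) = spec \<sigma> f - spec \<sigma> g" "spec \<sigma> (pconst c) = pconst c" "spec \<sigma> 0 = 0" "spec \<sigma> 1 = 1" for \<sigma> f g c
    by (simp_all add: spec_def psubst_hom_simps[OF pconst_hom])
  \<comment> \<open>The first condition describes the largest ideal inside the kernel of L. The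
    second supplies the first hypothesis of \<open>vanishing_imp_mem\<close>; both hold for the
    generating relations.\<close>
  define J where "J = {f. (\<forall>h. L (h * f) = 0) \<and> (\<forall>\<sigma>\<in>injections n n. spec \<sigma> f = 0)}"
  interpret root_ideal n J
  proof
    show "0 \<in> J" by (simp add: J_def L0 ss)
    show "f + g \<in> J" if "f \<in> J" "g \<in> J" for f g
      using that by (simp add: J_def distrib_left Ladd ss)
    show "h * f \<in> J" if "f \<in> J" for h f
      using that by (auto simp: J_def ss mult.assoc[symmetric])
    fix k
    let ?S = "\<lambda>k. fps_nth (\<Prod>i<n. 1 - fps_const (SS i) * fps_X) k"
    let ?T = "\<lambda>k. fps_nth (\<Prod>j<n. 1 - fps_const (TT j) * fps_X) k"
    have "L (h * (?S k - ?T k)) = 0" for h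
    proof (cases "k \<le> n")
      case True
      \<comment> \<open>The hypothesis holds for every \<epsilon>; comparing powers of \<epsilon>,
        with zero as the subspace, gives it for each coefficient.\<close>
      have "L (h * (?S k - ?T k)) \<in> {0}"
      proof (rule subspace_coeffs[where N = n])
        fix \<epsilon>
        have "(\<Sum>k\<le>n. pconst (\<epsilon> ^ k) * L (h * (?S k - ?T k))) = L (h * ((\<Sum>k\<le>n. pconst (\<epsilon> ^ k) * ?S k) - (\<Sum>k\<le>n. pconst (\<epsilon> ^ k) * ?T k)))"
          unfolding sum_subtractf[symmetric] sum_distrib_left Lsum
          by (intro sum.cong refl) (simp add: Lscale[symmetric] algebra_simps)
        also have "\<dots> = 0"
          using gen[of h \<epsilon>] prod_linear_expand[of "{..<n}" n \<epsilon> SS] prod_linear_expand[of "{..<n}" n \<epsilon> TT]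
          by (simp add: right_diff_distrib Ldiff)
        finally show "(\<Sum>k\<le>n. pconst (\<epsilon> ^ k) * L (h * (?S k - ?T k))) \<in> {0}" by simp
      qed (use True in auto)
      then show ?thesis by simp
    next
      case False
      then show ?thesis by (simp add: fps_linear_prod_degree L0)
    qed
    moreover have "spec \<sigma> (?S k - ?T k) = 0" if \<sigma>: "\<sigma> \<in> injections n n" for \<sigma>
    proof -
      have map: "spec \<sigma> (fps_nth (\<Prod>i\<in>A. 1 - fps_const (a i) * fps_X) k) = fps_nth (\<Prod>i\<in>A. 1 - fps_const (spec \<sigma> (a i)) * fps_X) k"
        if "finite A" for A :: "nat set" and a k
        using that
      proof (induction A arbitrary: k)
        case empty
        then show ?case by (simp add: fps_one_nth ss)
      next
        case (insert x A)
        then show ?case by (simp add: fps_linear_nth ss)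
      qed
      have "\<sigma> ` {..<n} = {..<n}"
        using \<sigma> by (intro card_subset_eq) (auto simp: injections_def card_image)
      then have "bij_betw \<sigma> {..<n} {..<n}" using \<sigma> by (auto simp: bij_betw_def injections_def)
      then have "(\<Prod>j<n. 1 - fps_const (pvar (\<sigma> j)) * fps_X) = (\<Prod>i<n. 1 - fps_const (pvar i :: nat cpoly) * fps_X)"
        by (rule prod.reindex_bij_betw)
      then show ?thesis
        unfolding ss map[OF finite_lessThan] by (simp add: spec_def psubst_pvar[OF pconst_hom])
    qed
    ultimately show "fps_nth ((\<Prod>i<n. 1 - fps_const (SS i) * fps_X) - (\<Prod>j<n. 1 - fps_const (TT j) * fps_X)) k \<in> J"
      by (simp add: J_def)
  qed
  define scale :: "complex \<Rightarrow> ((nat \<Rightarrow> nat) \<Rightarrow>\<^sub>0 nat cpoly) \<Rightarrow> (nat \<Rightarrow> nat) \<Rightarrow>\<^sub>0 nat cpoly" where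
    "scale c X = Poly_Mapping.map ((*) (pconst c)) X" for c X
  have lks: "lookup (scale c X) \<sigma> = pconst c * lookup X \<sigma>" for c X \<sigma>
    by (simp add: scale_def map.rep_eq when_def)
  interpret vector_space_pair "\<lambda>c f. pconst c * f :: (nat + nat) cpoly" scale
  proof (intro vector_space_pair.intro cpoly_vector_space)
    show "vector_space scale"
      by unfold_locales (auto intro!: poly_mapping_eqI simp: lks lookup_add pconst_simps algebra_simps)
  qed
  define res where "res f = (\<Sum>\<sigma>\<in>injections n n. single \<sigma> (spec \<sigma> f))" for f
  have fin: "finite (injections n n)" unfolding injections_def
    by (rule finite_subset[of _ "{..<n} \<rightarrow>\<^sub>E {..<n}"]) (auto intro: finite_PiE)
  have lkr: "lookup (res f) \<sigma> = (if \<sigma> \<in> injections n n then spec \<sigma> f else 0)" for f \<sigma>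
    using fin by (simp add: res_def lookup_sum lookup_single when_def)
  have "Vector_Spaces.linear (\<lambda>c f. pconst c * f) scale res"
    by (intro Vector_Spaces.linear_iff[THEN iffD2] conjI allI vs1.vector_space_axioms vs2.vector_space_axioms)
      (auto intro!: poly_mapping_eqI simp: lkr lks lookup_add ss)
  moreover have "vs1.subspace (sub_ring n)"
    by (auto simp: vs1.subspace_def intro: sub_ring_closed)
  \<comment> \<open>A linear section of the restriction map \<open>res\<close>. Since g is defined
    on all tuples, the tuple \<open>res f\<close> can be split into its entries, even though a tuple
    with one nonzero entry need not be a restriction. The error \<open>f - g (res f)\<close>
    vanishes on every component, so L kills it.\<close>
  ultimately obtain g where g: "range g \<subseteq> sub_ring n" "Vector_Spaces.linear scale (\<lambda>c f. pconst c * f) g"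
      "\<And>v. v \<in> res ` sub_ring n \<Longrightarrow> res (g v) = v"
    using linear_exists_right_inverse_on by metis
  interpret g: Vector_Spaces.linear scale "\<lambda>c f. pconst c * f" g by (rule g(2))
  define c where "c \<sigma> p = L (g (single \<sigma> p))" for \<sigma> p
  have "L f = (\<Sum>\<sigma>\<in>injections n n. c \<sigma> (spec \<sigma> f))" if f: "f \<in> sub_ring n" for f
  proof -
    have gr: "g (res f) \<in> sub_ring n" using g(1) by blast
    have "f - g (res f) \<in> J"
    proof (rule vanishing_imp_mem)
      show "f - g (res f) \<in> sub_ring n" using f gr by (rule sub_ring_closed)
      show "spec \<sigma> f = 0" if "f \<in> J" "\<sigma> \<in> injections n n" for f \<sigma> using that by (simp add: J_def)
      fix \<sigma> assume \<sigma>: "\<sigma> \<in> injections n n"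
      have "res (g (res f)) = res f" using g(3) f by blast
      then have "lookup (res (g (res f))) \<sigma> = lookup (res f) \<sigma>" by simp
      then show "spec \<sigma> (f - g (res f)) = 0" using \<sigma> by (simp add: lkr ss)
    qed
    then have "L (1 * (f - g (res f))) = 0" unfolding J_def by blast
    then have "L f = L (g (res f))" by (simp add: Ldiff)
    also have "\<dots> = (\<Sum>\<sigma>\<in>injections n n. c \<sigma> (spec \<sigma> f))"
      unfolding res_def c_def g.sum Lsum ..
    finally show ?thesis .
  qed
  then show ?thesis by (intro exI[of _ c]) (auto simp: c_def)
qed

section \<open>Derivatives of monomials and polarization\<close>

lemma lookup_pvar_mult:
  "lookup (pvar v * g) (\<nu> + single v 1) = lookup g \<nu>"
proof -
  have "pvar v * g = (\<Sum>\<xi>\<in>keys g. single (\<xi> + single v 1) (lookup g \<xi>))"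
    by (subst poly_mapping_sum_single[of g]) (simp add: pvar_def sum_distrib_left mult_single add.commute)
  then show ?thesis by (simp add: lookup_sum lookup_single when_def in_keys_iff)
qed

lemma pvar_pd_monomial:
  "pvar v * pd v (single \<mu> 1) = pconst (of_nat (lookup \<mu> v)) * single \<mu> 1"
proof -
  define C where "C \<mu> \<longleftrightarrow> pvar v * pd v (single \<mu> 1) = pconst (of_nat (lookup \<mu> v)) * single \<mu> 1" for \<mu>
  have 0: "C 0" by (simp add: C_def pconst_simps)
  have add: "C (\<mu> + \<nu>)" if "C \<mu>" "C \<nu>" for \<mu> \<nu>
  proof -
    have e: "single (\<mu> + \<nu>) (1::complex) = single \<mu> 1 * single \<nu> 1"
      by (simp add: mult_single)
    have "pvar v * pd v (single \<mu> 1 * single \<nu> 1)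
        = (pvar v * pd v (single \<mu> 1)) * single \<nu> 1 + single \<mu> 1 * (pvar v * pd v (single \<nu> 1))"
      by (simp add: pd_simps algebra_simps)
    also have "\<dots> = pconst (of_nat (lookup (\<mu> + \<nu>) v)) * (single \<mu> 1 * single \<nu> 1)"
      using that unfolding C_def by (simp add: lookup_add pconst_simps algebra_simps)
    finally show ?thesis unfolding C_def e .
  qed
  have one: "C (single u 1)" for u
    by (simp add: C_def pvar_def[symmetric] pd_simps lookup_single when_def pconst_simps del: One_nat_def)
  have "C (single u k)" for u k
  proof (induction k)
    case (Suc k)
    have "single u (Suc k) = single u k + single u 1" by (simp flip: single_add)
    then show ?case using add[OF Suc one] by simp
  qed (simp add: 0)
  then have "C (\<Sum>u\<in>A. single u (k u))" for A k
    by (induction A rule: infinite_finite_induct) (auto simp: 0 add)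
  from this[of "lookup \<mu>" "keys \<mu>"] show ?thesis
    by (simp add: C_def poly_mapping_sum_single[symmetric])
qed

lemma pd_scale: "pd v (pconst c * f) = pconst c * pd v f"
  by (simp add: pd_simps)

lemma pd_diff: "pd v (f - g) = pd v f - pd v g"
  using pd_simps(1)[of v "f - g" g] by simp

lemma lookup_pvar_pd: "lookup (pvar v * pd v f) \<mu> = of_nat (lookup \<mu> v) * lookup f \<mu>"
proof -
  have "pvar v * pd v f = (\<Sum>\<xi>\<in>keys f. pconst (lookup f \<xi>) * (pvar v * pd v (single \<xi> 1)))"
    by (subst cpoly_expand[of f]) (simp add: pd_sum pd_scale sum_distrib_left mult.left_commute)
  then have eq: "pvar v * pd v f = (\<Sum>\<xi>\<in>keys f. pconst (lookup f \<xi>) *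
      (pconst (of_nat (lookup \<xi> v)) * single \<xi> 1))"
    by (simp only: pvar_pd_monomial)
  have "lookup (pvar v * pd v f) \<mu> =
      (\<Sum>\<xi>\<in>keys f. if \<xi> = \<mu> then of_nat (lookup \<mu> v) * lookup f \<mu> else 0)"
    unfolding eq lookup_sum pconst_mult_lookup by (intro sum.cong refl) (simp add: lookup_single when_def)
  then show ?thesis by (simp add: in_keys_iff)
qed

lemma lookup_pd: "lookup (pd v f) \<nu> =
    of_nat (Suc (lookup \<nu> v)) * lookup f (\<nu> + single v 1)"
  using lookup_pvar_pd[of v f "\<nu> + single v 1"]
  by (simp add: lookup_pvar_mult lookup_add lookup_single del: One_nat_def)

lemma pd_closed: "f \<in> carrier (poly_ring W) \<Longrightarrow> pd v f \<in> carrier (poly_ring W)"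
  by (induction rule: poly_ring_induct) (auto simp: pd_simps intro!: poly_ring_closed')

lemma pd_eq_0: "f \<in> carrier (poly_ring W) \<Longrightarrow> v \<notin> W \<Longrightarrow> pd v f = 0"
  by (induction rule: poly_ring_induct) (auto simp: pd_simps)

text \<open>Polarization differentiates once for every slot \<open>s\<close>, by the variable \<open>(idx s, \<mu> s)\<close>. The extra term in
  the slots of \<open>A\<close> is the chain rule for the substitution \<open>x \<mapsto> (1 - \<epsilon> t) x\<close>.\<close>

definition sop :: "complex \<Rightarrow> 'i set \<Rightarrow> ('i \<Rightarrow> nat) \<Rightarrow> ('i \<Rightarrow> nat) \<Rightarrow> 'i \<Rightarrow> (nat \<times> nat) cpoly \<Rightarrow> (nat \<times> nat) cpoly" where
  "sop \<epsilon> A idx \<mu> s g = pd (idx s, \<mu> s) g - (if s \<in> A then pconst \<epsilon> * pd (idx s, Suc (\<mu> s)) g else 0)"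

lemma sop_simps: "sop \<epsilon> A idx \<mu> s (f - pconst c * g) = sop \<epsilon> A idx \<mu> s f - pconst c * sop \<epsilon> A idx \<mu> s g"
  by (simp add: sop_def pd_diff pd_scale) (auto simp: algebra_simps)

text \<open>All three families agree away from the slot p, and the iterated operator is linear in
  the operator applied at p.\<close>

lemma fold_slot:
  assumes lin: "\<And>s f g. F1 s (f - pconst c * g) = F1 s f - pconst c * F1 s g"
    and lin2: "\<And>s f g. F2 s (f - pconst c * g) = F2 s f - pconst c * F2 s g"
    and eq: "\<And>s g. s \<noteq> p \<Longrightarrow> F s g = F1 s g \<and> F2 s g = F1 s g" "\<And>g. F p g = F1 p g - pconst c * F2 p g"
    and "distinct xs" "p \<in> set xs"
  shows "fold F xs f = fold F1 xs f - pconst c * fold F2 xs (f :: 'v cpoly)"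
  using assms(5,6)
proof (induction xs arbitrary: f)
  case (Cons x xs)
  have same: "fold F1 xs (f - pconst c * g) = fold F1 xs f - pconst c * fold F1 xs g" for xs f g
    by (induction xs arbitrary: f g) (simp_all add: lin)
  show ?case
  proof (cases "x = p")
    case True
    have "F s = F1 s" "F2 s = F1 s" if "s \<in> set xs" for s
      using eq(1)[of s] Cons.prems True that by auto
    then have c: "fold F xs g = fold F1 xs g" "fold F2 xs g = fold F1 xs g" for g
      by - (rule List.fold_cong; simp)+
    show ?thesis using True by (simp add: eq(2) c same)
  next
    case False
    then show ?thesis using Cons eq(1)[OF False] by simp
  qed
qed simp

text \<open>The exponent of the variable s is the order of the derivative taken in the slot s.
  Multiplication by this variable raises the order by one, so the factor 1 - \<epsilon> s produces
  exactly the extra term of \<open>sop\<close> in that slot.\<close>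

lemma lin_ext_slots:
  assumes "distinct xs" "finite A" "A \<subseteq> set xs"
  shows "lin_ext (\<lambda>\<nu>. fold (sop \<epsilon> {} idx (lookup \<nu>)) xs f) (single \<nu> 1 * (\<Prod>s\<in>A. 1 - pconst \<epsilon> * pvar s))
    = fold (sop \<epsilon> A idx (lookup \<nu>)) xs f"
  using assms(2,3)
proof (induction A arbitrary: \<nu>)
  case empty
  then show ?case by (simp add: lin_ext_simps)
next
  case (insert p A)
  let ?L = "lin_ext (\<lambda>\<nu>. fold (sop \<epsilon> {} idx (lookup \<nu>)) xs f)" and ?P = "\<Prod>s\<in>A. 1 - pconst \<epsilon> * pvar s"
  let ?\<nu>' = "\<nu> + single p 1"
  have "single \<nu> 1 * (\<Prod>s\<in>insert p A. 1 - pconst \<epsilon> * pvar s)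
      = single \<nu> 1 * ?P - pconst \<epsilon> * (single ?\<nu>' 1 * ?P)"
  proof -
    have "single ?\<nu>' (1::complex) = single \<nu> 1 * pvar p" by (simp add: pvar_def mult_single)
    then show ?thesis using insert.hyps by (simp add: pconst_simps algebra_simps)
  qed
  then have "?L (single \<nu> 1 * (\<Prod>s\<in>insert p A. 1 - pconst \<epsilon> * pvar s))
      = fold (sop \<epsilon> A idx (lookup \<nu>)) xs f - pconst \<epsilon> * fold (sop \<epsilon> A idx (lookup ?\<nu>')) xs f"
    using insert by (simp add: lin_ext_diff del: One_nat_def)
  also have "\<dots> = fold (sop \<epsilon> (insert p A) idx (lookup \<nu>)) xs f"
    by (rule fold_slot[symmetric, where p = p])
      (use insert assms(1) in \<open>auto simp: sop_simps, auto simp: sop_def lookup_add lookup_single\<close>)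
  finally show ?case .
qed

lemma PiE_insert_sum:
  assumes "y \<notin> S"
  shows "(\<Sum>\<phi>\<in>Pi\<^sub>E (insert y S) B. H \<phi>) = (\<Sum>v\<in>B y. \<Sum>\<phi>\<in>Pi\<^sub>E S B. H (\<phi>(y := v)))"
proof -
  have "(\<Sum>\<phi>\<in>Pi\<^sub>E (insert y S) B. H \<phi>) = (\<Sum>x\<in>B y \<times> Pi\<^sub>E S B. H (case x of (v, \<phi>) \<Rightarrow> \<phi>(y := v)))"
    unfolding PiE_insert_eq using inj_combinator[OF assms, of B] by (simp add: sum.reindex)
  then show ?thesis by (simp add: sum.cartesian_product case_prod_unfold)
qed

definition tdeg :: "int list \<Rightarrow> int \<Rightarrow> (nat \<times> nat \<Rightarrow>\<^sub>0 nat) \<Rightarrow> nat" where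
  "tdeg w t \<mu> = (\<Sum>v\<in>keys \<mu>. if w ! fst v = t then lookup \<mu> v else 0)"

lemma tdeg_superset:
  "finite A \<Longrightarrow> keys \<mu> \<subseteq> A \<Longrightarrow> tdeg w t \<mu> = (\<Sum>v\<in>A. if w ! fst v = t then lookup \<mu> v else 0)"
  unfolding tdeg_def by (rule sum.mono_neutral_left) (auto simp: in_keys_iff)

lemma tdeg_add_single: "tdeg w t (\<mu> + single v 1) = tdeg w t \<mu> + (if w ! fst v = t then 1 else 0)"
proof -
  let ?A = "keys \<mu> \<union> {v}"
  have "keys (\<mu> + single v 1) \<subseteq> ?A" using keys_add[of \<mu> "single v 1"] by simp
  then have "tdeg w t (\<mu> + single v 1) =
      (\<Sum>u\<in>?A. if w ! fst u = t then lookup (\<mu> + single v 1) u else 0)"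
    by (intro tdeg_superset) auto
  also have "\<dots> = (\<Sum>u\<in>?A. (if w ! fst u = t then lookup \<mu> u else 0)
      + (if u = v then (if w ! fst v = t then 1 else 0) else 0))"
    by (intro sum.cong refl) (auto simp: lookup_add lookup_single when_def)
  also have "\<dots> = tdeg w t \<mu> + (if w ! fst v = t then 1 else 0)"
    unfolding sum.distrib tdeg_superset[of ?A \<mu>, OF finite_UnI[OF finite_keys finite.insertI[OF finite.emptyI]] Un_upper1] by simp
  finally show ?thesis .
qed

definition homog :: "int list \<Rightarrow> int \<Rightarrow> nat \<Rightarrow> (nat \<times> nat) cpoly \<Rightarrow> bool" where
  "homog w t n f \<longleftrightarrow> (\<forall>\<mu>\<in>keys f. tdeg w t \<mu> = n)"

lemma homog_pd: "homog w t ((if w ! i = t then 1 else 0) + n) f \<Longrightarrow> homog w t n (pd (i, k) f)"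
  unfolding homog_def
proof
  fix \<mu> assume f: "\<forall>\<mu>\<in>keys f. tdeg w t \<mu> = (if w ! i = t then 1 else 0) + n" and "\<mu> \<in> keys (pd (i, k) f)"
  then have "\<mu> + single (i, k) 1 \<in> keys f"
    unfolding in_keys_iff lookup_pd by auto
  then show "tdeg w t \<mu> = n" using f by (auto simp: tdeg_add_single simp del: One_nat_def split: if_splits)
qed

lemma homog_diff: "homog w t n f \<Longrightarrow> homog w t n g \<Longrightarrow> homog w t n (f - pconst c * g)"
  unfolding homog_def
proof
  fix \<mu> assume "\<forall>\<mu>\<in>keys f. tdeg w t \<mu> = n" "\<forall>\<mu>\<in>keys g. tdeg w t \<mu> = n" "\<mu> \<in> keys (f - pconst c * g)"
  then show "tdeg w t \<mu> = n" by (cases "\<mu> \<in> keys f") (auto simp: in_keys_iff lookup_minus pconst_mult_lookup)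
qed

lemma homog_fold:
  assumes "homog w t (length (filter (\<lambda>s. w ! idx s = t) xs) + n) f"
  shows "homog w t n (fold (sop \<epsilon> A idx \<mu>) xs f)"
  using assms
proof (induction xs arbitrary: f)
  case (Cons x xs)
  let ?m = "length (filter (\<lambda>s. w ! idx s = t) xs) + n"
  have h: "homog w t ?m (pd (idx x, k) f)" for k
    using Cons.prems by (intro homog_pd) (auto split: if_splits)
  have "homog w t ?m (sop \<epsilon> A idx \<mu> x f)"
    using homog_diff[OF h h, of "\<mu> x" \<epsilon> "Suc (\<mu> x)"] h[of "\<mu> x"] by (simp add: sop_def)
  then show ?case using Cons.IH by simp
qed simp

lemma fold_sop_closed: "f \<in> carrier (poly_ring W) \<Longrightarrow> fold (sop \<epsilon> A idx \<mu>) xs f \<in> carrier (poly_ring W)"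
proof (induction xs arbitrary: f)
  case (Cons x xs)
  have "sop \<epsilon> A idx \<mu> x f \<in> carrier (poly_ring W)"
    unfolding sop_def using Cons.prems
    by (cases "x \<in> A") (simp_all add: poly_ring_diff_closed poly_ring_closed pd_closed)
  then show ?case using Cons.IH by simp
qed simp

text \<open>The product, over all values t of \<tau>, of the factorial of the number of slots with
  value t.\<close>

primrec slot_const :: "('i \<Rightarrow> int) \<Rightarrow> 'i list \<Rightarrow> nat" where
  "slot_const \<tau> [] = 1"
| "slot_const \<tau> (y # ys) = length (filter (\<lambda>s. \<tau> s = \<tau> y) (y # ys)) * slot_const \<tau> ys"

lemma slot_const_pos: "slot_const \<tau> xs > 0"
  by (induction xs) auto

text \<open>Euler's identity for polynomials homogeneous in the variables of one weight, applied
  once for every slot. Each application lowers one degree by 1 and contributes the current degree as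
  a factor.\<close>

lemma taylor:
  assumes f: "f \<in> carrier (poly_ring ({..<length w} \<times> {..K}))"
    and hom: "\<And>t. t \<in> \<tau> ` set xs \<Longrightarrow> homog w t (length (filter (\<lambda>s. \<tau> s = t) xs)) f"
    and xs: "distinct xs"
  shows "pconst (of_nat (slot_const \<tau> xs)) * f = (\<Sum>idx\<in>Pi\<^sub>E (set xs) (\<lambda>s. {i. i < length w \<and> w ! i = \<tau> s}). \<Sum>a\<in>Pi\<^sub>E (set xs) (\<lambda>_. {..K}).
    (\<Prod>s\<in>set xs. pvar (idx s, a s)) * fold (sop 0 {} idx a) xs f)"
  using assms
proof (induction xs arbitrary: f)
  case Nil
  then show ?case by (simp add: pconst_simps)
next
  case (Cons y ys)
  let ?I = "\<lambda>s. {i. i < length w \<and> w ! i = \<tau> s}" and ?W = "{..<length w} \<times> {..K}"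
  define m where "m = length (filter (\<lambda>s. \<tau> s = \<tau> y) (y # ys))"
  have y: "y \<notin> set ys" "distinct ys" using Cons.prems by auto
  have euler: "pconst (of_nat m) * f = (\<Sum>i\<in>?I y. \<Sum>k\<le>K. pvar (i, k) * pd (i, k) f)"
  proof (rule poly_mapping_eqI)
    fix \<mu>
    have "lookup (\<Sum>i\<in>?I y. \<Sum>k\<le>K. pvar (i, k) * pd (i, k) f) \<mu>
        = of_nat (\<Sum>i\<in>?I y. \<Sum>k\<le>K. lookup \<mu> (i, k)) * lookup f \<mu>"
      by (simp add: lookup_sum lookup_pvar_pd sum_distrib_right)
    also have "\<dots> = of_nat m * lookup f \<mu>"
    proof (cases "\<mu> \<in> keys f")
      case True
      then have "keys \<mu> \<subseteq> ?W" using Cons.prems(1) by (simp add: poly_ring_carrier)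
      then have "tdeg w (\<tau> y) \<mu> = (\<Sum>v\<in>?W. if w ! fst v = \<tau> y then lookup \<mu> v else 0)"
        by (intro tdeg_superset) auto
      also have "\<dots> = (\<Sum>i<length w. \<Sum>k\<le>K. if w ! i = \<tau> y then lookup \<mu> (i, k) else 0)"
        by (simp add: sum.cartesian_product case_prod_unfold cong: if_cong)
      also have "\<dots> = (\<Sum>i\<in>?I y. \<Sum>k\<le>K. lookup \<mu> (i, k))"
        by (rule sum.mono_neutral_cong_right) auto
      finally have "tdeg w (\<tau> y) \<mu> = (\<Sum>i\<in>?I y. \<Sum>k\<le>K. lookup \<mu> (i, k))" .
      moreover have "tdeg w (\<tau> y) \<mu> = m"
        using Cons.prems(2)[of "\<tau> y"] True unfolding m_def homog_def by simp
      ultimately show ?thesis by simp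
    qed (simp add: in_keys_iff)
    finally show "lookup (pconst (of_nat m) * f) \<mu> = lookup (\<Sum>i\<in>?I y. \<Sum>k\<le>K. pvar (i, k) * pd (i, k) f) \<mu>"
      by (simp add: pconst_mult_lookup)
  qed
  let ?R = "\<lambda>f. \<Sum>idx\<in>Pi\<^sub>E (set ys) ?I. \<Sum>a\<in>Pi\<^sub>E (set ys) (\<lambda>_. {..K}). (\<Prod>s\<in>set ys. pvar (idx s, a s)) * fold (sop 0 {} idx a) ys f"
  have IH: "pconst (of_nat (slot_const \<tau> ys)) * pd (i, k) f = ?R (pd (i, k) f)" if i: "i \<in> ?I y" for i k
  proof (rule Cons.IH)
    show "pd (i, k) f \<in> carrier (poly_ring ?W)" using Cons.prems(1) by (rule pd_closed)
    fix t assume "t \<in> \<tau> ` set ys"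
    then have "homog w t (length (filter (\<lambda>s. \<tau> s = t) (y # ys))) f" using Cons.prems(2) by auto
    then show "homog w t (length (filter (\<lambda>s. \<tau> s = t) ys)) (pd (i, k) f)"
      using i by (intro homog_pd) (auto split: if_splits)
  qed (rule y)
  let ?c = "pconst (of_nat (slot_const \<tau> ys)) :: (nat \<times> nat) cpoly"
  let ?G = "\<lambda>idx a. (\<Prod>s\<in>set (y # ys). pvar (idx s, a s)) * fold (sop 0 {} idx a) (y # ys) f"
  have G: "?G (idx(y := i)) (a(y := k)) = pvar (i, k) * ((\<Prod>s\<in>set ys. pvar (idx s, a s)) * fold (sop 0 {} idx a) ys (pd (i, k) f))" for idx a i k
  proof -
    have "(\<Prod>s\<in>set ys. pvar ((idx(y := i)) s, (a(y := k)) s)) = (\<Prod>s\<in>set ys. pvar (idx s, a s))"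
      using y by (intro prod.cong) auto
    moreover have "fold (sop 0 {} (idx(y := i)) (a(y := k))) ys = fold (sop 0 {} idx a) ys"
      using y by (intro ext List.fold_cong) (auto simp: sop_def fun_eq_iff)
    ultimately show ?thesis using y by (simp add: sop_def mult.assoc)
  qed
  have "pconst (of_nat (slot_const \<tau> (y # ys))) * f = ?c * (pconst (of_nat m) * f)"
    by (simp add: m_def pconst_simps algebra_simps)
  also have "\<dots> = (\<Sum>i\<in>?I y. \<Sum>k\<le>K. pvar (i, k) * (?c * pd (i, k) f))"
    unfolding euler sum_distrib_left by (intro sum.cong refl) (simp add: algebra_simps)
  also have "\<dots> = (\<Sum>i\<in>?I y. \<Sum>k\<le>K. pvar (i, k) * ?R (pd (i, k) f))"
    by (intro sum.cong refl) (simp only: IH)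
  also have "\<dots> = (\<Sum>i\<in>?I y. \<Sum>k\<le>K. \<Sum>idx\<in>Pi\<^sub>E (set ys) ?I. \<Sum>a\<in>Pi\<^sub>E (set ys) (\<lambda>_. {..K}). ?G (idx(y := i)) (a(y := k)))"
    unfolding G sum_distrib_left ..
  also have "\<dots> = (\<Sum>i\<in>?I y. \<Sum>idx\<in>Pi\<^sub>E (set ys) ?I. \<Sum>k\<le>K. \<Sum>a\<in>Pi\<^sub>E (set ys) (\<lambda>_. {..K}). ?G (idx(y := i)) (a(y := k)))"
    by (intro sum.cong refl sum.swap)
  also have "\<dots> = (\<Sum>idx\<in>Pi\<^sub>E (set (y # ys)) ?I. \<Sum>a\<in>Pi\<^sub>E (set (y # ys)) (\<lambda>_. {..K}). ?G idx a)"
    unfolding list.set(2) PiE_insert_sum[OF y(1)] ..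
  finally show ?case .
qed

section \<open>All weights of absolute value at most one\<close>

text \<open>The coordinate series whose weight is \<open>t\<close> are multiplied by 1 - \<epsilon>
  X, where X is the parameter of the arc.\<close>

definition shift :: "int list \<Rightarrow> int \<Rightarrow> complex \<Rightarrow> (nat \<times> nat) cpoly \<Rightarrow> (nat \<times> nat) cpoly" where
  "shift w t \<epsilon> = psubst pconst (\<lambda>(i, k). pvar (i, k) - (if w ! i = t \<and> k \<noteq> 0 then pconst \<epsilon> * pvar (i, k - 1) else 0))"

lemma shift_simps:
  "shift w t \<epsilon> (f + g) = shift w t \<epsilon> f + shift w t \<epsilon> g" "shift w t \<epsilon> (f - g) = shift w t \<epsilon> f - shift w t \<epsilon> g"
  "shift w t \<epsilon> (f * g) = shift w t \<epsilon> f * shift w t \<epsilon> g" "shift w t \<epsilon> (pconst c) = pconst c" "shift w t \<epsilon> 0 = 0"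
  by (simp_all add: shift_def psubst_hom_simps[OF pconst_hom])

lemma pd_shift:
  "pd (i, k) (shift w t \<epsilon> f) = shift w t \<epsilon> (pd (i, k) f - (if w ! i = t then pconst \<epsilon> * pd (i, Suc k) f else 0))"
proof (induction f rule: cpoly_induct)
  case (const c)
  then show ?case by (simp add: shift_simps pd_simps)
next
  case (var v)
  obtain j l where v: "v = (j, l)" by (cases v)
  have s: "shift w t \<epsilon> (pvar (j, l)) = pvar (j, l) - (if w ! j = t \<and> l \<noteq> 0 then pconst \<epsilon> * pvar (j, l - 1) else 0)"
    by (simp add: shift_def psubst_pvar[OF pconst_hom])
  have one: "shift w t \<epsilon> 1 = 1" by (simp add: shift_def psubst_one[OF pconst_hom])
  show ?case unfolding v s
    by (cases l) (auto simp: pd_diff pd_scale pd_simps shift_simps one)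
next
  case (add f g)
  let ?T = "\<lambda>f. pd (i, k) f - (if w ! i = t then pconst \<epsilon> * pd (i, Suc k) f else 0)"
  have "pd (i, k) (shift w t \<epsilon> (f + g)) = shift w t \<epsilon> (?T f + ?T g)"
    by (simp only: shift_simps(1) pd_simps(1) add)
  also have "?T f + ?T g = ?T (f + g)" by (simp add: pd_simps algebra_simps)
  finally show ?case .
next
  case (mult f g)
  let ?T = "\<lambda>f. pd (i, k) f - (if w ! i = t then pconst \<epsilon> * pd (i, Suc k) f else 0)"
  have "pd (i, k) (shift w t \<epsilon> (f * g)) = shift w t \<epsilon> (?T f * g + f * ?T g)"
    by (simp only: shift_simps(1,3) pd_simps(2) mult)
  also have "?T f * g + f * ?T g = ?T (f * g)" by (simp add: pd_simps algebra_simps)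
  finally show ?case .
qed

lemma fold_pd_shift:
  assumes "\<And>s. s \<in> set xs \<Longrightarrow> s \<in> A \<longleftrightarrow> w ! idx s = t"
  shows "fold (sop 0 {} idx \<mu>) xs (shift w t \<epsilon> f) = shift w t \<epsilon> (fold (sop \<epsilon> A idx \<mu>) xs f)"
  using assms
proof (induction xs arbitrary: f)
  case (Cons x xs)
  have "sop 0 {} idx \<mu> x (shift w t \<epsilon> f) = shift w t \<epsilon> (sop \<epsilon> A idx \<mu> x f)"
    using Cons.prems[of x] by (simp add: sop_def pd_shift)
  then show ?case using Cons by simp
qed simp

text \<open>The unit \<gamma> = 1 - \<epsilon> X carries the arc with \<gamma> multiplied into the
  coordinates of weight -1 to the one with \<gamma> multiplied into those of weight 1. In this form
  both sides are polynomial substitutions without inverse series.\<close>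

lemma shift_invariant:
  assumes f: "f \<in> carrier (inv_jet_ring w m)" and w: "\<And>i. i < length w \<Longrightarrow> w ! i \<in> {-1, 0, 1}"
  shows "shift w 1 \<epsilon> f = shift w (-1) \<epsilon> f"
proof (rule peval_nonzero_eqI)
  fix v :: "nat \<times> nat \<Rightarrow> complex"
  define \<gamma> :: "complex fps" where "\<gamma> = 1 - fps_const \<epsilon> * fps_X"
  define v' where "v' t = (\<lambda>(i, k). v (i, k) - (if w ! i = t \<and> k \<noteq> 0 then \<epsilon> * v (i, k - 1) else 0))" for t
  have ev: "peval v (shift w t \<epsilon> f) = peval (v' t) f" for t
    unfolding shift_def psubst_psubst[OF id_hom]
    by (rule arg_cong[where f = "\<lambda>v. peval v f"]) (auto simp: v'_def fun_eq_iff psubst_hom_simps[OF id_hom])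
  have \<gamma>0: "fps_nth \<gamma> 0 \<noteq> 0" by (simp add: \<gamma>_def)
  have series: "Abs_fps (\<lambda>k. v' t (i, k)) = (if w ! i = t then \<gamma> else 1) * Abs_fps (\<lambda>k. v (i, k))" for t i
    by (rule fps_ext) (auto simp: v'_def \<gamma>_def fps_linear_nth)
  have "jet_act w \<gamma> (v' (-1)) (i, k) = v' 1 (i, k)" if "i < length w" for i k
  proof -
    have "\<gamma> powi (w ! i) * Abs_fps (\<lambda>k. v' (-1) (i, k)) = Abs_fps (\<lambda>k. v' 1 (i, k))"
      unfolding series using w[OF that] \<gamma>0
      by (auto simp: power_int_def inverse_mult_eq_1 mult.assoc[symmetric])
    then show ?thesis by (simp add: jet_act_def)
  qed
  then have "peval (v' 1) f = peval (jet_act w \<gamma> (v' (-1))) f"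
    using f by (intro psubst_cong[of f "{..<length w} \<times> {k. enat k \<le> m}"]) (auto simp: inv_jet_ring_iff coord_jet_ring_def)
  also have "\<dots> = peval (v' (-1)) f" by (rule inv_jet_ring_unit[OF f \<gamma>0])
  finally show "peval v (shift w 1 \<epsilon> f) = peval v (shift w (-1) \<epsilon> f)" by (simp add: ev)
qed

lemma homog_0_vars:
  assumes "homog w t 0 f" "\<mu> \<in> keys f" "v \<in> keys \<mu>"
  shows "w ! fst v \<noteq> t"
proof
  assume t: "w ! fst v = t"
  have "(\<Sum>v\<in>keys \<mu>. if w ! fst v = t then lookup \<mu> v else 0) = 0"
    using assms(1,2) by (simp add: homog_def tdeg_def)
  then have "(if w ! fst v = t then lookup \<mu> v else 0) = 0"
    using assms(3) by (simp only: sum_eq_0_iff finite_keys)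
  then show False using assms(3) t by (simp add: in_keys_iff)
qed

locale unit_weights =
  fixes w :: "int list"
  assumes unit: "i < length w \<Longrightarrow> w ! i \<in> {-1, 0, 1}"
begin

definition zvars :: "(nat \<times> nat) set" where
  "zvars = {v. fst v < length w \<and> w ! fst v = 0}"

lemma zvars_jet_image: "f \<in> carrier (poly_ring zvars) \<Longrightarrow> f \<in> jet_image w \<infinity>"
proof (induction rule: poly_ring_induct)
  case (var v)
  obtain i k where v: "v = (i, k)" by (cases v)
  have "pvar i \<in> carrier (inv_ring w)"
    unfolding pvar_def using var by (intro single_in_inv_ring) (auto simp: v zvars_def weight_single)
  then show ?case using jet_image_closed(2)[of "pvar i" w k \<infinity>] by (simp add: v jet_coeff_simps)
qed (auto intro: jet_image_closed)

lemma zvars_shift: "f \<in> carrier (poly_ring zvars) \<Longrightarrow> t \<noteq> 0 \<Longrightarrow> shift w t \<epsilon> f = f"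
  unfolding shift_def by (rule psubst_ident[of f zvars]) (auto simp: zvars_def)

lemma homog_zvars:
  assumes "homog w 1 0 f" "homog w (-1) 0 f" "f \<in> carrier (poly_ring ({..<length w} \<times> W))"
  shows "f \<in> carrier (poly_ring zvars)"
  unfolding poly_ring_carrier
proof (intro ballI subsetI)
  fix \<mu> v assume \<mu>: "\<mu> \<in> keys f" and v: "v \<in> keys \<mu>"
  have "v \<in> {..<length w} \<times> W" using assms(3) \<mu> v unfolding poly_ring_carrier by blast
  then have i: "fst v < length w" by auto
  then have "w ! fst v = 0" using unit[OF i] homog_0_vars[OF assms(1) \<mu> v] homog_0_vars[OF assms(2) \<mu> v] by auto
  then show "v \<in> zvars" using i by (simp add: zvars_def)
qed

lemma coeff_product_jet_image:
  assumes "i < length w" "j < length w" "w ! i = 1" "w ! j = -1"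
  shows "(\<Sum>k\<le>m. pvar (i, k) * pvar (j, m - k)) \<in> jet_image w \<infinity>"
proof -
  have "pvar i * pvar j = (single (single i 1 + single j 1) 1 :: nat cpoly)"
    by (simp add: pvar_def mult_single)
  also have "\<dots> \<in> carrier (inv_ring w)"
    using assms keys_add[of "single i 1" "single j (1::nat)"]
    by (intro single_in_inv_ring) (auto simp: weight_add weight_single)
  finally show ?thesis
    using jet_image_closed(2)[of "pvar i * pvar j" w m \<infinity>] by (simp add: jet_coeff_simps)
qed

text \<open>A polynomial of degree n in the variables of weight 1 and of degree n in those of weight
  -1 receives n slots of either kind. They are indexed by the variables S and T themselves.\<close>

definition slots :: "nat \<Rightarrow> (nat + nat) list" where
  "slots n = map Inl [0..<n] @ map Inr [0..<n]"

definition slot_weight :: "nat + nat \<Rightarrow> int" where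
  "slot_weight = case_sum (\<lambda>_. 1) (\<lambda>_. -1)"

lemma slots: "set (slots n) = Inl ` {..<n} \<union> Inr ` {..<n}" "distinct (slots n)"
  "length (filter (\<lambda>s. slot_weight s = 1) (slots n)) = n" "length (filter (\<lambda>s. slot_weight s = -1) (slots n)) = n"
proof -
  show "set (slots n) = Inl ` {..<n} \<union> Inr ` {..<n}" by (auto simp: slots_def)
  show "distinct (slots n)" by (auto simp: slots_def distinct_map)
  show "length (filter (\<lambda>s. slot_weight s = 1) (slots n)) = n" "length (filter (\<lambda>s. slot_weight s = -1) (slots n)) = n"
    by (simp_all add: slots_def slot_weight_def filter_map o_def)
qed

lemma prod_slots: "(\<Prod>s\<in>set (slots n). F s) = (\<Prod>p<n. F (Inl p)) * (\<Prod>q<n. F (Inr q))"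
  unfolding slots(1) by (subst prod.union_disjoint) (auto simp: prod.reindex)

lemma sum_slots: "(\<Sum>s\<in>set (slots n). F s) = (\<Sum>p<n. F (Inl p)) + (\<Sum>q<n. F (Inr q))"
  unfolding slots(1) by (subst sum.union_disjoint) (auto simp: sum.reindex)

lemma injections_bij: "\<sigma> \<in> injections n n \<Longrightarrow> bij_betw \<sigma> {..<n} {..<n}"
proof -
  assume \<sigma>: "\<sigma> \<in> injections n n"
  then have "\<sigma> ` {..<n} = {..<n}"
    by (intro card_subset_eq) (auto simp: injections_def card_image)
  then show ?thesis using \<sigma> by (auto simp: bij_betw_def injections_def)
qed

text \<open>The sum over one fibre of \<open>a \<mapsto> (\<lambda>q. a (Inl (\<sigma> q)) + a (Inr q))\<close> is the product of the coefficients of the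
  series \<open>x\<^sub>\<sigma>\<^sub>q y\<^sub>q\<close>.\<close>

lemma fibre_sum:
  fixes x y :: "nat \<Rightarrow> nat \<Rightarrow> 'v cpoly"
  assumes \<sigma>: "\<sigma> \<in> injections n n"
    and T: "T = {a \<in> set (slots n) \<rightarrow>\<^sub>E {..B}. (\<Sum>s\<in>set (slots n). a s) \<le> B}"
    and m: "m \<in> {..<n} \<rightarrow>\<^sub>E UNIV" "(\<Sum>q<n. m q) \<le> B"
  shows "(\<Sum>a | a \<in> T \<and> restrict (\<lambda>q. a (Inl (\<sigma> q)) + a (Inr q)) {..<n} = m.
      (\<Prod>p<n. x p (a (Inl p))) * (\<Prod>q<n. y q (a (Inr q))))
    = (\<Prod>q<n. \<Sum>k\<le>m q. x (\<sigma> q) k * y q (m q - k))"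
proof -
  have bij: "bij_betw \<sigma> {..<n} {..<n}" by (rule injections_bij[OF \<sigma>])
  define \<tau> where "\<tau> = the_inv_into {..<n} \<sigma>"
  have \<tau>: "\<sigma> (\<tau> p) = p" "\<tau> p < n" if "p < n" for p
    using bij that f_the_inv_into_f_bij_betw[of \<sigma> "{..<n}" "{..<n}" p] the_inv_into_into[of \<sigma> "{..<n}" p "{..<n}"]
    by (auto simp: \<tau>_def bij_betw_def)
  have \<sigma>q: "\<tau> (\<sigma> q) = q" "\<sigma> q < n" if "q < n" for q
    using bij that the_inv_into_f_f[of \<sigma> "{..<n}" q] by (auto simp: \<tau>_def bij_betw_def)
  let ?A = "{a. a \<in> T \<and> restrict (\<lambda>q. a (Inl (\<sigma> q)) + a (Inr q)) {..<n} = m}"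
  \<comment> \<open>A tuple in the fibre is determined by its orders b q at the slots \<sigma> q of
    the x-factors, since the order at the paired y-factor must be m q - b q.\<close>
  let ?a = "\<lambda>b. restrict (case_sum (\<lambda>p. b (\<tau> p)) (\<lambda>q. m q - b q)) (set (slots n))"
  have mem: "Inl p \<in> set (slots n) \<longleftrightarrow> p < n" "Inr p \<in> set (slots n) \<longleftrightarrow> p < n" for p
    by (auto simp: slots(1))
  have "(\<Prod>q<n. \<Sum>k\<le>m q. x (\<sigma> q) k * y q (m q - k))
      = (\<Sum>b\<in>Pi\<^sub>E {..<n} (\<lambda>q. {..m q}). \<Prod>q<n. x (\<sigma> q) (b q) * y q (m q - b q))"
    by (rule prod_sum_PiE) auto
  also have "\<dots> = (\<Sum>a\<in>?A. (\<Prod>p<n. x p (a (Inl p))) * (\<Prod>q<n. y q (a (Inr q))))"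
  proof (rule sum.reindex_bij_witness[where i = "\<lambda>a. restrict (\<lambda>q. a (Inl (\<sigma> q))) {..<n}" and j = ?a])
    fix b assume b: "b \<in> Pi\<^sub>E {..<n} (\<lambda>q. {..m q})"
    then have bm: "b q \<le> m q" if "q < n" for q using that by (auto simp: PiE_iff)
    show "restrict (\<lambda>q. ?a b (Inl (\<sigma> q))) {..<n} = b"
    proof
      fix q show "restrict (\<lambda>q. ?a b (Inl (\<sigma> q))) {..<n} q = b q"
        using b \<sigma>q[of q] by (cases "q < n") (auto simp: mem PiE_iff extensional_def)
    qed
    have total: "(\<Sum>s\<in>set (slots n). ?a b s) \<le> B"
    proof -
      have "(\<Sum>s\<in>set (slots n). ?a b s) = (\<Sum>p<n. b (\<tau> p)) + (\<Sum>q<n. m q - b q)"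
        unfolding sum_slots by (simp add: mem)
      also have "(\<Sum>p<n. b (\<tau> p)) = (\<Sum>q<n. b q)"
        using sum.reindex_bij_betw[OF bij, of "\<lambda>p. b (\<tau> p)"] \<sigma>q by simp
      also have "\<dots> + (\<Sum>q<n. m q - b q) = (\<Sum>q<n. m q)"
        using bm by (simp flip: sum.distrib)
      finally show ?thesis using m(2) by simp
    qed
    have "?a b s \<le> B" if "s \<in> set (slots n)" for s
      using member_le_sum[of s "set (slots n)" "?a b"] that total by fastforce
    then have "?a b \<in> T" unfolding T using total by (auto simp: PiE_iff)
    moreover have "restrict (\<lambda>q. ?a b (Inl (\<sigma> q)) + ?a b (Inr q)) {..<n} = m"
    proof
      fix q show "restrict (\<lambda>q. ?a b (Inl (\<sigma> q)) + ?a b (Inr q)) {..<n} q = m q"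
        using m(1) bm[of q] \<sigma>q[of q] by (cases "q < n") (auto simp: mem PiE_iff extensional_def)
    qed
    ultimately show "?a b \<in> ?A" by blast
    have "(\<Prod>p<n. x p (?a b (Inl p))) = (\<Prod>p<n. x p (b (\<tau> p)))" by (intro prod.cong) (auto simp: mem)
    also have "\<dots> = (\<Prod>q<n. x (\<sigma> q) (b q))"
      using prod.reindex_bij_betw[OF bij, of "\<lambda>p. x p (b (\<tau> p))"] \<sigma>q by simp
    finally show "(\<Prod>p<n. x p (?a b (Inl p))) * (\<Prod>q<n. y q (?a b (Inr q))) = (\<Prod>q<n. x (\<sigma> q) (b q) * y q (m q - b q))"
      by (simp add: prod.distrib mem)
  next
    fix a assume a: "a \<in> ?A"
    then have am: "a (Inl (\<sigma> q)) + a (Inr q) = m q" if "q < n" for q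
      using that by (metis (mono_tags, lifting) lessThan_iff mem_Collect_eq restrict_apply')
    have ext: "a s = undefined" if "s \<notin> set (slots n)" for s
      using a that unfolding T by (auto simp: PiE_iff extensional_def)
    show "?a (restrict (\<lambda>q. a (Inl (\<sigma> q))) {..<n}) = a"
    proof
      fix s
      show "?a (restrict (\<lambda>q. a (Inl (\<sigma> q))) {..<n}) s = a s"
      proof (cases "s \<in> set (slots n)")
        case True
        then consider p where "s = Inl p" "p < n" | q where "s = Inr q" "q < n" by (auto simp: slots(1))
        then show ?thesis
        proof cases
          case 1
          then show ?thesis using \<tau>[of p] by (simp add: mem)
        next
          case 2
          then show ?thesis using am[of q, symmetric] by (simp add: mem)
        qed
      qed (simp add: ext)
    qed
    have "a (Inl (\<sigma> q)) \<le> m q" if "q < n" for q using am[OF that] by simp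
    then show "restrict (\<lambda>q. a (Inl (\<sigma> q))) {..<n} \<in> Pi\<^sub>E {..<n} (\<lambda>q. {..m q})" by (simp add: restrict_PiE_iff)
  qed
  finally show ?thesis by simp
qed

text \<open>The derivative with orders a is read as the value of a linear map on the monomial in S
  and T with exponents a. \<open>linear_factor\<close> splits it into summands indexed by \<sigma>
  that depend on a only through the total order of each pair of slots \<sigma> q and q. Summing over
  all a with the same totals yields products of coefficients of series x_i y_j.\<close>

lemma slot_sum_jet_image:
  assumes f: "f \<in> carrier (poly_ring ({..<length w} \<times> {..K}))" "f \<in> carrier (inv_jet_ring w \<infinity>)"
    and hom: "homog w 1 n f" "homog w (-1) n f"
    and idx: "\<And>s. s \<in> set (slots n) \<Longrightarrow> idx s < length w \<and> w ! idx s = slot_weight s"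
  shows "(\<Sum>a\<in>set (slots n) \<rightarrow>\<^sub>E {..K}. (\<Prod>s\<in>set (slots n). pvar (idx s, a s)) * fold (sop 0 {} idx a) (slots n) f)
    \<in> jet_image w \<infinity>"
proof -
  let ?xs = "slots n"
  define \<Lambda> where "\<Lambda> \<nu> = fold (sop 0 {} idx (lookup \<nu>)) ?xs f" for \<nu>
  have filter: "filter (\<lambda>s. w ! idx s = t) ?xs = filter (\<lambda>s. slot_weight s = t) ?xs" for t
    using idx by (intro filter_cong) auto
  \<comment> \<open>The n derivatives of either kind use up both degrees, which leaves polynomials
    in jets of weight-zero coordinates. These lie in the image, and \<open>shift\<close> fixes
    them.\<close>
  have z: "fold (sop \<epsilon> A idx \<mu>) ?xs f \<in> carrier (poly_ring zvars)" for \<epsilon> A \<mu>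
    using hom by (intro homog_zvars[OF homog_fold homog_fold fold_sop_closed[OF f(1)]]) (simp_all add: filter slots)
  have sop0: "sop \<epsilon> {} idx \<mu> = sop 0 {} idx \<mu>" for \<epsilon> \<mu> by (simp add: sop_def fun_eq_iff)
  \<comment> \<open>The identity \<open>shift_invariant\<close> is differentiated once for every
    slot. By \<open>z\<close> the outer shift then disappears on both sides.\<close>
  have swap: "fold (sop \<epsilon> (Inl ` {..<n}) idx \<mu>) ?xs f = fold (sop \<epsilon> (Inr ` {..<n}) idx \<mu>) ?xs f" for \<epsilon> \<mu>
  proof -
    have "fold (sop 0 {} idx \<mu>) ?xs (shift w 1 \<epsilon> f) = fold (sop 0 {} idx \<mu>) ?xs (shift w (-1) \<epsilon> f)"
      using shift_invariant[OF f(2) unit] by simp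
    moreover have "s \<in> Inl ` {..<n} \<longleftrightarrow> w ! idx s = 1" "s \<in> Inr ` {..<n} \<longleftrightarrow> w ! idx s = -1" if "s \<in> set ?xs" for s
      using idx[OF that] that by (auto simp: slots(1) slot_weight_def)
    then have "fold (sop 0 {} idx \<mu>) ?xs (shift w 1 \<epsilon> f) = fold (sop \<epsilon> (Inl ` {..<n}) idx \<mu>) ?xs f"
      "fold (sop 0 {} idx \<mu>) ?xs (shift w (-1) \<epsilon> f) = fold (sop \<epsilon> (Inr ` {..<n}) idx \<mu>) ?xs f"
      using fold_pd_shift[of ?xs "Inl ` {..<n}" w idx 1 \<mu> \<epsilon> f] fold_pd_shift[of ?xs "Inr ` {..<n}" w idx "-1" \<mu> \<epsilon> f]
      by (simp_all add: zvars_shift[OF z])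
    ultimately show ?thesis by simp
  qed
  let ?L = "lin_ext \<Lambda>"
  have slot: "?L (single \<nu> 1 * (\<Prod>s\<in>A. 1 - pconst \<epsilon> * pvar s)) = fold (sop \<epsilon> A idx (lookup \<nu>)) ?xs f"
    if "A \<subseteq> set ?xs" for \<nu> \<epsilon> A
  proof -
    have "(\<lambda>\<nu>. fold (sop \<epsilon> {} idx (lookup \<nu>)) ?xs f) = \<Lambda>"
      unfolding sop0[of \<epsilon>] \<Lambda>_def[abs_def] ..
    then show ?thesis
      using lin_ext_slots[OF slots(2) finite_subset[OF that finite_set] that, of \<epsilon> idx f \<nu>] by simp
  qed
  have gen: "?L (h * (\<Prod>i<n. 1 - pconst \<epsilon> * SS i)) = ?L (h * (\<Prod>j<n. 1 - pconst \<epsilon> * TT j))" for h \<epsilon>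
  proof -
    have SS: "(\<Prod>i<n. 1 - pconst \<epsilon> * SS i) = (\<Prod>s\<in>Inl ` {..<n}. 1 - pconst \<epsilon> * pvar s)"
      and TT: "(\<Prod>i<n. 1 - pconst \<epsilon> * TT i) = (\<Prod>s\<in>Inr ` {..<n}. 1 - pconst \<epsilon> * pvar s)"
      by (simp_all add: prod.reindex)
    have mono: "?L (single \<nu> 1 * (\<Prod>i<n. 1 - pconst \<epsilon> * SS i)) = ?L (single \<nu> 1 * (\<Prod>j<n. 1 - pconst \<epsilon> * TT j))" for \<nu>
      unfolding SS TT by (subst (1 2) slot) (auto simp: slots(1) swap)
    have sum: "?L (sum F A) = (\<Sum>x\<in>A. ?L (F x))" for F and A :: "(nat + nat \<Rightarrow>\<^sub>0 nat) set"
      by (induction A rule: infinite_finite_induct) (simp_all add: lin_ext_simps)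
    have ex: "h * P = (\<Sum>\<mu>\<in>keys h. pconst (lookup h \<mu>) * (single \<mu> 1 * P))" for P
      by (subst cpoly_expand[of h]) (simp add: sum_distrib_right mult.assoc)
    show ?thesis unfolding ex sum lin_ext_simps(2) mono ..
  qed
  obtain c where c: "\<And>\<sigma> p. c \<sigma> p \<in> range ?L" "\<And>g. g \<in> sub_ring n \<Longrightarrow> ?L g = (\<Sum>\<sigma>\<in>injections n n. c \<sigma> (spec \<sigma> g))"
    using linear_factor[OF lin_ext_simps(1) lin_ext_simps(2) gen] by blast
  have cA: "c \<sigma> p \<in> jet_image w \<infinity>" for \<sigma> p
  proof -
    obtain g where "c \<sigma> p = ?L g" using c(1) by blast
    moreover have "?L g \<in> jet_image w \<infinity>"
      unfolding lin_ext_def \<Lambda>_def by (intro jet_image_sum_closed jet_image_closed(4) jet_image_closed(1) zvars_jet_image z)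
    ultimately show ?thesis by simp
  qed
  \<comment> \<open>A coefficient of x_i(t) y_j(t) needs all pairs of orders with a given sum, but
    the box \<open>{..K}\<close> cuts such a fibre off. T bounds only the total order, by the
    maximum B over the box, and contains complete fibres for every \<sigma>; the added derivatives
    vanish because f has no variables of order above K.\<close>
  define B where "B = 2 * n * K"
  define T where "T = {a \<in> set ?xs \<rightarrow>\<^sub>E {..B}. (\<Sum>s\<in>set ?xs. a s) \<le> B}"
  have finT: "finite T" unfolding T_def by (rule finite_subset[of _ "set ?xs \<rightarrow>\<^sub>E {..B}"]) (auto intro: finite_PiE)
  define F where "F a = (\<Prod>s\<in>set ?xs. pvar (idx s, a s))" for a :: "nat + nat \<Rightarrow> nat"
  define D where "D a = fold (sop 0 {} idx a) ?xs f" for a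
  define mm where "mm \<sigma> a = restrict (\<lambda>q. a (Inl (\<sigma> q)) + a (Inr q)) {..<n}" for \<sigma> :: "nat \<Rightarrow> nat" and a :: "nat + nat \<Rightarrow> nat"
  define M where "M \<sigma> m = (\<Prod>q<n. pvar (\<sigma> q) ^ m q)" for \<sigma> m :: "nat \<Rightarrow> nat"
  have D: "D a = (\<Sum>\<sigma>\<in>injections n n. c \<sigma> (M \<sigma> (mm \<sigma> a)))" for a
  proof -
    define \<nu> where "\<nu> = (\<Sum>s\<in>set ?xs. single s (a s))"
    have lk: "lookup \<nu> s = a s" if "s \<in> set ?xs" for s
      using that by (simp add: \<nu>_def lookup_sum lookup_single when_def)
    have mon: "single (\<Sum>s\<in>A. single s (a s)) 1 = (\<Prod>s\<in>A. pvar s ^ a s)" if "finite A" for A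
      using that
    proof (induction A)
      case (insert x A)
      show ?case
        unfolding sum.insert[OF insert.hyps] prod.insert[OF insert.hyps] insert.IH[symmetric]
        unfolding pvar_power mult_single by simp
    qed simp
    have \<nu>: "single \<nu> 1 = (\<Prod>p<n. SS p ^ a (Inl p)) * (\<Prod>q<n. TT q ^ a (Inr q))"
      unfolding \<nu>_def mon[OF finite_set] prod_slots ..
    have "D a = \<Lambda> \<nu>" unfolding D_def \<Lambda>_def
      by (rule List.fold_cong) (auto simp: sop_def fun_eq_iff lk)
    also have "\<dots> = ?L (single \<nu> 1)" by (simp add: lin_ext_simps)
    also have "\<dots> = (\<Sum>\<sigma>\<in>injections n n. c \<sigma> (spec \<sigma> (single \<nu> 1)))"
    proof (rule c(2))
      have "(\<Prod>p<n. SS p ^ a (Inl p)) \<in> sub_ring n" "(\<Prod>q<n. TT q ^ a (Inr q)) \<in> sub_ring n"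
        unfolding sub_ring_def by (intro poly_ring_prod_closed poly_ring_power_closed poly_ring_closed(2); simp)+
      then show "single \<nu> 1 \<in> sub_ring n" unfolding \<nu> by (rule sub_ring_closed)
    qed
    also have "\<dots> = (\<Sum>\<sigma>\<in>injections n n. c \<sigma> (M \<sigma> (mm \<sigma> a)))"
    proof (intro sum.cong refl arg_cong2[where f = c])
      fix \<sigma> assume \<sigma>: "\<sigma> \<in> injections n n"
      have "spec \<sigma> (single \<nu> 1) = (\<Prod>p<n. pvar p ^ a (Inl p)) * (\<Prod>q<n. pvar (\<sigma> q) ^ a (Inr q))"
        unfolding \<nu> spec_def by (simp add: psubst_hom_simps[OF pconst_hom] psubst_prod[OF pconst_hom] psubst_power[OF pconst_hom])
      also have "(\<Prod>p<n. pvar p ^ a (Inl p)) = (\<Prod>q<n. pvar (\<sigma> q) ^ a (Inl (\<sigma> q)))"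
        using prod.reindex_bij_betw[OF injections_bij[OF \<sigma>], of "\<lambda>p. pvar p ^ a (Inl p)"] by simp
      finally show "spec \<sigma> (single \<nu> 1) = M \<sigma> (mm \<sigma> a)"
        by (simp add: M_def mm_def power_add prod.distrib)
    qed
    finally show ?thesis .
  qed
  have "(\<Sum>a\<in>set ?xs \<rightarrow>\<^sub>E {..K}. F a * D a) = (\<Sum>a\<in>T. F a * D a)"
  proof (rule sum.mono_neutral_left[OF finT])
    have card: "card (set ?xs) = 2 * n" using distinct_card[OF slots(2), of n] by (simp add: slots_def)
    show "(set ?xs \<rightarrow>\<^sub>E {..K}) \<subseteq> T"
    proof
      fix a assume a: "a \<in> set ?xs \<rightarrow>\<^sub>E {..K}"
      have total: "(\<Sum>s\<in>set ?xs. a s) \<le> B"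
        using sum_bounded_above[of "set ?xs" a K] a by (auto simp: B_def card PiE_iff)
      have "a s \<le> B" if "s \<in> set ?xs" for s using member_le_sum[of s "set ?xs" a] that total by fastforce
      then show "a \<in> T" using a total by (auto simp: T_def PiE_iff)
    qed
    show "\<forall>a\<in>T - (set ?xs \<rightarrow>\<^sub>E {..K}). F a * D a = 0"
    proof
      fix a assume "a \<in> T - (set ?xs \<rightarrow>\<^sub>E {..K})"
      then obtain s where s: "s \<in> set ?xs" "a s > K" by (auto simp: T_def PiE_iff not_le)
      have "fold (sop 0 {} idx a) ys g = 0" if "s \<in> set ys" "g \<in> carrier (poly_ring ({..<length w} \<times> {..K}))" for ys g
        using that
      proof (induction ys arbitrary: g)
        case (Cons y ys)
        have zero: "fold (sop 0 {} idx a) zs 0 = 0" for zs by (induction zs) (simp_all add: sop_def)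
        show ?case
        proof (cases "y = s")
          case True
          then have "sop 0 {} idx a y g = 0" using pd_eq_0[OF Cons.prems(2), of "(idx s, a s)"] s(2) by (simp add: sop_def)
          then show ?thesis by (simp add: zero)
        next
          case False
          then show ?thesis using Cons pd_closed[OF Cons.prems(2)] by (simp add: sop_def)
        qed
      qed simp
      then have "D a = 0" unfolding D_def using s(1) f(1) by blast
      then show "F a * D a = 0" by simp
    qed
  qed
  also have "\<dots> = (\<Sum>\<sigma>\<in>injections n n. \<Sum>a\<in>T. c \<sigma> (M \<sigma> (mm \<sigma> a)) * F a)"
    unfolding D sum_distrib_left by (subst sum.swap) (simp add: mult.commute)
  \<comment> \<open>Along a fibre of \<open>mm \<sigma>\<close> the factor c is constant, and
    \<open>fibre_sum\<close> evaluates the remaining sum.\<close>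
  also have "\<dots> = (\<Sum>\<sigma>\<in>injections n n. \<Sum>m\<in>mm \<sigma> ` T. c \<sigma> (M \<sigma> m) * (\<Sum>a | a \<in> T \<and> mm \<sigma> a = m. F a))"
  proof (intro sum.cong refl)
    fix \<sigma>
    show "(\<Sum>a\<in>T. c \<sigma> (M \<sigma> (mm \<sigma> a)) * F a) = (\<Sum>m\<in>mm \<sigma> ` T. c \<sigma> (M \<sigma> m) * (\<Sum>a | a \<in> T \<and> mm \<sigma> a = m. F a))"
      unfolding sum.image_gen[OF finT, of _ "mm \<sigma>"] sum_distrib_left by (intro sum.cong refl) auto
  qed
  also have "\<dots> \<in> jet_image w \<infinity>"
  proof (rule jet_image_sum_closed, rule jet_image_sum_closed, rule jet_image_closed(4)[OF cA])
    fix \<sigma> m assume \<sigma>: "\<sigma> \<in> injections n n" and "m \<in> mm \<sigma> ` T"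
    then obtain a0 where a0: "a0 \<in> T" "m = mm \<sigma> a0" by blast
    have "(\<Sum>q<n. m q) = (\<Sum>q<n. a0 (Inl (\<sigma> q))) + (\<Sum>q<n. a0 (Inr q))"
      by (simp add: a0(2) mm_def sum.distrib)
    also have "(\<Sum>q<n. a0 (Inl (\<sigma> q))) = (\<Sum>p<n. a0 (Inl p))"
      by (rule sum.reindex_bij_betw[OF injections_bij[OF \<sigma>]])
    finally have "(\<Sum>q<n. m q) \<le> B" using a0(1) unfolding T_def sum_slots by simp
    then have "(\<Sum>a | a \<in> T \<and> mm \<sigma> a = m. F a) =
        (\<Prod>q<n. \<Sum>k\<le>m q. pvar (idx (Inl (\<sigma> q)), k) * pvar (idx (Inr q), m q - k))"
      using fibre_sum[OF \<sigma> T_def, of m "\<lambda>p k. pvar (idx (Inl p), k)" "\<lambda>q k. pvar (idx (Inr q), k)"] a0(2)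
      unfolding F_def prod_slots mm_def by simp
    also have "\<dots> \<in> jet_image w \<infinity>"
    proof (intro jet_image_prod_closed coeff_product_jet_image)
      fix q assume q: "q \<in> {..<n}"
      then have "\<sigma> q < n" using \<sigma> by (auto simp: injections_def)
      then show "idx (Inl (\<sigma> q)) < length w" "w ! idx (Inl (\<sigma> q)) = 1" "idx (Inr q) < length w" "w ! idx (Inr q) = -1"
        using idx[of "Inl (\<sigma> q)"] idx[of "Inr q"] q by (auto simp: slots(1) slot_weight_def)
    qed
    finally show "(\<Sum>a | a \<in> T \<and> mm \<sigma> a = m. F a) \<in> jet_image w \<infinity>" .
  qed
  finally show ?thesis unfolding F_def D_def .
qed

text \<open>A bound on the jet orders that occur makes the expansion \<open>taylor\<close> finite;
  the positive integer \<open>slot_const\<close> is divided out at the end.\<close>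

lemma homogeneous_jet_image:
  assumes f: "f \<in> carrier (inv_jet_ring w \<infinity>)" and hom: "homog w 1 n f" "homog w (-1) n f"
  shows "f \<in> jet_image w \<infinity>"
proof -
  obtain W where W: "finite W" "f \<in> carrier (poly_ring W)" using poly_ring_finite_vars by blast
  define K where "K = Max (insert 0 (snd ` W))"
  have fK: "f \<in> carrier (poly_ring ({..<length w} \<times> {..K}))"
    unfolding poly_ring_carrier
  proof (intro ballI subsetI)
    fix \<mu> v assume \<mu>: "\<mu> \<in> keys f" "v \<in> keys \<mu>"
    have "v \<in> W" using W(2) \<mu> unfolding poly_ring_carrier by blast
    then have "snd v \<le> K" unfolding K_def using W(1) by (intro Max_ge) auto
    moreover have "v \<in> {..<length w} \<times> UNIV"
      using f \<mu> unfolding inv_jet_ring_iff coord_jet_ring_def poly_ring_carrier by auto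
    ultimately show "v \<in> {..<length w} \<times> {..K}" by (cases v) auto
  qed
  let ?c = "of_nat (slot_const slot_weight (slots n)) :: complex"
  have "pconst ?c * f \<in> jet_image w \<infinity>"
  proof (subst taylor[OF fK _ slots(2)])
    fix t assume "t \<in> slot_weight ` set (slots n)"
    then have "t = 1 \<or> t = -1" by (auto simp: slot_weight_def split: sum.splits)
    then show "homog w t (length (filter (\<lambda>s. slot_weight s = t) (slots n))) f" using hom by (auto simp: slots)
  next
    show "(\<Sum>idx\<in>Pi\<^sub>E (set (slots n)) (\<lambda>s. {i. i < length w \<and> w ! i = slot_weight s}).
        \<Sum>a\<in>set (slots n) \<rightarrow>\<^sub>E {..K}. (\<Prod>s\<in>set (slots n). pvar (idx s, a s)) * fold (sop 0 {} idx a) (slots n) f) \<in> jet_image w \<infinity>"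
      by (intro jet_image_sum_closed slot_sum_jet_image[OF fK f hom]) (auto simp: PiE_iff)
  qed
  then have mem: "pconst (1 / ?c) * (pconst ?c * f) \<in> jet_image w \<infinity>" by (rule jet_image_closed(4)[OF jet_image_closed(1)])
  have "?c \<noteq> 0" using slot_const_pos[of slot_weight "slots n"] by simp
  then have "1 / ?c * ?c = 1" by simp
  then have "pconst (1 / ?c) * (pconst ?c * f) = f"
    by (simp only: mult.assoc[symmetric] pconst_simps(4)[symmetric] pconst_simps(2) mult_1_left)
  then show ?thesis using mem by (simp only:)
qed

section \<open>Bihomogeneous components of an invariant\<close>

definition rescale :: "complex \<Rightarrow> complex \<Rightarrow> (nat \<times> nat) cpoly \<Rightarrow> (nat \<times> nat) cpoly" where
  "rescale a b = psubst pconst (\<lambda>v. pconst (if w ! fst v = 1 then a else if w ! fst v = -1 then b else 1) * pvar v)"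

lemma lookup_rescale: "lookup (rescale a b f) \<mu> = a ^ tdeg w 1 \<mu> * b ^ tdeg w (-1) \<mu> * lookup f \<mu>"
proof -
  let ?r = "\<lambda>v. if w ! fst v = 1 then a else if w ! fst v = -1 then b else 1"
  have single: "rescale a b (single \<nu> c) = single \<nu> (a ^ tdeg w 1 \<nu> * b ^ tdeg w (-1) \<nu> * c)" for \<nu> c
  proof -
    have "psubst pconst pvar (single \<nu> 1) = single \<nu> 1" by (rule psubst_pvar_id)
    then have mon: "(\<Prod>v\<in>keys \<nu>. pvar v ^ lookup \<nu> v) = single \<nu> 1"
      by (simp add: psubst_single[OF pconst_hom] pconst_simps)
    have "(\<Prod>v\<in>keys \<nu>. ?r v ^ lookup \<nu> v) = (\<Prod>v\<in>keys \<nu>.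
        a ^ (if w ! fst v = 1 then lookup \<nu> v else 0) * b ^ (if w ! fst v = -1 then lookup \<nu> v else 0))"
      by (intro prod.cong) auto
    then have "(\<Prod>v\<in>keys \<nu>. ?r v ^ lookup \<nu> v) = a ^ tdeg w 1 \<nu> * b ^ tdeg w (-1) \<nu>"
      unfolding tdeg_def by (simp only: prod.distrib power_sum)
    moreover have "(\<Prod>v\<in>A. pconst (r v) ^ k v) = (pconst :: _ \<Rightarrow> (nat \<times> nat) cpoly) (\<Prod>v\<in>A. r v ^ k v)" for A k and r :: "nat \<times> nat \<Rightarrow> complex"
      by (induction A rule: infinite_finite_induct) (simp_all add: pconst_simps)
    ultimately have "(\<Prod>v\<in>keys \<nu>. pconst (?r v) ^ lookup \<nu> v) = (pconst :: _ \<Rightarrow> (nat \<times> nat) cpoly) (a ^ tdeg w 1 \<nu> * b ^ tdeg w (-1) \<nu>)"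
      by (simp only:)
    then show ?thesis
      unfolding rescale_def psubst_single[OF pconst_hom] power_mult_distrib prod.distrib mon
      by (simp only: pconst_mult_single) (simp add: pconst_def mult_single mult_ac)
  qed
  have "rescale a b f = (\<Sum>\<nu>\<in>keys f. rescale a b (single \<nu> (lookup f \<nu>)))"
    by (subst poly_mapping_sum_single[of f]) (simp add: rescale_def psubst_sum[OF pconst_hom])
  then show ?thesis by (simp add: single lookup_sum lookup_single when_def in_keys_iff)
qed

lemma peval_rescale: "peval v (rescale a b f) = peval (\<lambda>u. (if w ! fst u = 1 then a else if w ! fst u = -1 then b else 1) * v u) f"
  unfolding rescale_def psubst_psubst[OF id_hom] by (simp add: psubst_hom_simps[OF id_hom])

text \<open>The two-parameter torus acts on whole coordinate series by constants and therefore
  commutes with the jet group.\<close>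

lemma rescale_invariant:
  assumes f: "f \<in> carrier (inv_jet_ring w m)"
  shows "rescale a b f \<in> carrier (inv_jet_ring w m)"
  unfolding inv_jet_ring_iff
proof (intro conjI ballI allI)
  show "rescale a b f \<in> carrier (coord_jet_ring w m)"
    using f unfolding rescale_def inv_jet_ring_iff coord_jet_ring_def
    by (auto intro!: psubst_closed[of f "{..<length w} \<times> {k. enat k \<le> m}"] poly_ring_closed)
  fix \<gamma> v assume \<gamma>: "\<gamma> \<in> jet_group m"
  let ?r = "\<lambda>u. if w ! fst u = 1 then a else if w ! fst u = -1 then b else 1"
  have "(\<lambda>u. ?r u * jet_act w \<gamma> v u) = jet_act w \<gamma> (\<lambda>u. ?r u * v u)"
  proof
    fix u :: "nat \<times> nat"
    obtain i k where u: "u = (i, k)" by (cases u)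
    define r where "r = (if w ! i = 1 then a else if w ! i = -1 then b else 1)"
    have r: "?r (i, j) = r" for j by (simp add: r_def)
    have "Abs_fps (\<lambda>j. r * v (i, j)) = fps_const r * Abs_fps (\<lambda>j. v (i, j))" by (rule fps_ext) simp
    then show "?r u * jet_act w \<gamma> v u = jet_act w \<gamma> (\<lambda>u. ?r u * v u) u"
      unfolding u jet_act_def prod.case r by (simp add: mult.left_commute[of _ "fps_const r"])
  qed
  then show "peval (jet_act w \<gamma> v) (rescale a b f) = peval v (rescale a b f)"
    using f \<gamma> by (simp add: peval_rescale inv_jet_ring_iff)
qed

text \<open>The constant series 2 acts as the rescaling by 2 and 1/2, and 2 is not a root of
  unity.\<close>

lemma tdeg_eq:
  assumes f: "f \<in> carrier (inv_jet_ring w m)" and \<mu>: "\<mu> \<in> keys f"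
  shows "tdeg w 1 \<mu> = tdeg w (-1) \<mu>"
proof -
  have "rescale 2 (1 / 2) f = f"
  proof (rule peval_nonzero_eqI)
    fix v :: "nat \<times> nat \<Rightarrow> complex"
    have act: "(if w ! i = 1 then 2 else if w ! i = -1 then 1 / 2 else 1) * v (i, k) = jet_act w (fps_const 2) v (i, k)" if "i < length w" for i k
      using unit[OF that] by (auto simp: jet_act_def power_int_def fps_const_inverse)
    have "peval v (rescale 2 (1 / 2) f) = peval (jet_act w (fps_const 2) v) f"
      unfolding peval_rescale
    proof (rule psubst_cong)
      show "f \<in> carrier (poly_ring ({..<length w} \<times> {k. enat k \<le> m}))"
        using f by (simp add: inv_jet_ring_iff coord_jet_ring_def)
      fix u assume "u \<in> {..<length w} \<times> {k. enat k \<le> m}"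
      then show "(if w ! fst u = 1 then 2 else if w ! fst u = -1 then 1 / 2 else 1) * v u = jet_act w (fps_const 2) v u"
        using act[of "fst u" "snd u"] by auto
    qed
    also have "\<dots> = peval v f" by (rule inv_jet_ring_unit[OF f]) simp
    finally show "peval v (rescale 2 (1 / 2) f) = peval v f" .
  qed
  then have "2 ^ tdeg w 1 \<mu> * (1 / 2) ^ tdeg w (-1) \<mu> = (1::complex)"
    using lookup_rescale[of 2 "1/2" f \<mu>] \<mu> by (simp add: in_keys_iff)
  then have "(2::complex) ^ tdeg w 1 \<mu> = 2 ^ tdeg w (-1) \<mu>" by (simp add: power_one_over field_simps)
  then have "norm ((2::complex) ^ tdeg w 1 \<mu>) = norm ((2::complex) ^ tdeg w (-1) \<mu>)" by simp
  then have "(2::real) ^ tdeg w 1 \<mu> = 2 ^ tdeg w (-1) \<mu>" by (simp only: norm_power norm_numeral)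
  then show ?thesis by simp
qed

text \<open>\<open>subspace_coeffs\<close>, applied to the rescalings of f in the coordinates of
  weight -1, shows that the components of f by degree in these coordinates are invariant. By
  \<open>tdeg_eq\<close> they have the same degree in the coordinates of weight 1.\<close>

theorem jet_image_unit_weights: "jet_image w \<infinity> = carrier (inv_jet_ring w \<infinity>)"
proof
  show "carrier (inv_jet_ring w \<infinity>) \<subseteq> jet_image w \<infinity>"
  proof
    fix f assume f: "f \<in> carrier (inv_jet_ring w \<infinity>)"
    define N where "N = Max (insert 0 (tdeg w (-1) ` keys f))"
    define comp where "comp q = (\<Sum>\<mu>\<in>keys f. single \<mu> (if tdeg w (-1) \<mu> = q then lookup f \<mu> else 0))" for q
    have lk: "lookup (comp q) \<mu> = (if tdeg w (-1) \<mu> = q then lookup f \<mu> else 0)" for q \<mu>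
      unfolding comp_def by (simp add: lookup_sum lookup_single when_def in_keys_iff)
    have N: "tdeg w (-1) \<mu> \<le> N" if "\<mu> \<in> keys f" for \<mu>
      unfolding N_def using that by (intro Max_ge) auto
    have sum: "(\<Sum>q\<le>N. pconst (b ^ q) * comp q) = rescale 1 b f" for b
    proof (rule poly_mapping_eqI)
      fix \<mu>
      have "lookup (\<Sum>q\<le>N. pconst (b ^ q) * comp q) \<mu>
          = (\<Sum>q\<le>N. if q = tdeg w (-1) \<mu> then b ^ tdeg w (-1) \<mu> * lookup f \<mu> else 0)"
        unfolding lookup_sum pconst_mult_lookup lk by (intro sum.cong) auto
      then show "lookup (\<Sum>q\<le>N. pconst (b ^ q) * comp q) \<mu> = lookup (rescale 1 b f) \<mu>"
        using N[of \<mu>] by (auto simp: lookup_rescale in_keys_iff)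
    qed
    have "comp q \<in> carrier (inv_jet_ring w \<infinity>)" if "q \<le> N" for q
    proof (rule subspace_coeffs[OF _ _ _ that])
      fix b show "(\<Sum>q\<le>N. pconst (b ^ q) * comp q) \<in> carrier (inv_jet_ring w \<infinity>)"
        unfolding sum by (rule rescale_invariant[OF f])
    qed (auto intro: inv_jet_ring_closed)
    moreover have "homog w (-1) q (comp q)" "homog w 1 q (comp q)" for q
      using tdeg_eq[OF f] by (auto simp: homog_def in_keys_iff lk split: if_splits)
    ultimately have "comp q \<in> jet_image w \<infinity>" if "q \<le> N" for q
      using that homogeneous_jet_image by blast
    then have "(\<Sum>q\<le>N. pconst (1 ^ q) * comp q) \<in> jet_image w \<infinity>"
      by (intro jet_image_sum_closed jet_image_closed(4) jet_image_closed(1)) auto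
    also have "(\<Sum>q\<le>N. pconst (1 ^ q) * comp q) = f"
      unfolding sum by (rule poly_mapping_eqI) (simp add: lookup_rescale)
    finally show "f \<in> jet_image w \<infinity>" .
  qed
qed (rule jet_image_subset)

end

section \<open>The classification\<close>

lemma surjective_imp:
  assumes surj: "jet_image w \<infinity> = carrier (inv_jet_ring w \<infinity>)"
    and p: "p < length w" "w ! p > 0" and q: "q < length w" "w ! q < 0"
    and gcd: "\<And>d. (\<And>i. i < length w \<Longrightarrow> d dvd w ! i) \<Longrightarrow> d dvd 1"
  shows "(\<exists>a<length w. \<bar>w ! a\<bar> = 1 \<and> (\<forall>i<length w. i \<noteq> a \<longrightarrow> w ! i * w ! a \<le> 0)) \<or> (\<forall>i<length w. w ! i \<in> {-1, 0, 1})"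
proof -
  have opp: "i \<noteq> j" if "w ! i * w ! j < 0" for i j using that by (auto simp: mult_less_0_iff)
  have ratio: "int (nat (\<bar>w ! j\<bar> div g)) * w ! i + int (nat (\<bar>w ! i\<bar> div g)) * w ! j = 0"
    if neg: "w ! i * w ! j < 0" and g: "g dvd w ! i" "g dvd w ! j" "g > 0" for i j g
  proof -
    obtain a b where ab: "w ! i = g * a" "w ! j = g * b" using g(1,2) by (auto elim!: dvdE)
    have "a * b < 0" using neg g(3) unfolding ab by (auto simp: mult_less_0_iff zero_less_mult_iff)
    then show ?thesis using g(3) by (auto simp: ab abs_mult mult_less_0_iff algebra_simps)
  qed
  \<comment> \<open>Dividing by the gcd gives coprime exponents of an invariant monomial; both are
    at least 2 if neither weight divides the other.\<close>
  have comparable: "w ! i dvd w ! j \<or> w ! j dvd w ! i"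
    if ij: "i < length w" "j < length w" "w ! i * w ! j < 0" for i j
  proof (rule ccontr)
    assume nd: "\<not> (w ! i dvd w ! j \<or> w ! j dvd w ! i)"
    define g where "g = gcd (w ! i) (w ! j)"
    have g: "g > 0" "g dvd w ! i" "g dvd w ! j" using ij(3) by (auto simp: g_def)
    define \<alpha> where "\<alpha> = nat (\<bar>w ! j\<bar> div g)" define \<beta> where "\<beta> = nat (\<bar>w ! i\<bar> div g)"
    have ge: "x div g \<ge> 0" if "x \<ge> 0" for x using g(1) that by (simp add: pos_imp_zdiv_nonneg_iff)
    have eqs: "\<bar>w ! j\<bar> = g * int \<alpha>" "\<bar>w ! i\<bar> = g * int \<beta>" using g ge by (simp_all add: \<alpha>_def \<beta>_def)
    have "coprime (\<bar>w ! i\<bar> div g) (\<bar>w ! j\<bar> div g)"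
    proof -
      have "w ! i \<noteq> 0" using ij(3) by auto
      then show ?thesis using div_gcd_coprime[of "\<bar>w ! i\<bar>" "\<bar>w ! j\<bar>"] by (simp add: g_def)
    qed
    then have cop: "coprime \<alpha> \<beta>"
      using ge by (simp add: \<alpha>_def \<beta>_def coprime_int_iff[symmetric] coprime_commute del: coprime_int_iff)
    have "w ! i \<noteq> 0" "w ! j \<noteq> 0" using ij(3) by auto
    then have "g * int \<alpha> \<noteq> 0" "g * int \<beta> \<noteq> 0" unfolding eqs[symmetric] by simp_all
    then have "\<alpha> \<noteq> 0" "\<beta> \<noteq> 0" by simp_all
    moreover have "\<alpha> \<noteq> 1"
    proof
      assume "\<alpha> = 1"
      then have "\<bar>w ! j\<bar> dvd \<bar>w ! i\<bar>" using eqs g by simp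
      then show False using nd by simp
    qed
    moreover have "\<beta> \<noteq> 1"
    proof
      assume "\<beta> = 1"
      then have "\<bar>w ! i\<bar> dvd \<bar>w ! j\<bar>" using eqs g by simp
      then show False using nd by simp
    qed
    ultimately have "\<alpha> \<ge> 2" "\<beta> \<ge> 2" by linarith+
    then show False
      using not_surjective_coprime[OF ij(1,2) opp[OF ij(3)] _ _ cop _ \<open>w ! j \<noteq> 0\<close>]
        ratio[OF ij(3) g(2,3,1)] surj unfolding \<alpha>_def \<beta>_def by blast
  qed
  \<comment> \<open>Otherwise i and j give u, with exponent 1 at j, while i' and j give v, one of
    whose exponents is 1 by \<open>comparable\<close>. This is the situation of
    \<open>not_surjective_three\<close>.\<close>
  have unique: "i' = i"
    if ij: "i < length w" "j < length w" "w ! i * w ! j < 0" "w ! i dvd w ! j" "\<bar>w ! i\<bar> \<noteq> \<bar>w ! j\<bar>"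
      and i': "i' < length w" "w ! i' * w ! i > 0" for i j i'
  proof (rule ccontr)
    assume ne: "i' \<noteq> i"
    have s: "w ! i' * w ! j < 0" using ij(3) i'(2) by (auto simp: mult_less_0_iff zero_less_mult_iff)
    have nz: "w ! i \<noteq> 0" "w ! j \<noteq> 0" "w ! i' \<noteq> 0" using ij(3) i'(2) by auto
    define \<alpha> where "\<alpha> = nat (\<bar>w ! j\<bar> div \<bar>w ! i\<bar>)"
    have \<alpha>i: "int \<alpha> = \<bar>w ! j\<bar> div \<bar>w ! i\<bar>" using nz by (simp add: \<alpha>_def pos_imp_zdiv_nonneg_iff)
    have eq: "\<bar>w ! j\<bar> = \<bar>w ! i\<bar> * int \<alpha>" using ij(4) by (simp add: \<alpha>i)
    have "\<bar>w ! i\<bar> * int \<alpha> \<noteq> 0" unfolding eq[symmetric] using nz by simp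
    then have "\<alpha> \<noteq> 0" by auto
    moreover have "\<alpha> \<noteq> 1"
    proof
      assume "\<alpha> = 1"
      then show False using eq ij(5) by simp
    qed
    ultimately have "\<alpha> \<noteq> 0" "\<alpha> \<noteq> 1" by simp_all
    then have \<alpha>: "\<alpha> \<ge> 2" by linarith
    have u: "int \<alpha> * w ! i + w ! j = 0"
      using ratio[OF ij(3), of "\<bar>w ! i\<bar>"] ij(4) nz by (simp add: \<alpha>_def)
    have "w ! i' dvd w ! j \<or> w ! j dvd w ! i'" by (rule comparable) (use i' ij s in auto)
    then obtain \<alpha>2 \<beta>2 where v: "\<alpha>2 \<ge> 1" "\<beta>2 \<ge> 1" "\<alpha>2 = 1 \<or> \<beta>2 = 1" "int \<alpha>2 * w ! i' + int \<beta>2 * w ! j = 0"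
    proof
      assume d: "w ! i' dvd w ! j"
      define \<alpha>2 where "\<alpha>2 = nat (\<bar>w ! j\<bar> div \<bar>w ! i'\<bar>)"
      have eq: "int \<alpha>2 * w ! i' + int 1 * w ! j = 0"
        using ratio[OF s, of "\<bar>w ! i'\<bar>"] d nz by (simp add: \<alpha>2_def)
      have "\<alpha>2 \<noteq> 0"
      proof
        assume "\<alpha>2 = 0"
        then show False using eq nz by simp
      qed
      then show thesis using that[of \<alpha>2 1] eq by simp
    next
      assume d: "w ! j dvd w ! i'"
      define \<beta>2 where "\<beta>2 = nat (\<bar>w ! i'\<bar> div \<bar>w ! j\<bar>)"
      have eq: "int 1 * w ! i' + int \<beta>2 * w ! j = 0"
        using ratio[OF s, of "\<bar>w ! j\<bar>"] d nz by (simp add: \<beta>2_def)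
      have "\<beta>2 \<noteq> 0"
      proof
        assume "\<beta>2 = 0"
        then show False using eq nz by simp
      qed
      then show thesis using that[of 1 \<beta>2] eq by simp
    qed
    have "jet_image w \<infinity> \<noteq> carrier (inv_jet_ring w \<infinity>)"
      by (rule not_surjective_three[of i w i' j \<alpha> \<alpha>2 \<beta>2])
        (use ij i' ne \<alpha> u v nz opp[OF ij(3)] opp[OF s] in auto)
    then show False using surj by simp
  qed
  show ?thesis
  proof (rule ccontr)
    assume no: "\<not> ?thesis"
    \<comment> \<open>If opposite weights always had equal absolute values, all nonzero weights
      would be plus or minus one number, which the gcd condition makes 1.\<close>
    have "\<exists>i j. i < length w \<and> j < length w \<and> w ! i * w ! j < 0 \<and> \<bar>w ! i\<bar> \<noteq> \<bar>w ! j\<bar>"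
    proof (rule ccontr)
      assume "\<not> ?thesis"
      then have eq: "\<bar>w ! i\<bar> = \<bar>w ! j\<bar>" if "i < length w" "j < length w" "w ! i * w ! j < 0" for i j using that by blast
      have pq: "\<bar>w ! p\<bar> = \<bar>w ! q\<bar>" using p q by (intro eq) (auto simp: mult_less_0_iff)
      have val: "w ! i = 0 \<or> \<bar>w ! i\<bar> = w ! p" if "i < length w" for i
      proof -
        consider "w ! i = 0" | "w ! i > 0" | "w ! i < 0" by linarith
        then show ?thesis
        proof cases
          case 2
          then have "\<bar>w ! i\<bar> = \<bar>w ! q\<bar>" using that q by (intro eq) (auto simp: mult_less_0_iff)
          then show ?thesis using pq p by simp
        next
          case 3
          then have "\<bar>w ! p\<bar> = \<bar>w ! i\<bar>" using that p by (intro eq) (auto simp: mult_less_0_iff)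
          then show ?thesis using p by simp
        qed simp
      qed
      have "w ! p dvd w ! i" if "i < length w" for i using val[OF that] by (metis dvd_0_right dvd_abs_iff dvd_refl)
      then have "w ! p dvd 1" by (rule gcd)
      then have "w ! p = 1" using p by simp
      then have "w ! i \<in> {-1, 0, 1}" if "i < length w" for i using val[OF that] by auto
      then show False using no by blast
    qed
    then obtain a b where ab: "a < length w" "b < length w" "w ! a * w ! b < 0" "w ! a dvd w ! b" "\<bar>w ! a\<bar> \<noteq> \<bar>w ! b\<bar>"
      using comparable by (metis mult.commute)
    note ua = unique[OF ab]
    have "\<bar>w ! a\<bar> \<noteq> 1"
    proof
      assume "\<bar>w ! a\<bar> = 1"
      moreover have "\<forall>i<length w. i \<noteq> a \<longrightarrow> w ! i * w ! a \<le> 0" using ua by (meson not_le)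
      ultimately show False using no ab(1) by blast
    qed
    then have "\<not> w ! a dvd 1" by simp
    \<comment> \<open>As a is alone of its sign, b' has the opposite sign, and its weight properly
      divides w ! a. Hence b' is alone of its sign as well, contrary to b, whose weight has that
      sign and is divisible by w ! a.\<close>
    then obtain b' where b': "b' < length w" "\<not> w ! a dvd w ! b'" using gcd by blast
    have nz: "w ! a \<noteq> 0" "w ! b \<noteq> 0" using ab(3) by auto
    have "\<not> w ! b' * w ! a > 0" using ua[OF b'(1)] b'(2) by auto
    moreover have "w ! b' \<noteq> 0" using b'(2) by auto
    ultimately have s: "w ! b' * w ! a < 0" using nz by (simp add: not_less order_less_le)
    have d: "w ! b' dvd w ! a" using comparable[OF b'(1) ab(1) s] b'(2) by simp
    have ne: "\<bar>w ! b'\<bar> \<noteq> \<bar>w ! a\<bar>" using b'(2) by (metis abs_dvd_iff dvd_abs_iff dvd_refl)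
    have "w ! b * w ! b' > 0" using s ab(3) by (auto simp: mult_less_0_iff zero_less_mult_iff)
    from unique[OF b'(1) ab(1) s d ne ab(2) this] show False using b'(2) ab(4) by simp
  qed
qed

lemma filter_singleton_iff:
  "length (filter P w) = 1 \<and> filter P w ! 0 = x \<longleftrightarrow>
    (\<exists>a<length w. w ! a = x \<and> P x \<and> (\<forall>i<length w. i \<noteq> a \<longrightarrow> \<not> P (w ! i)))"
proof
  assume "length (filter P w) = 1 \<and> filter P w ! 0 = x"
  then have "filter P w = [x]" by (cases "filter P w") auto
  then obtain us vs where w: "w = us @ x # vs" "\<forall>u\<in>set us. \<not> P u" "P x" "filter P vs = []"
    by (auto simp: filter_eq_Cons_iff)
  have "\<not> P (w ! i)" if "i < length w" "i \<noteq> length us" for i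
    using that w by (auto simp: nth_append nth_Cons' filter_empty_conv)
  then show "\<exists>a<length w. w ! a = x \<and> P x \<and> (\<forall>i<length w. i \<noteq> a \<longrightarrow> \<not> P (w ! i))"
    using w by (intro exI[of _ "length us"]) auto
next
  assume "\<exists>a<length w. w ! a = x \<and> P x \<and> (\<forall>i<length w. i \<noteq> a \<longrightarrow> \<not> P (w ! i))"
  then obtain a where a: "a < length w" "w ! a = x" "P x" "\<And>i. i < length w \<Longrightarrow> i \<noteq> a \<Longrightarrow> \<not> P (w ! i)" by blast
  have "w = take a w @ x # drop (Suc a) w" using a id_take_nth_drop by blast
  moreover have "filter P (take a w) = []" using a by (auto simp: filter_empty_conv in_set_conv_nth)
  moreover have "filter P (drop (Suc a) w) = []" using a by (auto simp: filter_empty_conv in_set_conv_nth)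
  ultimately have "filter P w = [x]" using a(3) by (metis append_Nil filter.simps(2) filter_append)
  then show "length (filter P w) = 1 \<and> filter P w ! 0 = x" by simp
qed

theorem corollary5p2:
  fixes w r s :: "int list"
  assumes r: "r = sort (filter (\<lambda>k. 0 < k) w)" and d: "length r \<ge> 1"
    and s: "map uminus s = sort (filter (\<lambda>k. k < 0) w)" and e: "length s \<ge> 1"
    and gcd: "Gcd (set r \<union> set s) = 1"
  shows
    "(p_star ` carrier (quot_jet_ring w \<infinity>) = carrier (inv_jet_ring w \<infinity>) \<longleftrightarrow>
        (length r = 1 \<and> r ! 0 = 1 \<or> length s = 1 \<and> s ! 0 = 1) \<or>
        ((\<forall>k\<in>set r. k = 1) \<and> (\<forall>k\<in>set s. k = 1))) \<and>
     (length r = 1 \<and> r ! 0 = 1 \<or> length s = 1 \<and> s ! 0 = 1 \<longrightarrow>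
        (\<forall>ps. generators w ps \<longrightarrow> quot_map ps ` max_rank_points w ps = quot_points ps) \<and>
        (\<forall>m::enat. p_star \<in> ring_iso (quot_jet_ring w m) (inv_jet_ring w m)))"
proof -
  have set_r: "set r = {k \<in> set w. 0 < k}" unfolding r by auto
  have "set (map uminus s) = {k \<in> set w. k < 0}" unfolding s by auto
  then have "uminus ` set (map uminus s) = uminus ` {k \<in> set w. k < 0}" by simp
  then have set_s: "set s = uminus ` {k \<in> set w. k < 0}" by (simp add: image_image)
  have sort1: "sort l = l" if "length l = 1" for l :: "int list" using that by (cases l) auto
  have r1: "length r = 1 \<and> r ! 0 = 1 \<longleftrightarrow> length (filter (\<lambda>k. 0 < k) w) = 1 \<and> filter (\<lambda>k. 0 < k) w ! 0 = 1"
    unfolding r using sort1[of "filter (\<lambda>k. 0 < k) w"] by auto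
  have len_s: "length s = length (filter (\<lambda>k. k < 0) w)" using arg_cong[OF s, of length] by simp
  have s1: "length s = 1 \<and> s ! 0 = 1 \<longleftrightarrow> length (filter (\<lambda>k. k < 0) w) = 1 \<and> filter (\<lambda>k. k < 0) w ! 0 = -1"
  proof (cases "length s = 1")
    case True
    then have "map uminus s = filter (\<lambda>k. k < 0) w" using s sort1 len_s by simp
    from arg_cong[OF this, of "\<lambda>l. l ! 0"] show ?thesis using True len_s by auto
  qed (simp add: len_s)
  define C1 where "C1 \<longleftrightarrow> (\<exists>a<length w. \<bar>w ! a\<bar> = 1 \<and> (\<forall>i<length w. i \<noteq> a \<longrightarrow> w ! i * w ! a \<le> 0))"
  have C1: "length r = 1 \<and> r ! 0 = 1 \<or> length s = 1 \<and> s ! 0 = 1 \<longleftrightarrow> C1"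
    unfolding r1 s1 filter_singleton_iff C1_def by (auto simp: not_less abs_if split: if_splits)
  have C2: "(\<forall>k\<in>set r. k = 1) \<and> (\<forall>k\<in>set s. k = 1) \<longleftrightarrow> (\<forall>i<length w. w ! i \<in> {-1, 0, 1})"
  proof -
    have "(\<forall>k\<in>set r. k = 1) \<and> (\<forall>k\<in>set s. k = 1) \<longleftrightarrow> (\<forall>k\<in>set w. k \<in> {-1, 0, 1})"
      unfolding set_r set_s by force
    then show ?thesis by (simp add: all_set_conv_all_nth)
  qed
  have iso: "\<exists>i0 \<kappa>. unit_weight w i0 \<kappa>" if c1: C1
  proof -
    obtain a where a: "a < length w" "\<bar>w ! a\<bar> = 1" "\<And>i. i < length w \<Longrightarrow> i \<noteq> a \<Longrightarrow> w ! i * w ! a \<le> 0"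
      using c1 unfolding C1_def by blast
    have "w ! a = 1 \<or> w ! a = -1" using a(2) by linarith
    \<comment> \<open>Since w ! a squares to 1, multiplying by it twice recovers w ! i.\<close>
    then have "w ! i = - int (nat (- (w ! i * w ! a))) * w ! a" if "i < length w" "i \<noteq> a" for i
      using a(3)[OF that] by auto
    then have "unit_weight w a (\<lambda>i. nat (- (w ! i * w ! a)))" using a by unfold_locales auto
    then show ?thesis by blast
  qed
  have "jet_image w \<infinity> = carrier (inv_jet_ring w \<infinity>) \<longleftrightarrow> C1 \<or> (\<forall>i<length w. w ! i \<in> {-1, 0, 1})"
  proof
    assume surj: "jet_image w \<infinity> = carrier (inv_jet_ring w \<infinity>)"
    have "set r \<noteq> {}" "set s \<noteq> {}" using d e by auto
    then obtain p q where "p < length w" "w ! p > 0" "q < length w" "w ! q < 0"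
      unfolding set_r set_s by (auto simp: in_set_conv_nth)
    moreover have "c dvd 1" if "\<And>i. i < length w \<Longrightarrow> c dvd w ! i" for c
    proof -
      have "c dvd Gcd (set r \<union> set s)"
        using that unfolding set_r set_s by (intro Gcd_greatest) (auto simp: in_set_conv_nth)
      then show ?thesis unfolding gcd .
    qed
    ultimately show "C1 \<or> (\<forall>i<length w. w ! i \<in> {-1, 0, 1})"
      unfolding C1_def by (intro surjective_imp[OF surj]) auto
  next
    assume "C1 \<or> (\<forall>i<length w. w ! i \<in> {-1, 0, 1})"
    then show "jet_image w \<infinity> = carrier (inv_jet_ring w \<infinity>)"
    proof
      assume C1
      then obtain i0 \<kappa> where "unit_weight w i0 \<kappa>" using iso by blast
      then show ?thesis by (rule unit_weight.jet_image_eq)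
    next
      assume "\<forall>i<length w. w ! i \<in> {-1, 0, 1}"
      then have "unit_weights w" by unfold_locales auto
      then show ?thesis by (rule unit_weights.jet_image_unit_weights)
    qed
  qed
  moreover have "(\<forall>ps. generators w ps \<longrightarrow> quot_map ps ` max_rank_points w ps = quot_points ps) \<and>
        (\<forall>m::enat. p_star \<in> ring_iso (quot_jet_ring w m) (inv_jet_ring w m))" if c1: C1
  proof -
    obtain i0 \<kappa> where u: "unit_weight w i0 \<kappa>" using iso[OF c1] by blast
    show ?thesis using unit_weight.quot_map_max_rank_points[OF u] unit_weight.p_star_iso[OF u] by blast
  qed
  ultimately show ?thesis unfolding p_star_image C1 C2 by blast
qed

end
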